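(* Each holomorphic eta quotient of weight $1/2$ is a rescaling by a positive integer of one of the following fourteen eta quotients (that is, it has the form $z\mapsto g(\nu z)$ with $\nu$ a positive integer and $g$ in this list): $$\eta,\quad \frac{\eta^2}{\eta_2},\quad \frac{\eta_2^2}{\eta},\quad \frac{\eta_2^3}{\eta\,\eta_4},\quad \frac{\eta_2^5}{\eta^2\,\eta_4^2},\quad \frac{\eta\,\eta_4}{\eta_2},\quad \frac{\eta\,\eta_6^2}{\eta_2\,\eta_3},\quad \frac{\eta^2\,\eta_6}{\eta_2\,\eta_3},\quad \frac{\eta_2^2\,\eta_3}{\eta\,\eta_6},\quad \frac{\eta_2\,\eta_3^2}{\eta\,\eta_6},$$ $$\frac{\eta_2^2\,\eta_3\,\eta_{12}}{\eta\,\eta_4\,\eta_6},\quad \frac{\eta_2^5\,\eta_3\,\eta_{12}}{\eta^2\,\eta_4^2\,\eta_6^2},\quad \frac{\eta\,\eta_4\,\eta_6^2}{\eta_2\,\eta_3\,\eta_{12}},\quad \frac{\eta\,\eta_4\,\eta_6^5}{\eta_2^2\,\eta_3^2\,\eta_{12}^2}.$$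
   Context: Let $\mathfrak{H}=\{\tau\in\mathbb{C}:\operatorname{Im}(\tau)>0\}$. The Dedekind eta function is $\eta(z)=e^{\pi i z/12}\prod_{n=1}^\infty(1-e^{2\pi i n z})$ for $z\in\mathfrak{H}$, and for a positive integer $d$, $\eta_d(z):=\eta(dz)$. An eta quotient is a finite product $f=\prod_d \eta_d^{X_d}$ with $d$ positive integers and $X_d\in\mathbb{Z}$; its weight is $\frac12\sum_d X_d$ and its level is $N=\operatorname{lcm}\{d: X_d\neq 0\}$. It transforms like a modular form with a multiplier system on $\Gamma_0(N)$. An eta quotient of level $N$ is called holomorphic if it has no pole at any cusp of $\Gamma_0(N)$. Up to a positive factor, the order of $f$ at a cusp $a/t$ of $\Gamma_0(N)$ with $t\mid N$, $\gcd(a,t)=1$, is $\sum_{d\mid N}\frac{\gcd(d,t)^2}{d}X_d$, so holomorphy means that this sum is $\geq 0$ for every $t\mid N$. The rescaling of $f$ by a positive integer $\nu$ is the function $z\mapsto f(\nu z)$. *)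

theory Defs
  imports "HOL-Complex_Analysis.Complex_Analysis"
begin

text \<open>Only the values on the upper half-plane are meaningful; the product index is shifted
  so that it starts at \<open>n = 1\<close>.\<close>

definition dedekind_eta :: "complex \<Rightarrow> complex" where
  "dedekind_eta z =
     exp (of_real pi * \<i> * z / 12) * (\<Prod>n. 1 - exp (2 * of_real pi * \<i> * of_nat (Suc n) * z))"

definition eta_resc :: "nat \<Rightarrow> complex \<Rightarrow> complex" where
  "eta_resc d z = dedekind_eta (of_nat d * z)"

text \<open>An eta quotient is given by its family of exponents \<open>X\<close>, a finitely supported
  integer-valued function on the positive integers.\<close>

definition eta_exponents :: "(nat \<Rightarrow> int) \<Rightarrow> bool" where
  "eta_exponents X \<longleftrightarrow> finite {d. X d \<noteq> 0} \<and> X 0 = 0"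

definition eta_quotient :: "(nat \<Rightarrow> int) \<Rightarrow> complex \<Rightarrow> complex" where
  "eta_quotient X z = (\<Prod>d | X d \<noteq> 0. eta_resc d z powi X d)"

definition eta_weight :: "(nat \<Rightarrow> int) \<Rightarrow> real" where
  "eta_weight X = of_int (\<Sum>d | X d \<noteq> 0. X d) / 2"

definition eta_level :: "(nat \<Rightarrow> int) \<Rightarrow> nat" where
  "eta_level X = Lcm {d. X d \<noteq> 0}"

definition slash :: "real \<Rightarrow> int \<Rightarrow> int \<Rightarrow> int \<Rightarrow> int \<Rightarrow> (complex \<Rightarrow> complex) \<Rightarrow> complex \<Rightarrow> complex" where
  "slash k a b c d f z =
     (of_int c * z + of_int d) powr (- of_real k) *
     f ((of_int a * z + of_int b) / (of_int c * z + of_int d))"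

text \<open>Let \<open>f\<close> be an eta quotient of level \<open>N\<close> and weight \<open>k\<close>, and let
  \<open>a * d - b * c = 1\<close>. The cusp in question is the image \<open>a / c\<close> of \<open>\<infinity>\<close> (so \<open>\<infinity>\<close> itself
  if \<open>c = 0\<close>). As \<open>slash k a b c d f\<close> is periodic with period \<open>24 * N\<close>, it is a function
  of the local parameter \<open>q = exp (2 \<pi> \<i> z / (24 N))\<close>, and the cusp corresponds to \<open>q = 0\<close>.
  By periodicity the choice of the branch of the logarithm used to recover \<open>z\<close>
  from \<open>q\<close> is immaterial, and so is the branch of the power in \<open>slash\<close>.\<close>

definition eta_quotient_pole_at_cusp ::
    "(nat \<Rightarrow> int) \<Rightarrow> int \<Rightarrow> int \<Rightarrow> int \<Rightarrow> int \<Rightarrow> bool" where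
  "eta_quotient_pole_at_cusp X a b c d \<longleftrightarrow>
     is_pole (\<lambda>q. slash (eta_weight X) a b c d (eta_quotient X)
                    (of_nat (24 * eta_level X) * Ln q / (2 * of_real pi * \<i>))) 0"

text \<open>Every cusp of \<open>\<Gamma>\<^sub>0(N)\<close> is represented by the image of \<open>\<infinity>\<close> under some element of
  \<open>SL\<^sub>2(\<int>)\<close>.\<close>

definition holomorphic_eta_quotient :: "(nat \<Rightarrow> int) \<Rightarrow> bool" where
  "holomorphic_eta_quotient X \<longleftrightarrow>
     (\<forall>a b c d. a * d - b * c = 1 \<longrightarrow> \<not> eta_quotient_pole_at_cusp X a b c d)"

definition zagier_list :: "(complex \<Rightarrow> complex) list" where
  "zagier_list =
    [\<lambda>z. eta_resc 1 z,
     \<lambda>z. eta_resc 1 z ^ 2 / eta_resc 2 z,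
     \<lambda>z. eta_resc 2 z ^ 2 / eta_resc 1 z,
     \<lambda>z. eta_resc 2 z ^ 3 / (eta_resc 1 z * eta_resc 4 z),
     \<lambda>z. eta_resc 2 z ^ 5 / (eta_resc 1 z ^ 2 * eta_resc 4 z ^ 2),
     \<lambda>z. eta_resc 1 z * eta_resc 4 z / eta_resc 2 z,
     \<lambda>z. eta_resc 1 z * eta_resc 6 z ^ 2 / (eta_resc 2 z * eta_resc 3 z),
     \<lambda>z. eta_resc 1 z ^ 2 * eta_resc 6 z / (eta_resc 2 z * eta_resc 3 z),
     \<lambda>z. eta_resc 2 z ^ 2 * eta_resc 3 z / (eta_resc 1 z * eta_resc 6 z),
     \<lambda>z. eta_resc 2 z * eta_resc 3 z ^ 2 / (eta_resc 1 z * eta_resc 6 z),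
     \<lambda>z. eta_resc 2 z ^ 2 * eta_resc 3 z * eta_resc 12 z /
           (eta_resc 1 z * eta_resc 4 z * eta_resc 6 z),
     \<lambda>z. eta_resc 2 z ^ 5 * eta_resc 3 z * eta_resc 12 z /
           (eta_resc 1 z ^ 2 * eta_resc 4 z ^ 2 * eta_resc 6 z ^ 2),
     \<lambda>z. eta_resc 1 z * eta_resc 4 z * eta_resc 6 z ^ 2 /
           (eta_resc 2 z * eta_resc 3 z * eta_resc 12 z),
     \<lambda>z. eta_resc 1 z * eta_resc 4 z * eta_resc 6 z ^ 5 /
           (eta_resc 2 z ^ 2 * eta_resc 3 z ^ 2 * eta_resc 12 z ^ 2)]"

end

theory Submission
  imports Defs
begin

text \<open>An eta quotient is determined by its exponents \<open>X\<close>, and holomorphy at the cusp \<open>1 / t\<close>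
means that the order \<open>\<Sum>d. X d * gcd(d, t)\<^sup>2 / d\<close> is nonnegative. The proof has an analytic half, which
derives these inequalities from the absence of poles, and a combinatorial half, which finds all
integral \<open>X\<close> of total sum \<open>1\<close> that satisfy them for every \<open>t > 0\<close>.

The analytic half uses only the asymptotics of \<open>\<eta>\<close> at a rational point, not its transformation law.
The logarithm of \<open>\<Prod>n. 1 - q ^ n\<close> is \<open>- (\<Sum>m. q ^ m / (m * (1 - q ^ m)))\<close>. When \<open>z\<close> tends to
\<open>\<i>\<infinity>\<close> in a vertical strip, \<open>d * z / (t * z + 1)\<close> tends to \<open>d / t\<close> inside an angle. After division by
\<open>Im z\<close> only the terms with \<open>t dvd d * m\<close> survive, and they add up to a multiple of \<open>\<zeta>(2)\<close>; Tannery's theorem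
justifies the termwise limit (\<open>log_eta_series_limit\<close>). A negative order at \<open>1 / t\<close> therefore makes the
transformed function grow exponentially in \<open>Im z\<close>, which is a pole in the local parameter
(\<open>holomorphic_cusp_order_nonneg\<close>).

For the combinatorial half, real exponent families are allowed, and \<open>holo Q A\<close> says that \<open>A\<close> is supported on
numbers with all prime factors in \<open>Q\<close> and has nonnegative orders. The matrix \<open>gcd(d, t)\<^sup>2 / d\<close> is a tensor
product over the primes, with the factor \<open>p powi (i - \<bar>i - j\<bar>)\<close> at the prime \<open>p\<close>. So for a prime \<open>p\<close> a family
splits into rows according to the exponent of \<open>p\<close>, and the combination of the rows with coefficients
\<open>p powi - \<bar>i - j\<bar>\<close> is again holomorphic. The constant function \<open>1\<close> is a positive combination of these kernels
(this is the valence formula), and the indicator function of a row is a short signed combination of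
them, since the one-prime matrix has a tridiagonal inverse.

This gives a norm: \<open>holo_diff Q T r\<close> says that \<open>T = A - B\<close> with \<open>A\<close> and \<open>B\<close> holomorphic and of total weight at most
\<open>r\<close>. If \<open>T\<close> occupies several rows, then its lowest and its highest row are controlled by mostly disjoint parts of
the total weight, so \<open>r\<close> is bounded below by a multiple of the sum of the norms of these two rows
(\<open>outer_slices\<close>). Induction over the primes shows that a nonzero integral \<open>T\<close> has norm at least \<open>2 / 3\<close>
(\<open>norm_ge_two_thirds\<close>). A holomorphic \<open>X\<close> of weight \<open>1\<close>, which here stands for modular weight \<open>1 / 2\<close>, has norm
\<open>1\<close>, so at a prime \<open>p \<ge> 5\<close> it can have only one row, and up to rescaling only the primes \<open>2\<close> and \<open>3\<close> matter.

On powers of \<open>2\<close> the same estimates leave six integral families of weight \<open>1\<close> (\<open>unit_dyadic\<close>) and, up to sign,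
two families of weight \<open>0\<close> and norm at most \<open>3 / 4\<close> (\<open>null_dyadic\<close>). At the prime \<open>3\<close> there is one row of weight
\<open>1\<close>, and every other outer row is adjacent to it and of this second kind. One such row can be attached in eight
ways (\<open>unit_row_with_null_row\<close>) and two cannot be attached (\<open>no_two_null_rows\<close>). The six families
without and the eight with an attached row make up the list of fourteen.\<close>

section \<open>Growth of eta quotients at the cusps\<close>

text \<open>Expand \<open>Ln (1 - q ^ n)\<close> in powers of \<open>q ^ n\<close> and sum over \<open>n\<close> first: the inner sums are geometric. This order of
summation isolates the singular behaviour at each root of unity in single terms.\<close>

lemma log_euler_product:
  fixes q :: complex
  assumes q: "norm q < 1"
  shows "(\<Prod>n. 1 - q ^ Suc n) = exp (- (\<Sum>m. q ^ Suc m / (of_nat (Suc m) * (1 - q ^ Suc m))))"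
proof -
  define f where "f n m = q ^ (Suc n * Suc m) / of_nat (Suc m)" for n m
  have small: "norm (q ^ Suc n) < 1" for n
    using q by (simp add: norm_power power_less_one_iff del: power_Suc)
  have row: "f n sums (- Ln (1 - q ^ Suc n))" for n
  proof -
    have "(\<lambda>k. - ((q ^ Suc n) ^ k) / of_nat k) sums Ln (1 - q ^ Suc n)"
      using Ln_series'[of "- (q ^ Suc n)"] small[of n] by (simp del: power_Suc)
    then have "(\<lambda>k. - ((q ^ Suc n) ^ Suc k) / of_nat (Suc k)) sums Ln (1 - q ^ Suc n)"
      by (subst sums_Suc_iff) simp
    from sums_minus[OF this] show ?thesis unfolding f_def power_mult by (simp del: power_Suc of_nat_Suc)
  qed
  have col: "(\<lambda>n. f n m) sums (q ^ Suc m / (of_nat (Suc m) * (1 - q ^ Suc m)))" for m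
  proof -
    have "(\<lambda>n. q ^ Suc m / of_nat (Suc m) * (q ^ Suc m) ^ n) sums (q ^ Suc m / of_nat (Suc m) * (1 / (1 - q ^ Suc m)))"
      by (intro sums_mult geometric_sums small)
    moreover have "f n m = q ^ Suc m / of_nat (Suc m) * (q ^ Suc m) ^ n" for n
      unfolding f_def by (simp add: power_mult[symmetric] power_add[symmetric] algebra_simps)
    ultimately show ?thesis by simp
  qed
  have geo: "(\<lambda>n. norm q ^ n) summable_on UNIV"
    using norm_summable_imp_summable_on[of "\<lambda>n. norm q ^ n"] q by (simp add: summable_geometric)
  have "(\<lambda>x. norm (case x of (n, m) \<Rightarrow> q ^ n * q ^ m)) summable_on UNIV \<times> UNIV"
    unfolding Infinite_Sum.abs_summable_on_Sigma_iff
  proof (intro conjI ballI)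
    show "(\<lambda>m. norm (case (n, m) of (n, m) \<Rightarrow> q ^ n * q ^ m)) summable_on UNIV" for n
      using summable_on_cmult_right[OF geo, of "norm q ^ n"] by (simp add: norm_mult norm_power)
    have "(\<lambda>n. norm q ^ n * (\<Sum>\<^sub>\<infinity>m. norm q ^ m)) summable_on UNIV"
      by (rule summable_on_cmult_left[OF geo])
    then show "(\<lambda>n. norm (\<Sum>\<^sub>\<infinity>m. norm (case (n, m) of (n, m) \<Rightarrow> q ^ n * q ^ m))) summable_on UNIV"
      by (simp add: norm_mult norm_power infsum_cmult_right' abs_mult infsum_nonneg)
  qed
  then have dbl: "(\<lambda>x. norm (case x of (n, m) \<Rightarrow> f n m)) summable_on UNIV \<times> UNIV"
  proof (rule Infinite_Sum.abs_summable_on_comparison_test)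
    fix x :: "nat \<times> nat" assume "x \<in> UNIV \<times> UNIV"
    obtain n m where x: "x = (n, m)" by (cases x)
    have "norm q ^ (Suc n * Suc m) / Suc m \<le> norm q ^ (Suc n * Suc m) / 1"
      by (rule divide_left_mono) auto
    also have "\<dots> = norm q ^ (Suc n * Suc m)" by simp
    also have "\<dots> \<le> norm q ^ (n + m)" by (rule power_decreasing) (use q in auto)
    finally show "norm (case x of (n, m) \<Rightarrow> f n m) \<le> norm (case x of (n, m) \<Rightarrow> q ^ n * q ^ m)"
      unfolding x f_def by (simp add: norm_divide norm_power norm_mult power_add del: power_Suc of_nat_Suc)
  qed
  then have sm: "(\<lambda>(n, m). f n m) summable_on UNIV \<times> UNIV" by (rule abs_summable_summable)
  then have sm': "(\<lambda>(m, n). f n m) summable_on UNIV \<times> UNIV"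
    by (subst (asm) summable_on_swap) simp
  have rows: "(\<Sum>\<^sub>\<infinity>m. f n m) = - Ln (1 - q ^ Suc n)" for n
  proof -
    have "f n summable_on UNIV" using summable_on_SigmaD1[OF sm] by simp
    then show ?thesis using row by (metis has_sum_imp_sums has_sum_infsum sums_unique2)
  qed
  have cols: "(\<Sum>\<^sub>\<infinity>n. f n m) = q ^ Suc m / (of_nat (Suc m) * (1 - q ^ Suc m))" for m
  proof -
    have "(\<lambda>n. f n m) summable_on UNIV" using summable_on_SigmaD1[OF sm'] by simp
    then show ?thesis using col by (metis has_sum_imp_sums has_sum_infsum sums_unique2)
  qed
  have "(\<lambda>n. \<Sum>\<^sub>\<infinity>m. f n m) summable_on UNIV" using summable_on_Sigma_banach[OF sm] by simp
  then have 1: "(\<lambda>n. - Ln (1 - q ^ Suc n)) sums (\<Sum>\<^sub>\<infinity>n. \<Sum>\<^sub>\<infinity>m. f n m)"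
    unfolding rows by (intro has_sum_imp_sums has_sum_infsum)
  have "(\<lambda>m. \<Sum>\<^sub>\<infinity>n. f n m) summable_on UNIV" using summable_on_Sigma_banach[OF sm'] by simp
  then have 2: "(\<lambda>m. q ^ Suc m / (of_nat (Suc m) * (1 - q ^ Suc m))) sums (\<Sum>\<^sub>\<infinity>m. \<Sum>\<^sub>\<infinity>n. f n m)"
    unfolding cols by (intro has_sum_imp_sums has_sum_infsum)
  have 3: "(\<Sum>\<^sub>\<infinity>n. \<Sum>\<^sub>\<infinity>m. f n m) = (\<Sum>\<^sub>\<infinity>m. \<Sum>\<^sub>\<infinity>n. f n m)"
    using infsum_swap_banach[OF sm] by simp
  have nz: "1 - q ^ Suc n \<noteq> 0" for n using small[of n] by auto
  have "(\<lambda>n. Ln (1 - q ^ Suc n)) sums (- (\<Sum>m. q ^ Suc m / (of_nat (Suc m) * (1 - q ^ Suc m))))"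
    using sums_minus[OF 1] sums_unique[OF 2] unfolding 3 by simp
  then have "(\<Prod>n. exp (Ln (1 - q ^ Suc n))) = exp (- (\<Sum>m. q ^ Suc m / (of_nat (Suc m) * (1 - q ^ Suc m))))"
    by (subst prodinf_exp) (auto simp: sums_iff)
  then show ?thesis using nz by simp
qed

text \<open>Minus the logarithm of the infinite product in the definition of \<open>\<eta>\<close>.\<close>

definition log_eta_series :: "complex \<Rightarrow> complex" where
  "log_eta_series w = (\<Sum>m. exp (2 * of_real pi * \<i> * w) ^ Suc m /
     (of_nat (Suc m) * (1 - exp (2 * of_real pi * \<i> * w) ^ Suc m)))"

lemma dedekind_eta_exp:
  assumes "Im w > 0"
  shows "dedekind_eta w = exp (of_real pi * \<i> * w / 12 - log_eta_series w)"
proof -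
  let ?q = "exp (2 * of_real pi * \<i> * w)"
  have "norm ?q < 1" using assms by simp
  moreover have "exp (2 * of_real pi * \<i> * of_nat (Suc n) * w) = ?q ^ Suc n" for n
    by (subst exp_of_nat_mult[symmetric]) (simp add: algebra_simps)
  ultimately show ?thesis
    unfolding dedekind_eta_def log_eta_series_def by (simp only: log_euler_product exp_diff exp_minus divide_inverse)
qed

text \<open>A majorant whose dependence on \<open>m\<close> is summable and whose dependence on \<open>w\<close> is exactly the expected order of growth
\<open>1 / Im w\<close>. It comes from \<open>x \<le> exp x - 1\<close>.\<close>

lemma geometric_bound:
  assumes "Im w > 0"
  shows "norm (exp (2 * of_real pi * \<i> * w) ^ Suc m / (of_nat (Suc m) * (1 - exp (2 * of_real pi * \<i> * w) ^ Suc m)))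
      \<le> 1 / (2 * pi * real (Suc m) ^ 2 * Im w)"
proof -
  let ?q = "exp (2 * of_real pi * \<i> * w)"
  define x where "x = 2 * pi * real (Suc m) * Im w"
  have x: "x > 0" using assms by (simp add: x_def)
  have n: "norm (?q ^ Suc m) = exp (- x)"
    unfolding norm_power by (subst norm_exp_eq_Re, subst exp_of_nat_mult[symmetric]) (simp add: x_def algebra_simps)
  have "1 + x \<le> exp x" by (rule exp_ge_add_one_self)
  then have "x \<le> exp x - 1" by linarith
  then have "x * exp (- x) \<le> (exp x - 1) * exp (- x)" by (rule mult_right_mono) simp
  also have "\<dots> = 1 - exp (- x)" by (simp add: algebra_simps exp_minus)
  finally have 1: "x * exp (- x) \<le> 1 - exp (- x)" .
  have 2: "1 - exp (- x) \<le> norm (1 - ?q ^ Suc m)"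
    using norm_triangle_ineq2[of 1 "?q ^ Suc m"] n by simp
  have 3: "0 < 1 - exp (- x)" using x by simp
  have "norm (?q ^ Suc m / (of_nat (Suc m) * (1 - ?q ^ Suc m))) = exp (- x) / (real (Suc m) * norm (1 - ?q ^ Suc m))"
    by (simp add: norm_divide norm_mult n del: power_Suc of_nat_Suc)
  also have "\<dots> \<le> exp (- x) / (real (Suc m) * (1 - exp (- x)))"
    using 2 3 by (intro divide_left_mono mult_left_mono mult_pos_pos) auto
  also have "\<dots> \<le> 1 / (real (Suc m) * x)"
    using 1 3 x by (simp add: divide_simps mult.commute del: of_nat_Suc)
  also have "real (Suc m) * x = 2 * pi * real (Suc m) ^ 2 * Im w"
    by (simp add: x_def power2_eq_square)
  finally show ?thesis .
qed

text \<open>With \<open>g = gcd d t\<close>, the indices that occur are the multiples of \<open>t div g\<close>, so this is \<open>\<zeta>(2)\<close> rescaled. The factor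
\<open>gcd(d, t)\<^sup>2 / d\<close> of the order at a cusp originates here.\<close>

lemma sums_multiples:
  fixes d t :: nat
  assumes "d > 0" "t > 0"
  shows "(\<lambda>k. if t dvd d * Suc k then real t ^ 2 / (2 * pi * d * real (Suc k) ^ 2) else 0)
     sums (pi * real (gcd d t) ^ 2 / (12 * d))"
proof -
  define g h where "g = gcd d t" and "h = t div g"
  have g: "g > 0" "t = g * h" using assms by (auto simp: g_def h_def)
  then have h: "h > 0" using assms by (cases h) auto
  have dv: "t dvd d * n \<longleftrightarrow> h dvd n" for n
  proof -
    obtain e where e: "d = g * e" using g_def by (metis dvdE gcd_dvd1)
    have "coprime e h" using e g assms(1) by (metis g_def gcd_mult_distrib_nat coprime_iff_gcd_eq_1 mult_cancel1 mult.right_neutral neq0_conv)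
    then show ?thesis using g e by (simp add: mult.assoc coprime_dvd_mult_right_iff coprime_commute)
  qed
  let ?f = "\<lambda>n. real t ^ 2 / (2 * pi * d * real n ^ 2)"
  have "(\<lambda>n. 1 / (real n + 1)\<^sup>2) sums (pi\<^sup>2 / 6)" using inverse_squares_sums by (simp add: add.commute)
  from sums_mult[OF this, of "real g ^ 2 / (2 * pi * d)"]
  moreover have "?f (h * Suc n) = real g ^ 2 / (2 * pi * d) * (1 / (real n + 1)\<^sup>2)" for n
  proof -
    have "(a * b)\<^sup>2 / (2 * pi * e * (b * s)\<^sup>2) = a\<^sup>2 / (2 * pi * e) * (1 / s\<^sup>2)" if "b \<noteq> 0" for a b e s :: real
      using that by (simp add: power_mult_distrib)
    from this[of "real h" "real g" "real d" "real n + 1"] show ?thesis using g h by (simp add: add.commute distrib_left)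
  qed
  moreover have "real g ^ 2 / (2 * pi * d) * (pi\<^sup>2 / 6) = pi * real g ^ 2 / (12 * d)"
    by (simp add: power2_eq_square)
  ultimately have "(\<lambda>n. ?f (h * Suc n)) sums (pi * real g ^ 2 / (12 * d))" by (simp only:)
  then have "((\<lambda>n. ?f (h * Suc n)) has_sum (pi * real g ^ 2 / (12 * d))) UNIV"
    by (rule sums_nonneg_imp_has_sum) simp
  moreover have "inj (\<lambda>n. h * Suc n - 1)"
    using h by (intro injI) (metis Suc_diff_1 mult_cancel1 mult_pos_pos neq0_conv old.nat.inject zero_less_Suc)
  moreover have "Suc (h * Suc n - 1) = h * Suc n" for n using h by simp
  ultimately have "((\<lambda>k. ?f (Suc k)) has_sum (pi * real g ^ 2 / (12 * d))) (range (\<lambda>n. h * Suc n - 1))"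
    by (subst has_sum_reindex) (simp_all add: o_def del: of_nat_Suc of_nat_mult mult_Suc_right)
  then have "((\<lambda>k. if t dvd d * Suc k then ?f (Suc k) else 0) has_sum (pi * real g ^ 2 / (12 * d))) UNIV"
  proof (subst (asm) has_sum_cong_neutral)
    fix k assume k: "k \<in> UNIV - range (\<lambda>n. h * Suc n - 1)"
    have "\<not> h dvd Suc k"
    proof
      assume "h dvd Suc k"
      \<comment> \<open>The summation index is shifted by one, so the multiples of h are the numbers Suc k.\<close>
      then obtain n where n: "Suc k = h * n" by (auto elim: dvdE)
      then obtain n' where "n = Suc n'" by (cases n) auto
      then have "k = h * Suc n' - 1" using n by simp
      then show False using k by blast
    qed
    then show "(if t dvd d * Suc k then ?f (Suc k) else 0) = 0" unfolding dv by (simp only: if_False)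
  next
    fix k assume "k \<in> range (\<lambda>n. h * Suc n - 1) \<inter> UNIV"
    then obtain n where "k = h * Suc n - 1" by auto
    then have "Suc k = h * Suc n" using h by simp
    then have "h dvd Suc k" by simp
    then show "?f (Suc k) = (if t dvd d * Suc k then ?f (Suc k) else 0)" unfolding dv by (simp only: if_True)
  qed auto
  then show ?thesis unfolding g_def by (rule has_sum_imp_sums)
qed

lemma tendsto_exp_quotient:
  fixes u :: "'a \<Rightarrow> complex"
  assumes "filterlim u (at 0) F"
  shows "((\<lambda>x. (exp (u x) - 1) / u x) \<longlongrightarrow> 1) F"
proof -
  have "((\<lambda>h. (exp h - 1) / h) \<longlongrightarrow> 1) (at (0::complex))"
    using DERIV_exp[of "0::complex"] by (simp add: has_field_derivative_iff)
  from filterlim_compose[OF this assms] show ?thesis .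
qed

lemma exp_rational_eq_1:
  assumes "t > 0" shows "exp (2 * of_real pi * \<i> * of_nat m / of_nat t) = 1 \<longleftrightarrow> t dvd m"
proof -
  have "Im (2 * of_real pi * \<i> * of_nat m / of_nat t) = 2 * pi * (real m / real t)"
    by (simp add: Im_divide_of_nat)
  moreover have "Re (2 * of_real pi * \<i> * of_nat m / of_nat t) = 0"
    by (simp add: Re_divide_of_nat)
  ultimately have "exp (2 * of_real pi * \<i> * of_nat m / of_nat t) = 1
      \<longleftrightarrow> (\<exists>n::int. 2 * pi * (real m / real t) = of_int (2 * n) * pi)"
    unfolding exp_eq_1 by presburger
  also have "\<dots> \<longleftrightarrow> (\<exists>n::int. real m = of_int n * real t)"
    using assms by (simp add: field_simps)
  also have "\<dots> \<longleftrightarrow> (\<exists>n::int. int m = n * int t)"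
    by (metis (mono_tags, opaque_lifting) of_int_eq_iff of_int_mult of_int_of_nat_eq)
  also have "\<dots> \<longleftrightarrow> t dvd m"
    by (metis dvd_def int_dvd_int_iff mult.commute)
  finally show ?thesis .
qed

lemma ln_power_int:
  assumes "(x::real) > 0" shows "ln (x powi k) = of_int k * ln x"
  using assms by (cases "k \<ge> 0") (auto simp: power_int_def ln_realpow ln_inverse)

text \<open>The approach to a cusp: \<open>z\<close> tends to \<open>\<i>\<infinity>\<close> inside a vertical strip along an arbitrary filter. For the
local parameter \<open>q\<close> the filter is \<open>at 0\<close>, and the strip appears because the argument of \<open>q\<close> is bounded.\<close>

locale vertical_approach =
  fixes z :: "'a \<Rightarrow> complex" and F :: "'a filter" and B :: real
  assumes Im_top: "filterlim (\<lambda>x. Im (z x)) at_top F"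
    and Re_bounded: "eventually (\<lambda>x. \<bar>Re (z x)\<bar> \<le> B) F"
    and nontrivial: "F \<noteq> bot"
begin

lemma Im_pos: "eventually (\<lambda>x. Im (z x) > 0) F"
  using filterlim_at_top_dense[THEN iffD1, OF Im_top] by blast

lemma inverse_Im: "((\<lambda>x. 1 / Im (z x)) \<longlongrightarrow> 0) F"
  using tendsto_inverse_0_at_top[OF Im_top] by (simp add: inverse_eq_divide)

lemma inverse_Im_complex: "((\<lambda>x. 1 / of_real (Im (z x)) :: complex) \<longlongrightarrow> 0) F"
  using tendsto_of_real[OF inverse_Im, where 'a = complex] by simp

lemma Re_over_Im: "((\<lambda>x. Re (z x) / Im (z x)) \<longlongrightarrow> 0) F"
proof (rule Lim_null_comparison)
  show "eventually (\<lambda>x. norm (Re (z x) / Im (z x)) \<le> B * (1 / Im (z x))) F"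
    using Im_pos Re_bounded
  proof eventually_elim
    case (elim x)
    then show ?case by (simp add: abs_div divide_right_mono)
  qed
  show "((\<lambda>x. B * (1 / Im (z x))) \<longlongrightarrow> 0) F"
    using tendsto_mult_left[OF inverse_Im, of B] by simp
qed

lemma over_Im: "((\<lambda>x. z x / of_real (Im (z x))) \<longlongrightarrow> \<i>) F"
proof -
  have "((\<lambda>x. of_real (Re (z x) / Im (z x)) + \<i>) \<longlongrightarrow> of_real 0 + \<i>) F"
    by (intro tendsto_add tendsto_of_real Re_over_Im tendsto_const)
  moreover have "eventually (\<lambda>x. of_real (Re (z x) / Im (z x)) + \<i> = z x / of_real (Im (z x))) F"
    using Im_pos
  proof eventually_elim
    case (elim x)
    then show ?case by (subst (3) complex_eq[of "z x"]) (simp add: field_simps)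
  qed
  ultimately show ?thesis by (simp add: filterlim_cong)
qed

lemma affine_over_Im: "((\<lambda>x. (of_nat t * z x + 1) / of_real (Im (z x))) \<longlongrightarrow> of_nat t * \<i>) F"
proof -
  have "((\<lambda>x. of_nat t * (z x / of_real (Im (z x))) + 1 / of_real (Im (z x))) \<longlongrightarrow> of_nat t * \<i> + 0) F"
    by (intro tendsto_add tendsto_mult over_Im tendsto_const inverse_Im_complex)
  then show ?thesis by (simp add: add_divide_distrib)
qed

context
  fixes d t :: nat
  assumes d: "d > 0" and t: "t > 0"
begin

text \<open>The argument at which \<open>\<eta>\<close> is evaluated; \<open>cusp_offset\<close> is its distance from the rational number \<open>d / t\<close>.\<close>

definition cusp_point :: "'a \<Rightarrow> complex" where
  "cusp_point x = of_nat d * (z x / (of_nat t * z x + 1))"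

definition cusp_offset :: "'a \<Rightarrow> complex" where
  "cusp_offset x = - of_nat d / (of_nat t * (of_nat t * z x + 1))"

lemma affine_nonzero: "Im (z x) > 0 \<Longrightarrow> of_nat t * z x + 1 \<noteq> 0"
  using t by (auto simp: complex_eq_iff)

lemma cusp_point_eq:
  assumes "Im (z x) > 0" shows "cusp_point x = of_nat d / of_nat t + cusp_offset x"
  using affine_nonzero[OF assms] t unfolding cusp_point_def cusp_offset_def
  by (simp add: divide_simps) (simp add: algebra_simps)

lemma Im_cusp_point:
  assumes "Im (z x) > 0"
  shows "Im (cusp_point x) = d * Im (z x) / (norm (of_nat t * z x + 1))\<^sup>2"
proof -
  have "Im (z x / (of_nat t * z x + 1)) = Im (z x) / (norm (of_nat t * z x + 1))\<^sup>2"
    unfolding Im_divide cmod_power2 by (simp add: algebra_simps)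
  moreover have "Im (of_nat d * w) = real d * Im w" for w by simp
  ultimately have "Im (cusp_point x) = real d * (Im (z x) / (norm (of_nat t * z x + 1))\<^sup>2)"
    by (simp only: cusp_point_def)
  then show ?thesis by simp
qed

lemma Im_cusp_point_pos: "Im (z x) > 0 \<Longrightarrow> Im (cusp_point x) > 0"
  using Im_cusp_point d affine_nonzero by simp

text \<open>The limit is a positive multiple of \<open>\<i>\<close>: the rational point is approached vertically, hence inside an angle. This is what
keeps the majorant of the series in balance with its terms.\<close>

lemma cusp_offset_times_Im: "((\<lambda>x. cusp_offset x * of_real (Im (z x))) \<longlongrightarrow> of_nat d * \<i> / of_nat t ^ 2) F"
proof -
  have "((\<lambda>x. - of_nat d / (of_nat t * ((of_nat t * z x + 1) / of_real (Im (z x)))))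
      \<longlongrightarrow> - of_nat d / (of_nat t * (of_nat t * \<i>))) F"
    by (intro tendsto_divide tendsto_const tendsto_mult affine_over_Im) (use t in auto)
  moreover have "- of_nat d / (of_nat t * (of_nat t * \<i>)) = of_nat d * \<i> / (of_nat t ^ 2 :: complex)"
    using t by (simp add: field_simps power2_eq_square)
  moreover have "eventually (\<lambda>x. - of_nat d / (of_nat t * ((of_nat t * z x + 1) / of_real (Im (z x))))
      = cusp_offset x * of_real (Im (z x))) F"
    using Im_pos
  proof eventually_elim
    case (elim x)
    then show ?case using t affine_nonzero[OF elim] by (simp add: cusp_offset_def divide_simps)
  qed
  ultimately show ?thesis by (simp add: filterlim_cong)
qed

lemma cusp_offset_tendsto: "(cusp_offset \<longlongrightarrow> 0) F"
proof -
  have "((\<lambda>x. cusp_offset x * of_real (Im (z x)) * (1 / of_real (Im (z x)))) \<longlongrightarrow> of_nat d * \<i> / of_nat t ^ 2 * 0) F"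
    by (intro tendsto_mult cusp_offset_times_Im inverse_Im_complex)
  moreover have "eventually (\<lambda>x. cusp_offset x * of_real (Im (z x)) * (1 / of_real (Im (z x))) = cusp_offset x) F"
    using Im_pos by eventually_elim simp
  ultimately show ?thesis by (simp add: filterlim_cong)
qed

definition q_power :: "nat \<Rightarrow> 'a \<Rightarrow> complex" where
  "q_power m x = exp (2 * of_real pi * \<i> * cusp_point x) ^ Suc m"

lemma q_power_eq:
  assumes "Im (z x) > 0"
  shows "q_power m x = exp (2 * of_real pi * \<i> * of_nat (d * Suc m) / of_nat t) *
    exp (2 * of_real pi * \<i> * of_nat (Suc m) * cusp_offset x)"
  unfolding q_power_def cusp_point_eq[OF assms] exp_of_nat_mult[symmetric] exp_add[symmetric]
  by (simp add: algebra_simps)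

text \<open>If \<open>t dvd d * Suc m\<close>, then \<open>q ^ Suc m\<close> tends to \<open>1\<close> and the term has a pole whose residue gives the limit; otherwise
\<open>q ^ Suc m\<close> tends to another root of unity and the division by \<open>Im z\<close> annihilates the term.\<close>

lemma term_limit:
  "((\<lambda>x. q_power m x / (of_nat (Suc m) * (1 - q_power m x)) / of_real (Im (z x))) \<longlongrightarrow>
     of_real (if t dvd d * Suc m then real t ^ 2 / (2 * pi * d * real (Suc m) ^ 2) else 0)) F"
proof -
  define \<zeta> where "\<zeta> = exp (2 * of_real pi * \<i> * of_nat (d * Suc m) / of_nat t)"
  define c :: complex where "c = 2 * of_real pi * \<i> * of_nat (Suc m)"
  have c: "c \<noteq> 0" by (simp add: c_def del: of_nat_Suc)
  have qe: "eventually (\<lambda>x. q_power m x = \<zeta> * exp (c * cusp_offset x)) F"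
    using Im_pos by eventually_elim (simp only: q_power_eq \<zeta>_def c_def)
  have co: "((\<lambda>x. c * cusp_offset x) \<longlongrightarrow> 0) F" using tendsto_mult_left[OF cusp_offset_tendsto, of c] by simp
  then have ex: "((\<lambda>x. exp (c * cusp_offset x)) \<longlongrightarrow> 1) F" using tendsto_exp[OF co] by simp
  show ?thesis
  proof (cases "t dvd d * Suc m")
    case True
    then have z1: "\<zeta> = 1" unfolding \<zeta>_def using exp_rational_eq_1[OF t] by blast
    have off: "cusp_offset x \<noteq> 0" if "Im (z x) > 0" for x
      using affine_nonzero[OF that] d t by (simp add: cusp_offset_def)
    have "filterlim (\<lambda>x. c * cusp_offset x) (at 0) F"
      using co Im_pos off c by (auto simp: filterlim_at elim!: eventually_mono)
    note quot = tendsto_exp_quotient[OF this]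
    let ?g = "\<lambda>x. exp (c * cusp_offset x) / (of_nat (Suc m) * (- ((exp (c * cusp_offset x) - 1) / (c * cusp_offset x)))
        * (c * (cusp_offset x * of_real (Im (z x)))))"
    let ?l = "1 / (of_nat (Suc m) * (- 1) * (c * (of_nat d * \<i> / of_nat t ^ 2)))"
    have "(?g \<longlongrightarrow> ?l) F"
      by (intro tendsto_divide tendsto_mult tendsto_minus tendsto_const ex quot cusp_offset_times_Im)
         (use c d t in \<open>simp del: of_nat_Suc\<close>)
    moreover have "?l = of_real (real t ^ 2 / (2 * pi * d * real (Suc m) ^ 2))"
      using d t unfolding c_def by (simp add: divide_simps power2_eq_square del: of_nat_Suc)
    moreover have "eventually (\<lambda>x. ?g x = q_power m x / (of_nat (Suc m) * (1 - q_power m x)) / of_real (Im (z x))) F"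
      using Im_pos qe
    proof eventually_elim
      case (elim x)
      have "c * cusp_offset x \<noteq> 0" using off[OF elim(1)] c by simp
      then have "of_nat (Suc m) * (- ((exp (c * cusp_offset x) - 1) / (c * cusp_offset x))) * (c * (cusp_offset x * of_real (Im (z x))))
          = of_nat (Suc m) * (1 - exp (c * cusp_offset x)) * of_real (Im (z x))"
        by (simp add: field_simps del: of_nat_Suc)
      then show ?case unfolding elim(2) z1 by simp
    qed
    ultimately show ?thesis using True by (simp add: filterlim_cong del: of_nat_Suc)
  next
    case False
    then have z1: "\<zeta> \<noteq> 1" unfolding \<zeta>_def using exp_rational_eq_1[OF t] by blast
    have "((\<lambda>x. \<zeta> * exp (c * cusp_offset x)) \<longlongrightarrow> \<zeta> * 1) F" by (intro tendsto_mult tendsto_const ex)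
    then have "(q_power m \<longlongrightarrow> \<zeta>) F" using qe by (simp add: filterlim_cong)
    then have "((\<lambda>x. q_power m x / (of_nat (Suc m) * (1 - q_power m x)) * (1 / of_real (Im (z x))))
        \<longlongrightarrow> \<zeta> / (of_nat (Suc m) * (1 - \<zeta>)) * 0) F"
      by (intro tendsto_intros inverse_Im_complex) (use z1 in \<open>simp_all del: of_nat_Suc\<close>)
    then show ?thesis using False by simp
  qed
qed

lemma log_eta_series_limit:
  "((\<lambda>x. log_eta_series (cusp_point x) / of_real (Im (z x))) \<longlongrightarrow> of_real (pi * real (gcd d t) ^ 2 / (12 * d))) F"
proof -
  let ?a = "\<lambda>m x. q_power m x / (of_nat (Suc m) * (1 - q_power m x)) / of_real (Im (z x))"
  let ?b = "\<lambda>m. if t dvd d * Suc m then real t ^ 2 / (2 * pi * d * real (Suc m) ^ 2) else 0"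
  define M where "M m = (real t + 1) ^ 2 / (2 * pi * d) * (1 / real (Suc m) ^ 2)" for m
  have "summable (\<lambda>m. 1 / real (Suc m) ^ 2)"
    using inverse_squares_sums by (simp add: sums_iff add.commute)
  then have M: "summable M" unfolding M_def by (rule summable_mult)
  have "((\<lambda>x. norm ((of_nat t * z x + 1) / of_real (Im (z x)))) \<longlongrightarrow> norm (of_nat t * \<i>)) F"
    by (intro tendsto_norm affine_over_Im)
  then have "((\<lambda>x. norm ((of_nat t * z x + 1) / of_real (Im (z x)))) \<longlongrightarrow> real t) F"
    by (simp add: norm_mult)
  from order_tendstoD(2)[OF this, of "real t + 1"]
  have "eventually (\<lambda>x. norm ((of_nat t * z x + 1) / of_real (Im (z x))) < real t + 1) F" by simp
  with Im_pos have bound: "eventually (\<lambda>x. \<forall>m. norm (?a m x) \<le> M m) F"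
  proof eventually_elim
    case (elim x)
    let ?n = "norm (of_nat t * z x + 1)" and ?y = "Im (z x)"
    have n: "?n > 0" using affine_nonzero[OF elim(1)] by simp
    have le: "?n / ?y \<le> real t + 1" using elim by (simp add: norm_divide)
    show ?case
    proof
      fix m
      have "norm (q_power m x / (of_nat (Suc m) * (1 - q_power m x))) \<le> 1 / (2 * pi * real (Suc m) ^ 2 * Im (cusp_point x))"
        unfolding q_power_def by (rule geometric_bound[OF Im_cusp_point_pos[OF elim(1)]])
      from divide_right_mono[OF this, of ?y] elim(1)
      have "norm (q_power m x / (of_nat (Suc m) * (1 - q_power m x))) / ?y
          \<le> 1 / (2 * pi * real (Suc m) ^ 2 * Im (cusp_point x)) / ?y" by linarith
      moreover have "norm (?a m x) = norm (q_power m x / (of_nat (Suc m) * (1 - q_power m x))) / ?y"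
        by (simp only: norm_divide norm_of_real abs_of_pos[OF elim(1)])
      ultimately have "norm (?a m x) \<le> 1 / (2 * pi * real (Suc m) ^ 2 * Im (cusp_point x)) / ?y" by simp
      also have "\<dots> = (?n / ?y) ^ 2 / (2 * pi * d) * (1 / real (Suc m) ^ 2)"
        using n elim(1) d unfolding Im_cusp_point[OF elim(1)] by (simp add: field_simps power2_eq_square del: of_nat_Suc)
      also have "\<dots> \<le> M m" unfolding M_def
        using le n elim(1) by (intro mult_right_mono divide_right_mono power_mono) auto
      finally show "norm (?a m x) \<le> M m" .
    qed
  qed
  have "eventually (\<lambda>(m, x). norm (?a m x) \<le> M m) (at_top \<times>\<^sub>F F)"
    using eventually_prodI[OF eventually_True bound] by (rule eventually_mono) auto
  from tannerys_theorem[OF term_limit this M nontrivial]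
  have lim: "((\<lambda>x. \<Sum>m. ?a m x) \<longlongrightarrow> (\<Sum>m. of_real (?b m))) F"
    and sm: "eventually (\<lambda>x. summable (\<lambda>m. norm (?a m x))) F" by blast+
  have "(\<Sum>m. of_real (?b m) :: complex) = of_real (pi * real (gcd d t) ^ 2 / (12 * d))"
    by (rule sums_unique[symmetric, OF sums_of_real[OF sums_multiples[OF d t]]])
  moreover have "eventually (\<lambda>x. (\<Sum>m. ?a m x) = log_eta_series (cusp_point x) / of_real (Im (z x))) F"
    using sm Im_pos
  proof eventually_elim
    case (elim x)
    have "summable (\<lambda>m. ?a m x)" by (rule summable_norm_cancel[OF elim(1)])
    from summable_mult2[OF this, of "of_real (Im (z x))"]
    have "summable (\<lambda>m. q_power m x / (of_nat (Suc m) * (1 - q_power m x)))" using elim(2) by (simp del: of_nat_Suc)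
    from suminf_divide[OF this, of "of_real (Im (z x))"] show ?case
      unfolding log_eta_series_def q_power_def by simp
  qed
  ultimately show ?thesis using lim by (simp add: filterlim_cong)
qed

lemma eta_resc_growth:
  "((\<lambda>x. ln (norm (eta_resc d (z x / (of_nat t * z x + 1)))) / Im (z x)) \<longlongrightarrow>
     - (pi / 12) * (real (gcd d t) ^ 2 / d)) F"
proof -
  have "((\<lambda>x. Re (log_eta_series (cusp_point x) / of_real (Im (z x)))) \<longlongrightarrow>
      Re (of_real (pi * real (gcd d t) ^ 2 / (12 * d)))) F"
    by (rule tendsto_Re[OF log_eta_series_limit])
  moreover have "((\<lambda>x. Im (cusp_point x) / Im (z x)) \<longlongrightarrow> 0) F"
  proof -
    have lim: "((\<lambda>x. Im (of_nat d / of_nat t + cusp_offset x) * (1 / Im (z x))) \<longlongrightarrow> Im (of_nat d / of_nat t + 0) * 0) F"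
      by (intro tendsto_mult tendsto_Im tendsto_add tendsto_const cusp_offset_tendsto inverse_Im)
    have "eventually (\<lambda>x. Im (of_nat d / of_nat t + cusp_offset x) * (1 / Im (z x)) = Im (cusp_point x) / Im (z x)) F"
      using Im_pos by eventually_elim (simp add: cusp_point_eq)
    from Lim_transform_eventually[OF lim this] show ?thesis by simp
  qed
  ultimately have "((\<lambda>x. - (pi / 12) * (Im (cusp_point x) / Im (z x)) - Re (log_eta_series (cusp_point x) / of_real (Im (z x))))
     \<longlongrightarrow> - (pi / 12) * 0 - Re (of_real (pi * real (gcd d t) ^ 2 / (12 * d)))) F"
    by (intro tendsto_diff tendsto_mult tendsto_const)
  moreover have "eventually (\<lambda>x. - (pi / 12) * (Im (cusp_point x) / Im (z x)) - Re (log_eta_series (cusp_point x) / of_real (Im (z x)))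
     = ln (norm (eta_resc d (z x / (of_nat t * z x + 1)))) / Im (z x)) F"
    using Im_pos
  proof eventually_elim
    case (elim x)
    have "eta_resc d (z x / (of_nat t * z x + 1)) = exp (of_real pi * \<i> * cusp_point x / 12 - log_eta_series (cusp_point x))"
      using dedekind_eta_exp[OF Im_cusp_point_pos[OF elim]] by (simp add: eta_resc_def cusp_point_def)
    moreover have "Re (of_real pi * \<i> * cusp_point x / 12) = - (pi / 12) * Im (cusp_point x)" by simp
    ultimately have "ln (norm (eta_resc d (z x / (of_nat t * z x + 1))))
        = - (pi / 12) * Im (cusp_point x) - Re (log_eta_series (cusp_point x))" by simp
    then show ?case using elim by (simp add: diff_divide_distrib)
  qed
  ultimately show ?thesis by (simp add: filterlim_cong)
qed

lemma eta_resc_nonzero: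
  assumes "Im (z x) > 0" shows "eta_resc d (z x / (of_nat t * z x + 1)) \<noteq> 0"
  using dedekind_eta_exp[OF Im_cusp_point_pos[OF assms]] by (simp add: eta_resc_def cusp_point_def)

end

lemma eta_quotient_growth:
  assumes t: "t > 0" and X: "eta_exponents X"
  shows "((\<lambda>x. ln (norm (eta_quotient X (z x / (of_nat t * z x + 1)))) / Im (z x)) \<longlongrightarrow>
     - (pi / 12) * (\<Sum>d | X d \<noteq> 0. of_int (X d) * (real (gcd d t) ^ 2 / d))) F"
    "eventually (\<lambda>x. eta_quotient X (z x / (of_nat t * z x + 1)) \<noteq> 0) F"
proof -
  have fin: "finite {d. X d \<noteq> 0}" and pos: "\<And>d. X d \<noteq> 0 \<Longrightarrow> d > 0"
    using X by (auto simp: eta_exponents_def intro: gr0I)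
  have "((\<lambda>x. \<Sum>d | X d \<noteq> 0. of_int (X d) * (ln (norm (eta_resc d (z x / (of_nat t * z x + 1)))) / Im (z x)))
     \<longlongrightarrow> (\<Sum>d | X d \<noteq> 0. of_int (X d) * (- (pi / 12) * (real (gcd d t) ^ 2 / d)))) F"
    by (intro tendsto_sum tendsto_mult tendsto_const eta_resc_growth t) (use pos in auto)
  moreover have "(\<Sum>d | X d \<noteq> 0. of_int (X d) * (- (pi / 12) * (real (gcd d t) ^ 2 / d)))
      = - (pi / 12) * (\<Sum>d | X d \<noteq> 0. of_int (X d) * (real (gcd d t) ^ 2 / d))"
    by (simp add: sum_distrib_left mult.left_commute)
  moreover have "eventually (\<lambda>x. (\<Sum>d | X d \<noteq> 0. of_int (X d) * (ln (norm (eta_resc d (z x / (of_nat t * z x + 1)))) / Im (z x)))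
     = ln (norm (eta_quotient X (z x / (of_nat t * z x + 1)))) / Im (z x)) F"
    using Im_pos
  proof eventually_elim
    case (elim x)
    let ?w = "z x / (of_nat t * z x + 1)"
    have nz: "norm (eta_resc d ?w) > 0" if "X d \<noteq> 0" for d
      using eta_resc_nonzero[OF pos[OF that] t elim] by simp
    have "ln (norm (eta_quotient X ?w)) = ln (\<Prod>d | X d \<noteq> 0. norm (eta_resc d ?w) powi X d)"
      by (simp add: eta_quotient_def prod_norm[symmetric] norm_power_int)
    also have "\<dots> = (\<Sum>d | X d \<noteq> 0. ln (norm (eta_resc d ?w) powi X d))"
      using nz by (intro ln_prod) (auto simp: fin)
    also have "\<dots> = (\<Sum>d | X d \<noteq> 0. of_int (X d) * ln (norm (eta_resc d ?w)))"
      using nz by (intro sum.cong refl) (simp add: ln_power_int)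
    finally show ?case by (simp add: sum_divide_distrib)
  qed
  ultimately show "((\<lambda>x. ln (norm (eta_quotient X (z x / (of_nat t * z x + 1)))) / Im (z x)) \<longlongrightarrow>
     - (pi / 12) * (\<Sum>d | X d \<noteq> 0. of_int (X d) * (real (gcd d t) ^ 2 / d))) F"
    by (simp add: filterlim_cong)
  show "eventually (\<lambda>x. eta_quotient X (z x / (of_nat t * z x + 1)) \<noteq> 0) F"
    using Im_pos
  proof eventually_elim
    case (elim x)
    then show ?case using eta_resc_nonzero[OF pos t elim] fin by (simp add: eta_quotient_def power_int_eq_0_iff)
  qed
qed

lemma ln_affine_over_Im:
  assumes t: "t > 0"
  shows "((\<lambda>x. ln (norm (of_nat t * z x + 1)) / Im (z x)) \<longlongrightarrow> 0) F"
proof -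
  have "((\<lambda>x. norm ((of_nat t * z x + 1) / of_real (Im (z x)))) \<longlongrightarrow> norm (of_nat t * \<i>)) F"
    by (intro tendsto_norm affine_over_Im)
  then have "((\<lambda>x. ln (norm ((of_nat t * z x + 1) / of_real (Im (z x))))) \<longlongrightarrow> ln (norm (of_nat t * \<i>))) F"
    by (rule tendsto_ln) (use t in simp)
  moreover have "((\<lambda>x. ln (Im (z x)) / Im (z x)) \<longlongrightarrow> 0) F"
    by (rule filterlim_compose[OF ln_x_over_x_tendsto_0 Im_top])
  ultimately have lim: "((\<lambda>x. ln (norm ((of_nat t * z x + 1) / of_real (Im (z x)))) * (1 / Im (z x)) + ln (Im (z x)) / Im (z x))
     \<longlongrightarrow> ln (norm (of_nat t * \<i>)) * 0 + 0) F"
    by (intro tendsto_add tendsto_mult inverse_Im)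
  have "eventually (\<lambda>x. ln (norm ((of_nat t * z x + 1) / of_real (Im (z x)))) * (1 / Im (z x)) + ln (Im (z x)) / Im (z x)
     = ln (norm (of_nat t * z x + 1)) / Im (z x)) F"
    using Im_pos
  proof eventually_elim
    case (elim x)
    then have "norm (of_nat t * z x + 1) > 0" using affine_nonzero[OF t t elim] by simp
    then show ?case using elim by (simp add: norm_divide ln_div field_simps)
  qed
  from Lim_transform_eventually[OF lim this] show ?thesis by simp
qed

text \<open>The automorphy factor contributes only \<open>ln (Im z)\<close> to the logarithm and cannot compensate the linear growth.\<close>

lemma slash_at_top:
  assumes t: "t > 0" and X: "eta_exponents X"
    and neg: "(\<Sum>d | X d \<noteq> 0. of_int (X d) * (real (gcd d t) ^ 2 / d)) < 0"
  shows "filterlim (\<lambda>x. slash k 1 0 (int t) 1 (eta_quotient X) (z x)) at_infinity F"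
proof -
  let ?s = "\<Sum>d | X d \<noteq> 0. of_int (X d) * (real (gcd d t) ^ 2 / d)"
  let ?h = "\<lambda>x. slash k 1 0 (int t) 1 (eta_quotient X) (z x)"
  let ?w = "\<lambda>x. of_nat t * z x + 1"
  let ?g = "\<lambda>x. - k * (ln (norm (?w x)) / Im (z x)) + ln (norm (eta_quotient X (z x / ?w x))) / Im (z x)"
  have "(?g \<longlongrightarrow> - k * 0 + - (pi / 12) * ?s) F"
    by (intro tendsto_add tendsto_mult tendsto_const ln_affine_over_Im eta_quotient_growth t X)
  moreover have "pi / 12 * ?s < 0" using neg by (intro mult_pos_neg) auto
  then have "0 < - k * 0 + - (pi / 12) * ?s" by linarith
  ultimately have "filterlim (\<lambda>x. ?g x * Im (z x)) at_top F"
    by (rule filterlim_tendsto_pos_mult_at_top[OF _ _ Im_top])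
  then have "filterlim (\<lambda>x. exp (?g x * Im (z x))) at_top F"
    by (rule filterlim_compose[OF exp_at_top])
  moreover have "eventually (\<lambda>x. exp (?g x * Im (z x)) = norm (?h x)) F"
    using Im_pos eta_quotient_growth(2)[OF t X]
  proof eventually_elim
    case (elim x)
    have w: "?w x \<noteq> 0" using affine_nonzero[OF t t elim(1)] .
    have "norm (?h x) = norm (exp (- of_real k * Ln (?w x))) * norm (eta_quotient X (z x / ?w x))"
      using w by (simp add: slash_def powr_def norm_mult)
    also have "norm (exp (- of_real k * Ln (?w x))) = exp (- k * ln (norm (?w x)))" using w by simp
    also have "norm (eta_quotient X (z x / ?w x)) = exp (ln (norm (eta_quotient X (z x / ?w x))))"
      using elim(2) by simp
    finally show ?case using elim(1) by (simp add: exp_add[symmetric] left_diff_distrib)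
  qed
  ultimately have "filterlim (\<lambda>x. norm (?h x)) at_top F" by (simp add: filterlim_cong)
  then show ?thesis by (rule filterlim_norm_at_top_imp_at_infinity)
qed

end

text \<open>Here \<open>z = 24 * N * Ln q / (2 * pi * \<i>)\<close>, so \<open>Im z\<close> is \<open>- 12 * N * ln (norm q) / pi\<close>, and \<open>\<bar>Im (Ln q)\<bar> \<le> pi\<close> bounds \<open>Re z\<close>.\<close>

lemma cusp_parameter:
  assumes "N > 0"
  shows "vertical_approach (\<lambda>q. of_nat (24 * N) * Ln q / (2 * of_real pi * \<i>)) (at 0) (12 * real N)"
proof
  let ?z = "\<lambda>q. of_nat (24 * N) * Ln q / (2 * of_real pi * \<i>)"
  have z: "?z q = of_real (12 * real N / pi) * (- \<i> * Ln q)" for q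
    by (simp add: field_simps)
  have "Im (?z q) = 12 * real N / pi * (- Re (Ln q))" for q unfolding z by (simp add: Im_complex_of_real)
  moreover have "Re (?z q) = 12 * real N / pi * Im (Ln q)" for q unfolding z by simp
  ultimately have Im: "Im (?z q) = 12 * real N / pi * (- Re (Ln q))" and Re: "Re (?z q) = 12 * real N / pi * Im (Ln q)" for q
    by blast+
  have "filterlim (\<lambda>q::complex. norm q) (at_right 0) (at 0)"
    unfolding filterlim_at by (auto intro!: tendsto_norm_zero simp: eventually_at_filter)
  then have "filterlim (\<lambda>q::complex. - ln (norm q)) at_top (at 0)"
    by (intro filterlim_compose[OF filterlim_uminus_at_top_at_bot] filterlim_compose[OF ln_at_0])
  then have "filterlim (\<lambda>q::complex. 12 * real N / pi * (- ln (norm q))) at_top (at 0)"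
    by (rule filterlim_tendsto_pos_mult_at_top[OF tendsto_const, rotated]) (use assms in simp)
  moreover have "eventually (\<lambda>q::complex. 12 * real N / pi * (- ln (norm q)) = Im (?z q)) (at 0)"
    unfolding eventually_at_filter Im by (rule always_eventually) simp
  ultimately show "filterlim (\<lambda>q. Im (?z q)) at_top (at 0)" by (simp add: filterlim_cong)
  show "eventually (\<lambda>q. \<bar>Re (?z q)\<bar> \<le> 12 * real N) (at 0)"
    unfolding eventually_at_filter Re
  proof (rule always_eventually, intro allI impI)
    fix q :: complex assume "q \<noteq> 0"
    then have "\<bar>Im (Ln q)\<bar> \<le> pi" using mpi_less_Im_Ln[of q] Im_Ln_le_pi[of q] by linarith
    then have "12 * real N / pi * \<bar>Im (Ln q)\<bar> \<le> 12 * real N / pi * pi" by (intro mult_left_mono) auto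
    then show "\<bar>12 * real N / pi * Im (Ln q)\<bar> \<le> 12 * real N" by (simp add: abs_mult)
  qed
qed simp

text \<open>The cusps \<open>1 / t\<close> suffice. Since \<open>t\<close> ranges over all positive integers, multiples of the level included, no level
has to be mentioned from here on.\<close>

lemma holomorphic_cusp_order_nonneg:
  assumes X: "eta_exponents X" "holomorphic_eta_quotient X" and t: "t > 0"
  shows "0 \<le> (\<Sum>d | X d \<noteq> 0. of_int (X d) * (real (gcd d t) ^ 2 / d))"
proof (rule ccontr)
  assume neg: "\<not> ?thesis"
  have "eta_level X > 0"
    using X(1) by (auto simp: eta_level_def eta_exponents_def Lcm_0_iff intro!: gr0I)
  then interpret vertical_approach "\<lambda>q. of_nat (24 * eta_level X) * Ln q / (2 * of_real pi * \<i>)"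
      "at 0" "12 * real (eta_level X)"
    by (rule cusp_parameter)
  have "eta_quotient_pole_at_cusp X 1 0 (int t) 1"
    unfolding eta_quotient_pole_at_cusp_def is_pole_def by (rule slash_at_top[OF t X(1)]) (use neg in simp)
  moreover have "(1::int) * 1 - 0 * int t = 1" by simp
  ultimately show False using X(2) unfolding holomorphic_eta_quotient_def by blast
qed

section \<open>Exponent families and their orders at the cusps\<close>

definition pairing :: "(nat \<Rightarrow> real) \<Rightarrow> (nat \<Rightarrow> real) \<Rightarrow> real" where
  "pairing A f = (\<Sum>d | A d \<noteq> 0. A d * f d)"

text \<open>The sum of the exponents, which is twice the weight of the eta quotient.\<close>

abbreviation weight :: "(nat \<Rightarrow> real) \<Rightarrow> real" where
  "weight A \<equiv> pairing A (\<lambda>_. 1)"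

definition cusp_order :: "(nat \<Rightarrow> real) \<Rightarrow> nat \<Rightarrow> real" where
  "cusp_order A t = pairing A (\<lambda>d. (real (gcd d t))\<^sup>2 / real d)"

definition smooth :: "nat set \<Rightarrow> nat set" where
  "smooth Q = {d. d > 0 \<and> prime_factors d \<subseteq> Q}"

definition fin_on :: "nat set \<Rightarrow> (nat \<Rightarrow> real) \<Rightarrow> bool" where
  "fin_on S A \<longleftrightarrow> finite {d. A d \<noteq> 0} \<and> {d. A d \<noteq> 0} \<subseteq> S"

definition holo :: "nat set \<Rightarrow> (nat \<Rightarrow> real) \<Rightarrow> bool" where
  "holo Q A \<longleftrightarrow> fin_on (smooth Q) A \<and> (\<forall>t>0. 0 \<le> cusp_order A t)"

lemma pairing_eq_sum:
  assumes "finite D" "{d. A d \<noteq> 0} \<subseteq> D"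
  shows "pairing A f = (\<Sum>d\<in>D. A d * f d)"
  unfolding pairing_def by (rule sum.mono_neutral_left) (use assms in auto)

lemma fin_on_comb:
  assumes "fin_on S A" "fin_on S B"
  shows "fin_on S (\<lambda>d. a * A d + b * B d)"
proof -
  have "{d. a * A d + b * B d \<noteq> 0} \<subseteq> {d. A d \<noteq> 0} \<union> {d. B d \<noteq> 0}" by auto
  with assms show ?thesis unfolding fin_on_def
    by (meson finite_UnI finite_subset le_supI order_trans)
qed

lemma pairing_comb:
  assumes "fin_on S A" "fin_on S B"
  shows "pairing (\<lambda>d. a * A d + b * B d) f = a * pairing A f + b * pairing B f"
proof -
  define D where "D = {d. A d \<noteq> 0} \<union> {d. B d \<noteq> 0}"
  have D: "finite D" using assms by (auto simp: D_def fin_on_def)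
  have "pairing (\<lambda>d. a * A d + b * B d) f = (\<Sum>d\<in>D. (a * A d + b * B d) * f d)"
    by (rule pairing_eq_sum[OF D]) (auto simp: D_def)
  moreover have "pairing A f = (\<Sum>d\<in>D. A d * f d)"
    by (rule pairing_eq_sum[OF D]) (auto simp: D_def)
  moreover have "pairing B f = (\<Sum>d\<in>D. B d * f d)"
    by (rule pairing_eq_sum[OF D]) (auto simp: D_def)
  ultimately show ?thesis
    by (simp add: sum.distrib sum_distrib_left algebra_simps)
qed

lemma pairing_comb_right: "pairing A (\<lambda>d. a * f d + b * g d) = a * pairing A f + b * pairing A g"
  unfolding pairing_def by (simp add: sum.distrib sum_distrib_left algebra_simps)

lemma pairing_scale_right: "pairing A (\<lambda>d. a * f d) = a * pairing A f"
  unfolding pairing_def by (simp add: sum_distrib_left algebra_simps)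

lemma pairing_cong:
  assumes "\<And>d. A d \<noteq> 0 \<Longrightarrow> f d = g d"
  shows "pairing A f = pairing A g"
  unfolding pairing_def by (rule sum.cong) (use assms in auto)

lemma holo_fin: "holo Q A \<Longrightarrow> fin_on (smooth Q) A"
  by (simp add: holo_def)

lemma holo_comb:
  assumes "holo Q A" "holo Q B" "0 \<le> a" "0 \<le> b"
  shows "holo Q (\<lambda>d. a * A d + b * B d)"
proof -
  have "cusp_order (\<lambda>d. a * A d + b * B d) t = a * cusp_order A t + b * cusp_order B t" for t
    unfolding cusp_order_def using pairing_comb[OF holo_fin[OF assms(1)] holo_fin[OF assms(2)]] .
  with assms show ?thesis by (auto simp: holo_def intro: fin_on_comb)
qed

lemma weight_comb:
  assumes "holo Q A" "holo Q B"
  shows "weight (\<lambda>d. a * A d + b * B d) = a * weight A + b * weight B"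
  using pairing_comb[OF holo_fin[OF assms(1)] holo_fin[OF assms(2)]] .

section \<open>Separating one prime\<close>

definition cofactor :: "nat \<Rightarrow> nat \<Rightarrow> nat" where
  "cofactor p d = d div p ^ multiplicity p d"

text \<open>Write \<open>d = p ^ j * m\<close> with \<open>m\<close> prime to \<open>p\<close>, and call the part of \<open>A\<close> with a fixed \<open>j\<close> a row. This is the
combination of the rows with coefficients \<open>u j\<close>, a family on the numbers \<open>m\<close>.\<close>

definition collapse :: "nat \<Rightarrow> (nat \<Rightarrow> real) \<Rightarrow> (nat \<Rightarrow> real) \<Rightarrow> nat \<Rightarrow> real" where
  "collapse p u A m = (\<Sum>d | A d \<noteq> 0 \<and> cofactor p d = m. u (multiplicity p d) * A d)"

lemma cofactor_decomp: "d = p ^ multiplicity p d * cofactor p d"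
  unfolding cofactor_def by (simp add: multiplicity_dvd)

lemma cofactor_pos: "d > 0 \<Longrightarrow> cofactor p d > 0"
  using cofactor_decomp[of d p] by (metis mult_0_right neq0_conv)

lemma not_dvd_cofactor:
  assumes "prime p" "d > 0" shows "\<not> p dvd cofactor p d"
  using assms multiplicity_decompose[of d p] unfolding cofactor_def
  by (metis neq0_conv not_prime_unit)

lemma cofactor_power_mult:
  assumes "prime p" "\<not> p dvd m"
  shows "cofactor p (p ^ j * m) = m" "multiplicity p (p ^ j * m) = j"
proof -
  have "m \<noteq> 0" using assms(2) by (metis dvd_0_right)
  then show *: "multiplicity p (p ^ j * m) = j"
    using assms by (simp add: prime_elem_multiplicity_mult_distrib multiplicity_prime_power not_dvd_imp_multiplicity_0)
  show "cofactor p (p ^ j * m) = m" unfolding cofactor_def *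
    using assms(1) by (simp add: prime_gt_0_nat)
qed

lemma cofactor_smooth:
  assumes "prime p" "d \<in> smooth (insert p Q)" shows "cofactor p d \<in> smooth Q"
proof -
  have d: "d > 0" using assms by (simp add: smooth_def)
  have "q \<in> Q" if q: "q \<in> prime_factors (cofactor p d)" for q
  proof -
    have "q dvd cofactor p d" "prime q" using q by auto
    then have "q dvd d" "q \<noteq> p"
      using cofactor_decomp[of d p] not_dvd_cofactor[OF assms(1) d] by (metis dvd_mult, blast)
    then show ?thesis using assms d \<open>prime q\<close> by (auto simp: smooth_def in_prime_factors_iff)
  qed
  then show ?thesis using cofactor_pos[OF d] by (auto simp: smooth_def)
qed

lemma collapse_support: "{m. collapse p u A m \<noteq> 0} \<subseteq> cofactor p ` {d. A d \<noteq> 0}"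
proof
  fix m assume "m \<in> {m. collapse p u A m \<noteq> 0}"
  then have "{d. A d \<noteq> 0 \<and> cofactor p d = m} \<noteq> {}"
    by (auto simp only: collapse_def sum.empty mem_Collect_eq)
  then show "m \<in> cofactor p ` {d. A d \<noteq> 0}" by auto
qed

lemma pairing_collapse:
  assumes "finite {d. A d \<noteq> 0}"
  shows "pairing (collapse p u A) g = pairing A (\<lambda>d. u (multiplicity p d) * g (cofactor p d))"
proof -
  have "pairing (collapse p u A) g = (\<Sum>m\<in>cofactor p ` {d. A d \<noteq> 0}. collapse p u A m * g m)"
    by (rule pairing_eq_sum) (use assms collapse_support in auto)
  also have "\<dots> = (\<Sum>m\<in>cofactor p ` {d. A d \<noteq> 0}. \<Sum>d | d \<in> {d. A d \<noteq> 0} \<and> cofactor p d = m.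
      A d * (u (multiplicity p d) * g (cofactor p d)))"
    by (rule sum.cong) (auto simp: collapse_def sum_distrib_right sum_distrib_left algebra_simps intro!: sum.cong)
  also have "\<dots> = pairing A (\<lambda>d. u (multiplicity p d) * g (cofactor p d))"
    unfolding pairing_def by (rule sum.image_gen[symmetric]) fact
  finally show ?thesis .
qed

lemma collapse_fin_on:
  assumes "prime p" "fin_on (smooth (insert p Q)) A"
  shows "fin_on (smooth Q) (collapse p u A)"
proof -
  have "cofactor p d \<in> smooth Q" if "A d \<noteq> 0" for d
    by (rule cofactor_smooth[OF assms(1)]) (use that assms(2) in \<open>auto simp: fin_on_def\<close>)
  then have "cofactor p ` {d. A d \<noteq> 0} \<subseteq> smooth Q" by blast
  moreover have "finite (cofactor p ` {d. A d \<noteq> 0})" using assms(2) by (simp add: fin_on_def)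
  moreover note collapse_support[of p u A]
  ultimately show ?thesis unfolding fin_on_def by (metis finite_subset subset_trans)
qed

lemma collapse_cong:
  assumes "\<And>d. A d \<noteq> 0 \<Longrightarrow> u (multiplicity p d) = v (multiplicity p d)"
  shows "collapse p u A = collapse p v A"
  by (rule ext) (auto simp: collapse_def assms intro!: sum.cong)

lemma collapse_comb:
  "collapse p (\<lambda>j. a * u j + b * v j) A m = a * collapse p u A m + b * collapse p v A m"
  unfolding collapse_def by (simp add: sum.distrib sum_distrib_left algebra_simps)

lemma collapse_scale: "collapse p (\<lambda>j. a * u j) A m = a * collapse p u A m"
  unfolding collapse_def by (simp add: sum_distrib_left algebra_simps)

lemma collapse_comb_left:
  assumes "fin_on S A" "fin_on S B"
  shows "collapse p u (\<lambda>d. a * A d + b * B d) m = a * collapse p u A m + b * collapse p u B m"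
proof -
  define D where "D = {d \<in> {d. A d \<noteq> 0} \<union> {d. B d \<noteq> 0}. cofactor p d = m}"
  have D: "finite D" unfolding D_def
    by (rule finite_subset[of _ "{d. A d \<noteq> 0} \<union> {d. B d \<noteq> 0}"]) (use assms in \<open>auto simp: fin_on_def\<close>)
  have *: "collapse p u C m = (\<Sum>d\<in>D. u (multiplicity p d) * C d)"
    if "{d. C d \<noteq> 0} \<subseteq> {d. A d \<noteq> 0} \<union> {d. B d \<noteq> 0}" for C
    unfolding collapse_def by (rule sum.mono_neutral_left) (use that D in \<open>auto simp: D_def\<close>)
  have "{d. a * A d + b * B d \<noteq> 0} \<subseteq> {d. A d \<noteq> 0} \<union> {d. B d \<noteq> 0}" by auto
  from *[OF this] *[of A] *[of B] show ?thesis
    by (simp add: sum.distrib sum_distrib_left algebra_simps)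
qed

text \<open>The one-prime factor \<open>gcd(p ^ i, p ^ j)\<^sup>2 / p ^ j\<close> divided by \<open>p ^ i\<close>; truncated subtraction makes the exponent
\<open>\<bar>i - j\<bar>\<close>.\<close>

definition decay :: "nat \<Rightarrow> nat \<Rightarrow> nat \<Rightarrow> real" where
  "decay p i j = (1 / real p) ^ ((i - j) + (j - i))"

lemma gcd_prime_power_mult:
  assumes "prime (p::nat)" "\<not> p dvd m" "\<not> p dvd t"
  shows "gcd (p ^ v * m) (p ^ i * t) = p ^ min v i * gcd m t"
proof -
  have cop: "coprime (p ^ k) m" "coprime (p ^ k) t" for k
    using assms by (auto simp: prime_imp_coprime_nat)
  show ?thesis
  proof (cases "v \<le> i")
    case True
    then obtain k where k: "i = v + k" using le_Suc_ex by blast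
    have "gcd (p ^ v * m) (p ^ i * t) = p ^ v * gcd m (p ^ k * t)"
      by (simp add: k power_add mult.assoc gcd_mult_distrib_nat)
    also have "gcd m (p ^ k * t) = gcd m t"
      using cop(1)[of k] by (simp add: coprime_commute gcd_mult_left_left_cancel gcd_mult_right_left_cancel)
    finally show ?thesis using True by simp
  next
    case False
    then obtain k where k: "v = i + k" using le_Suc_ex nat_le_linear by blast
    have "gcd (p ^ v * m) (p ^ i * t) = p ^ i * gcd (p ^ k * m) t"
      by (simp add: k power_add mult.assoc gcd_mult_distrib_nat)
    also have "gcd (p ^ k * m) t = gcd m t"
      using cop(2)[of k] by (simp add: coprime_commute gcd_mult_left_left_cancel)
    finally show ?thesis using False by simp
  qed
qed

text \<open>The kernel of the order at \<open>t\<close>, applied after a collapse with \<open>decay p i\<close>, is the kernel of the order at \<open>p ^ i\<close> times the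
\<open>p\<close>-free part of \<open>t\<close>.\<close>

lemma decay_gcd:
  assumes p: "prime p" and "d > 0" "t > 0"
  shows "decay p i (multiplicity p d) * ((real (gcd (cofactor p d) t))\<^sup>2 / real (cofactor p d))
       = (1 / real p ^ i) * ((real (gcd d (p ^ i * cofactor p t)))\<^sup>2 / real d)"
proof -
  define v m t' where "v = multiplicity p d" and "m = cofactor p d" and "t' = cofactor p t"
  have nd: "\<not> p dvd m" "\<not> p dvd t'" using not_dvd_cofactor assms by (auto simp: m_def t'_def)
  have p0: "real p > 0" using p by (simp add: prime_gt_0_nat)
  have m0: "real m > 0" using assms cofactor_pos by (simp add: m_def)
  have d: "d = p ^ v * m" and t: "t = p ^ multiplicity p t * t'"
    using cofactor_decomp by (auto simp: v_def m_def t'_def)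
  have "gcd m t = gcd (p ^ 0 * m) (p ^ multiplicity p t * t')" using t by simp
  also have "\<dots> = gcd m t'" by (subst gcd_prime_power_mult[OF p nd]) simp
  finally have g1: "gcd m t = gcd m t'" .
  have g2: "gcd d (p ^ i * t') = p ^ min v i * gcd m t'"
    unfolding d by (rule gcd_prime_power_mult[OF p nd])
  have e: "i + v + 0 = (i - v) + (v - i) + 2 * min v i" by simp
  have "real p ^ i * real p ^ v = real p ^ ((i - v) + (v - i)) * (real p ^ min v i)\<^sup>2"
    by (metis e add_0_right power_add power_mult mult.commute)
  then have "(1 / real p) ^ ((i - v) + (v - i)) = (real p ^ min v i)\<^sup>2 / (real p ^ i * real p ^ v)"
    using p0 by (simp add: power_divide field_simps)
  moreover have "real d = real p ^ v * real m" using d by (metis of_nat_mult of_nat_power)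
  ultimately show ?thesis
    unfolding decay_def v_def[symmetric] m_def[symmetric] t'_def[symmetric] g1 g2
    by (simp add: power_mult_distrib)
qed

lemma holo_collapse_decay:
  assumes "prime p" "holo (insert p Q) A"
  shows "holo Q (collapse p (decay p i) A)"
proof -
  have fin: "fin_on (smooth (insert p Q)) A" using assms by (simp add: holo_def)
  have "0 \<le> cusp_order (collapse p (decay p i) A) t" if t: "t > 0" for t
  proof -
    have "cusp_order (collapse p (decay p i) A) t
        = pairing A (\<lambda>d. decay p i (multiplicity p d) *
            ((real (gcd (cofactor p d) t))\<^sup>2 / real (cofactor p d)))"
      unfolding cusp_order_def by (rule pairing_collapse) (use fin in \<open>simp add: fin_on_def\<close>)
    also have "\<dots> = pairing A (\<lambda>d. (1 / real p ^ i) * ((real (gcd d (p ^ i * cofactor p t)))\<^sup>2 / real d))"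
      by (rule pairing_cong, rule decay_gcd)
         (use assms fin t in \<open>auto simp: fin_on_def smooth_def\<close>)
    also have "\<dots> = (1 / real p ^ i) * cusp_order A (p ^ i * cofactor p t)"
      unfolding cusp_order_def by (rule pairing_scale_right)
    finally show ?thesis using assms t cofactor_pos[OF t, of p]
      by (simp add: holo_def prime_gt_0_nat)
  qed
  then show ?thesis using collapse_fin_on[OF assms(1) fin] by (simp add: holo_def)
qed

text \<open>The functions \<open>u\<close> for which collapsing does not create negative orders. They form a convex cone, generated by the
functions \<open>decay p i\<close>.\<close>

definition preserves_holo :: "nat \<Rightarrow> (nat \<Rightarrow> real) \<Rightarrow> bool" where
  "preserves_holo p u \<longleftrightarrow> (\<forall>Q A. holo (insert p Q) A \<longrightarrow> holo Q (collapse p u A))"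

lemma decay_preserves_holo: "prime p \<Longrightarrow> preserves_holo p (decay p i)"
  by (simp add: preserves_holo_def holo_collapse_decay)

lemma comb_preserves_holo:
  assumes "preserves_holo p u" "preserves_holo p v" "0 \<le> a" "0 \<le> b"
  shows "preserves_holo p (\<lambda>j. a * u j + b * v j)"
  unfolding preserves_holo_def
proof (intro allI impI)
  fix Q A assume "holo (insert p Q) A"
  then have "holo Q (\<lambda>m. a * collapse p u A m + b * collapse p v A m)"
    using assms by (auto simp: preserves_holo_def intro: holo_comb)
  then show "holo Q (collapse p (\<lambda>j. a * u j + b * v j) A)"
    by (simp add: collapse_comb[abs_def])
qed

text \<open>A closed form of \<open>\<Sum>i\<le>l. c i * decay p i j\<close> with \<open>c 0 = p / (p + 1)\<close> and \<open>c i = (p - 1) / (p + 1)\<close> for \<open>i > 0\<close>.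
The complete sum over all \<open>i\<close> is \<open>1\<close>, and \<open>high p l\<close> is the remaining part.\<close>

definition low :: "nat \<Rightarrow> nat \<Rightarrow> nat \<Rightarrow> real" where
  "low p l j = (if l \<le> j then real p / (real p + 1) * (1 / real p) ^ (j - l) else 1 - (1 / real p) ^ (l - j) / (real p + 1))"

definition high :: "nat \<Rightarrow> nat \<Rightarrow> nat \<Rightarrow> real" where
  "high p l j = 1 - low p l j"

lemma low_Suc:
  assumes "p > 0"
  shows "low p (Suc l) j = low p l j + (real p - 1) / (real p + 1) * decay p (Suc l) j"
proof -
  have p: "real p > 0" using assms by simp
  consider "Suc l \<le> j" | "j = l" | "j < l" by linarith
  then show ?thesis
  proof cases
    case 1
    then obtain k where k: "j = Suc l + k" using le_Suc_ex by blast
    have *: "real p / (real p + 1) * x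
        = real p / (real p + 1) * (1 / real p * x) + (real p - 1) / (real p + 1) * x" for x :: real
      using p by (simp add: divide_simps) (simp add: algebra_simps)
    have "low p (Suc l) j = real p / (real p + 1) * (1 / real p) ^ k"
      "low p l j = real p / (real p + 1) * (1 / real p * (1 / real p) ^ k)"
      "decay p (Suc l) j = (1 / real p) ^ k"
      by (simp_all add: low_def decay_def k Suc_diff_le)
    then show ?thesis using *[of "(1 / real p) ^ k"] by metis
  next
    case 2
    have "1 - 1 / real p / (real p + 1)
        = real p / (real p + 1) + (real p - 1) / (real p + 1) * (1 / real p)"
      using p by (simp add: divide_simps) (simp add: algebra_simps)
    with 2 show ?thesis by (simp add: low_def decay_def)
  next
    case 3
    then obtain k where k: "l = j + k" "k > 0" using less_imp_add_positive by blast
    have *: "1 - 1 / real p * x / (real p + 1)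
        = 1 - x / (real p + 1) + (real p - 1) / (real p + 1) * (1 / real p * x)" for x :: real
      using p by (simp add: divide_simps) (simp add: algebra_simps)
    have "low p (Suc l) j = 1 - 1 / real p * (1 / real p) ^ k / (real p + 1)"
      "low p l j = 1 - (1 / real p) ^ k / (real p + 1)"
      "decay p (Suc l) j = 1 / real p * (1 / real p) ^ k"
      using k by (simp_all add: low_def decay_def Suc_diff_le)
    then show ?thesis using *[of "(1 / real p) ^ k"] by metis
  qed
qed

lemma low_preserves_holo:
  assumes "prime p" shows "preserves_holo p (low p l)"
proof (induction l)
  case 0
  have "low p 0 = (\<lambda>j. real p / (real p + 1) * decay p 0 j + 0 * decay p 0 j)"
    by (auto simp: low_def decay_def)
  moreover have "preserves_holo p (\<lambda>j. real p / (real p + 1) * decay p 0 j + 0 * decay p 0 j)"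
    by (rule comb_preserves_holo) (use assms decay_preserves_holo in auto)
  ultimately show ?case by simp
next
  case (Suc l)
  have "low p (Suc l) = (\<lambda>j. 1 * low p l j + (real p - 1) / (real p + 1) * decay p (Suc l) j)"
    using low_Suc[of p l] prime_gt_0_nat[OF assms] by (auto simp: fun_eq_iff)
  moreover have "preserves_holo p (\<lambda>j. 1 * low p l j + (real p - 1) / (real p + 1) * decay p (Suc l) j)"
    by (rule comb_preserves_holo) (use assms Suc decay_preserves_holo prime_ge_1_nat[OF assms] in auto)
  ultimately show ?case by simp
qed

lemma high_eq:
  assumes "p > 0"
  shows "high p l j = high p (Suc l) j + (real p - 1) / (real p + 1) * decay p (Suc l) j"
  using low_Suc[OF assms, of l j] by (simp add: high_def)

lemma high_beyond: "p > 0 \<Longrightarrow> j \<le> k \<Longrightarrow> high p k j = 1 / (real p + 1) * decay p k j"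
  by (cases "j = k") (auto simp: high_def low_def decay_def field_simps)

text \<open>The infinite tail is a finite sum on the support of a given family: beyond every occurring exponent \<open>high p k\<close> is a
multiple of \<open>decay p k\<close>, and \<open>high p l\<close> is reached from there by adding kernels.\<close>

lemma high_preserves_holo:
  assumes "prime p" shows "preserves_holo p (high p l)"
  unfolding preserves_holo_def
proof (intro allI impI)
  fix Q A assume A: "holo (insert p Q) A"
  have p: "p > 0" "real p \<ge> 1" using assms prime_gt_0_nat prime_ge_1_nat by auto
  have "finite {d. A d \<noteq> 0}" using A by (simp add: holo_def fin_on_def)
  then have "finite (insert l (multiplicity p ` {d. A d \<noteq> 0}))" by simp
  then obtain k where k: "\<And>j. j \<in> insert l (multiplicity p ` {d. A d \<noteq> 0}) \<Longrightarrow> j \<le> k"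
    using finite_nat_set_iff_bounded_le by meson
  then have "l \<le> k" by blast
  then show "holo Q (collapse p (high p l) A)"
  proof (induction rule: inc_induct)
    case base
    have "collapse p (high p k) A = collapse p (\<lambda>j. 1 / (real p + 1) * decay p k j + 0 * decay p k j) A"
      by (rule collapse_cong) (use p k in \<open>auto simp: high_beyond\<close>)
    moreover have "preserves_holo p (\<lambda>j. 1 / (real p + 1) * decay p k j + 0 * decay p k j)"
      by (rule comb_preserves_holo) (use assms decay_preserves_holo in auto)
    ultimately show ?case using A by (simp add: preserves_holo_def)
  next
    case (step i)
    have "collapse p (high p i) A = (\<lambda>m. 1 * collapse p (high p (Suc i)) A m
            + (real p - 1) / (real p + 1) * collapse p (decay p (Suc i)) A m)"
      by (subst collapse_comb[symmetric], rule arg_cong[of _ _ "\<lambda>u. collapse p u A"])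
         (use p in \<open>auto simp: high_eq[of p i] fun_eq_iff\<close>)
    then show ?case
      using holo_comb[OF step(3) holo_collapse_decay[OF assms A], of 1 "(real p - 1)/(real p + 1)" "Suc i"] p by simp
  qed
qed

text \<open>Summing the rows is compatible with holomorphy and keeps the weight. It is \<open>low p 0 + high p 0\<close>, the
splitting of the weight in the valence formula.\<close>

lemma one_preserves_holo:
  assumes "prime p" shows "preserves_holo p (\<lambda>_. 1)"
proof -
  have "(\<lambda>_. 1) = (\<lambda>j. 1 * low p 0 j + 1 * high p 0 j)" by (auto simp: high_def)
  moreover have "preserves_holo p (\<lambda>j. 1 * low p 0 j + 1 * high p 0 j)"
    by (rule comb_preserves_holo) (use assms low_preserves_holo high_preserves_holo in auto)
  ultimately show ?thesis by simp
qed

lemma smooth_empty: "smooth {} = {1}"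
proof -
  have "d = 1" if "d > 0" "prime_factors d = {}" for d :: nat
    using that prime_factorization_empty_iff[of d] by (auto)
  then show ?thesis by (auto simp: smooth_def)
qed

text \<open>Sum the rows at one prime after the other, until only the value at \<open>1\<close> is left.\<close>

lemma weight_nonneg:
  assumes "finite Q" "\<forall>q\<in>Q. prime q" "holo Q A"
  shows "0 \<le> weight A"
  using assms
proof (induction Q arbitrary: A rule: finite_induct)
  case empty
  then have sub: "{d. A d \<noteq> 0} \<subseteq> {1}" by (simp add: holo_def fin_on_def smooth_empty)
  have "0 \<le> cusp_order A 1" using empty by (simp add: holo_def)
  then show ?case using sub
    by (simp add: cusp_order_def pairing_eq_sum[of "{1}"])
next
  case (insert p Q)
  have "weight (collapse p (\<lambda>_. 1) A) = weight A"
    using insert.prems by (subst pairing_collapse) (auto simp: holo_def fin_on_def)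
  moreover have "holo Q (collapse p (\<lambda>_. 1) A)"
    using insert.prems one_preserves_holo by (auto simp: preserves_holo_def)
  ultimately show ?case using insert.IH insert.prems by (metis insert_iff)
qed

section \<open>Differences of holomorphic exponent families\<close>

text \<open>The norm whose unit ball is spanned by the holomorphic families of weight \<open>1\<close> and their negatives: \<open>r\<close> is an
upper bound for the norm of \<open>T\<close>.\<close>

definition holo_diff :: "nat set \<Rightarrow> (nat \<Rightarrow> real) \<Rightarrow> real \<Rightarrow> bool" where
  "holo_diff Q T r \<longleftrightarrow>
     (\<exists>A B. holo Q A \<and> holo Q B \<and> T = (\<lambda>d. A d - B d) \<and> weight A + weight B \<le> r)"

lemma holo_diff_mono: "holo_diff Q T r \<Longrightarrow> r \<le> r' \<Longrightarrow> holo_diff Q T r'"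
  unfolding holo_diff_def by (elim exE conjE) (intro exI conjI; (assumption | rule order_trans))

lemma holo_diff_fin:
  assumes "holo_diff Q T r" shows "fin_on (smooth Q) T"
proof -
  obtain A B where "fin_on (smooth Q) A" "fin_on (smooth Q) B" "T = (\<lambda>d. A d - B d)"
    using assms by (auto simp: holo_diff_def holo_def)
  then show ?thesis using fin_on_comb[of "smooth Q" A B 1 "-1"] by simp
qed

lemma holo_zero: "holo Q (\<lambda>_. 0)"
  by (simp add: holo_def fin_on_def cusp_order_def pairing_def)

lemma holo_diff_self: "holo Q A \<Longrightarrow> holo_diff Q A (weight A)"
  unfolding holo_diff_def
  by (rule exI[of _ A], rule exI[of _ "\<lambda>_. 0"]) (simp add: holo_zero pairing_def)

lemma holo_diff_add:
  assumes "holo_diff Q T r" "holo_diff Q U q"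
  shows "holo_diff Q (\<lambda>d. T d + U d) (r + q)"
proof -
  obtain A B where 1: "holo Q A" "holo Q B" "T = (\<lambda>d. A d - B d)" "weight A + weight B \<le> r"
    using assms by (auto simp: holo_diff_def)
  obtain C D where 2: "holo Q C" "holo Q D" "U = (\<lambda>d. C d - D d)" "weight C + weight D \<le> q"
    using assms by (auto simp: holo_diff_def)
  show ?thesis unfolding holo_diff_def
    by (rule exI[of _ "\<lambda>d. 1 * A d + 1 * C d"], rule exI[of _ "\<lambda>d. 1 * B d + 1 * D d"], intro conjI
        holo_comb 1 2) (use 1 2 weight_comb[OF 1(1) 2(1), of 1 1] weight_comb[OF 1(2) 2(2), of 1 1] in auto)
qed

lemma holo_diff_scale:
  assumes "holo_diff Q T r"
  shows "holo_diff Q (\<lambda>d. a * T d) (\<bar>a\<bar> * r)"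
proof -
  obtain A B where 1: "holo Q A" "holo Q B" "T = (\<lambda>d. A d - B d)" "weight A + weight B \<le> r"
    using assms by (auto simp: holo_diff_def)
  have 2: "\<bar>a\<bar> * weight A + \<bar>a\<bar> * weight B \<le> \<bar>a\<bar> * r"
    using mult_left_mono[OF 1(4), of "\<bar>a\<bar>"] by (simp add: algebra_simps)
  have 3: "holo Q (\<lambda>d. \<bar>a\<bar> * A d + 0 * A d)" "holo Q (\<lambda>d. \<bar>a\<bar> * B d + 0 * B d)"
    using holo_comb[OF 1(1) 1(1), of "\<bar>a\<bar>" 0] holo_comb[OF 1(2) 1(2), of "\<bar>a\<bar>" 0] by simp_all
  have 4: "weight (\<lambda>d. \<bar>a\<bar> * A d + 0 * A d) = \<bar>a\<bar> * weight A"
          "weight (\<lambda>d. \<bar>a\<bar> * B d + 0 * B d) = \<bar>a\<bar> * weight B"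
    using weight_comb[OF 1(1) 1(1), of "\<bar>a\<bar>" 0] weight_comb[OF 1(2) 1(2), of "\<bar>a\<bar>" 0] by simp_all
  show ?thesis
  proof (cases "a \<ge> 0")
    case True
    show ?thesis unfolding holo_diff_def
      by (rule exI, rule exI, rule conjI[OF 3(1) conjI[OF 3(2)]], unfold 4)
         (use True 1 2 in \<open>auto simp: algebra_simps\<close>)
  next
    case False
    show ?thesis unfolding holo_diff_def
      by (rule exI, rule exI, rule conjI[OF 3(2) conjI[OF 3(1)]], unfold 4)
         (use False 1 2 in \<open>auto simp: algebra_simps\<close>)
  qed
qed

lemma holo_diff_comb:
  assumes "holo_diff Q T r" "holo_diff Q U q"
  shows "holo_diff Q (\<lambda>d. a * T d + b * U d) (\<bar>a\<bar> * r + \<bar>b\<bar> * q)"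
  using holo_diff_add[OF holo_diff_scale[OF assms(1)] holo_diff_scale[OF assms(2)]] .

lemma holo_diff_weight:
  assumes "finite Q" "\<forall>q\<in>Q. prime q" "holo_diff Q T r"
  shows "\<bar>weight T\<bar> \<le> r"
proof -
  obtain A B where 1: "holo Q A" "holo Q B" "T = (\<lambda>d. A d - B d)" "weight A + weight B \<le> r"
    using assms by (auto simp: holo_diff_def)
  then have "weight T = weight A - weight B" using weight_comb[OF 1(1,2), of 1 "-1"] by simp
  then show ?thesis using weight_nonneg[OF assms(1,2) 1(1)] weight_nonneg[OF assms(1,2) 1(2)] 1(4) by simp
qed

text \<open>The value \<open>s u\<close> is the total weight that remains after collapsing both parts of \<open>T\<close> with \<open>u\<close>. It is linear in \<open>u\<close>, so a
decomposition of \<open>1\<close> into functions \<open>u\<close> that preserve holomorphy distributes the norm bound \<open>r\<close>.\<close>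

lemma holo_diff_collapse:
  assumes p: "prime p" and Q: "finite Q" "\<forall>q\<in>Q. prime q" and T: "holo_diff (insert p Q) T r"
  obtains s where
    "\<And>a u b v. s (\<lambda>j. a * u j + b * v j) = a * s u + b * s v"
    "\<And>u. preserves_holo p u \<Longrightarrow> 0 \<le> s u"
    "\<And>u. preserves_holo p u \<Longrightarrow> holo_diff Q (collapse p u T) (s u)"
    "s (\<lambda>_. 1) \<le> r"
proof -
  obtain A B where 1: "holo (insert p Q) A" "holo (insert p Q) B" "T = (\<lambda>d. A d - B d)"
      "weight A + weight B \<le> r"
    using T by (auto simp: holo_diff_def)
  define s where "s u = pairing A (\<lambda>d. u (multiplicity p d)) + pairing B (\<lambda>d. u (multiplicity p d))" for u
  have s: "s u = weight (collapse p u A) + weight (collapse p u B)" for u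
    using 1 unfolding s_def by (subst (1 2) pairing_collapse) (auto simp: holo_def fin_on_def)
  have T': "collapse p u T = (\<lambda>m. collapse p u A m - collapse p u B m)" for u
    using collapse_comb_left[OF holo_fin[OF 1(1)] holo_fin[OF 1(2)], of p u 1 "-1"] 1(3) by auto
  show ?thesis
  proof (rule that[of s])
    show "s (\<lambda>j. a * u j + b * v j) = a * s u + b * s v" for a u b v
      unfolding s_def by (simp add: pairing_comb_right algebra_simps)
    show "0 \<le> s u" if "preserves_holo p u" for u
      unfolding s using that 1 weight_nonneg[OF Q] by (auto simp: preserves_holo_def)
    show "holo_diff Q (collapse p u T) (s u)" if "preserves_holo p u" for u
      unfolding s holo_diff_def T' using that 1 by (auto simp: preserves_holo_def)
    show "s (\<lambda>_. 1) \<le> r" using 1 by (simp add: s_def)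
  qed
qed

section \<open>Extracting the outer rows\<close>

definition slice :: "nat \<Rightarrow> nat \<Rightarrow> (nat \<Rightarrow> real) \<Rightarrow> nat \<Rightarrow> real" where
  "slice p j = collapse p (\<lambda>i. if i = j then 1 else 0)"

lemma slice_apply:
  assumes p: "prime p" and T: "T 0 = 0" and fin: "finite {d. T d \<noteq> 0}"
  shows "slice p j T m = (if p dvd m then 0 else T (p ^ j * m))"
proof -
  have eq: "{d. T d \<noteq> 0 \<and> cofactor p d = m \<and> multiplicity p d = j}
      = (if p dvd m \<or> T (p ^ j * m) = 0 then {} else {p ^ j * m})" (is "?L = ?R")
  proof -
    have "d = p ^ j * m \<and> \<not> p dvd m" if "d \<in> ?L" for d
      using that cofactor_decomp[of d p] not_dvd_cofactor[OF p, of d] T by (cases "d = 0") auto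
    moreover have "p ^ j * m \<in> ?L" if "\<not> p dvd m" "T (p ^ j * m) \<noteq> 0"
      using that cofactor_power_mult[OF p] by auto
    ultimately show ?thesis by (auto split: if_splits)
  qed
  have "slice p j T m = (\<Sum>d | T d \<noteq> 0 \<and> cofactor p d = m. if multiplicity p d = j then T d else 0)"
    unfolding slice_def collapse_def by (rule sum.cong) auto
  also have "\<dots> = (\<Sum>d | T d \<noteq> 0 \<and> cofactor p d = m \<and> multiplicity p d = j. T d)"
  proof -
    have "finite {d. T d \<noteq> 0 \<and> cofactor p d = m}" by (rule finite_subset[OF _ fin]) auto
    then show ?thesis by (subst sum.inter_filter[symmetric]) (auto intro: sum.cong)
  qed
  also have "\<dots> = (if p dvd m then 0 else T (p ^ j * m))" unfolding eq by auto
  finally show ?thesis .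
qed

lemma slice_combination:
  assumes "\<And>d. T d \<noteq> 0 \<Longrightarrow> a * u (multiplicity p d) + b * v (multiplicity p d)
      = (if multiplicity p d = j then 1 else 0)"
  shows "slice p j T = (\<lambda>m. a * collapse p u T m + b * collapse p v T m)"
  unfolding slice_def collapse_comb[symmetric]
  by (subst collapse_cong[of T _ p "\<lambda>i. a * u i + b * v i"]) (use assms in auto)

text \<open>The lowest row is extracted by \<open>low\<close> and one kernel, because the inverse of the one-prime matrix is
tridiagonal. If \<open>l\<close> is the lowest row, only \<open>j \<ge> l\<close> occurs. There \<open>low p l\<close> is proportional to \<open>decay p l\<close>, and it is preferable
because it uses the part of the weight that belongs to all kernels of index at most \<open>l\<close>.\<close>

lemma low_decay_slice:
  assumes p: "p \<ge> 2" and "l \<le> j"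
  shows "p / (real p - 1) * low p l j - p / (real p ^ 2 - 1) * decay p (Suc l) j
       = (if j = l then 1 else 0)"
proof -
  have p1: "real p > 1" using p by simp
  have pp: "real p ^ 2 - 1 = (real p - 1) * (real p + 1)" by (simp add: algebra_simps power2_eq_square)
  show ?thesis
  proof (cases "j = l")
    case True
    have "p / (real p - 1) * (p / (real p + 1)) - p / ((real p - 1) * (real p + 1)) * (1 / p) = 1"
      using p1 by (simp add: divide_simps) (simp add: algebra_simps)
    then show ?thesis using True unfolding pp by (simp add: low_def decay_def)
  next
    case False
    then obtain k where k: "j = Suc l + k" using assms(2) le_Suc_ex by (metis le_neq_implies_less Suc_leI)
    have *: "p / (real p - 1) * (p / (real p + 1) * (1 / p * x)) - p / ((real p - 1) * (real p + 1)) * x = 0" for x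
      using p1 by (simp add: divide_simps)
    have "low p l j = p / (real p + 1) * (1 / p * (1 / p) ^ k)" "decay p (Suc l) j = (1 / p) ^ k"
      using p1 by (simp_all add: low_def decay_def k Suc_diff_le)
    then show ?thesis using *[of "(1 / p) ^ k"] False unfolding pp by simp
  qed
qed

lemma high_decay_slice:
  assumes p: "p \<ge> 2" and "j \<le> Suc m"
  shows "p / (real p - 1) * high p m j - p / (real p ^ 2 - 1) * decay p m j
       = (if j = Suc m then 1 else 0)"
proof -
  have p1: "real p > 1" using p by simp
  have pp: "real p ^ 2 - 1 = (real p - 1) * (real p + 1)" by (simp add: algebra_simps power2_eq_square)
  show ?thesis
  proof (cases "j = Suc m")
    case True
    have "p / (real p - 1) * (1 - p / (real p + 1) * (1 / p)) - p / ((real p - 1) * (real p + 1)) * (1 / p) = 1"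
      using p1 by (simp add: divide_simps) (simp add: algebra_simps)
    then show ?thesis using True unfolding pp by (simp add: high_def low_def decay_def)
  next
    case False
    then have "j \<le> m" using assms by simp
    then show ?thesis using False p1 unfolding pp by (simp add: high_beyond)
  qed
qed

lemma low_high_slice:
  assumes p: "p \<ge> 2" and "j = l \<or> j = Suc l"
  shows "p / (real p - 1) * low p l j - 1 / (real p - 1) * high p l j = (if j = l then 1 else 0)"
    "p / (real p - 1) * high p l j - 1 / (real p - 1) * low p l j = (if j = Suc l then 1 else 0)"
proof -
  have p1: "real p > 1" using p by simp
  show "p / (real p - 1) * low p l j - 1 / (real p - 1) * high p l j = (if j = l then 1 else 0)"
    "p / (real p - 1) * high p l j - 1 / (real p - 1) * low p l j = (if j = Suc l then 1 else 0)"
    using assms(2) p1 by (auto simp: low_def high_def divide_simps) (auto simp: algebra_simps)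
qed

text \<open>Decompose \<open>1\<close> into the four functions that extract the lowest and the highest row and a remainder that preserves holomorphy.
If the rows are adjacent, \<open>low\<close> and \<open>high\<close> serve both of them, and if exactly one row lies between them, both use
the same kernel. In the latter case the two coefficients of this kernel add up to more than is available
when \<open>p = 2\<close>, and nothing is claimed.\<close>

lemma outer_slices:
  assumes p: "prime p" and Q: "finite Q" "\<forall>q\<in>Q. prime q" and T: "holo_diff (insert p Q) T r"
    and bd: "\<And>d. T d \<noteq> 0 \<Longrightarrow> l \<le> multiplicity p d \<and> multiplicity p d \<le> n" and ln: "l < n"
  obtains x y where "holo_diff Q (slice p l T) x" "holo_diff Q (slice p n T) y"
    "n = Suc l \<Longrightarrow> (real p - 1) * (x + y) \<le> (real p + 1) * r"
    "l + 3 \<le> n \<or> (l + 2 \<le> n \<and> p \<ge> 3) \<Longrightarrow> (real p - 1) * (x + y) \<le> real p * r"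
proof -
  obtain s where lin: "\<And>a u b v. s (\<lambda>j. a * u j + b * v j) = a * s u + b * s v"
    and nn: "\<And>u. preserves_holo p u \<Longrightarrow> 0 \<le> s u"
    and sl: "\<And>u. preserves_holo p u \<Longrightarrow> holo_diff Q (collapse p u T) (s u)"
    and one: "s (\<lambda>_. 1) \<le> r"
    using holo_diff_collapse[OF p Q T] by blast
  have p2: "p \<ge> 2" using p prime_ge_2_nat by blast
  then have p1: "real p \<ge> 2" by simp
  define c where "c = (real p - 1) / (real p + 1)"
  have c: "c > 0" "real p / (real p ^ 2 - 1) = p / (real p - 1)^2 * c"
  proof -
    have "real p ^ 2 - 1 = (real p - 1) * (real p + 1)" by (simp add: algebra_simps power2_eq_square)
    then show "c > 0" "real p / (real p ^ 2 - 1) = p / (real p - 1)^2 * c"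
      using p1 by (auto simp: c_def divide_simps power2_eq_square)
  qed
  have kl: "preserves_holo p (low p i)" "preserves_holo p (high p i)" "preserves_holo p (decay p i)" for i
    using p by (auto intro: low_preserves_holo high_preserves_holo decay_preserves_holo)
  have lh: "s (low p i) + s (high p i) \<le> r" for i
  proof -
    have "(\<lambda>_. 1) = (\<lambda>j. 1 * low p i j + 1 * high p i j)" by (auto simp: high_def)
    then show ?thesis using lin[of 1 "low p i" 1 "high p i"] one by simp
  qed
  have lS: "s (low p (Suc i)) = s (low p i) + c * s (decay p (Suc i))" for i
  proof -
    have "low p (Suc i) = (\<lambda>j. 1 * low p i j + c * decay p (Suc i) j)"
      using low_Suc[of p i] p2 by (auto simp: c_def)
    then show ?thesis using lin[of 1 "low p i" c "decay p (Suc i)"] by simp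
  qed
  have inc: "s (low p i) \<le> s (low p j)" if "i \<le> j" for i j
    by (rule lift_Suc_mono_le[of "\<lambda>i. s (low p i)", OF _ that]) (use lS c nn kl in simp)
  show ?thesis
  proof (cases "n = Suc l")
    case True
    have v: "multiplicity p d = l \<or> multiplicity p d = Suc l" if "T d \<noteq> 0" for d
      using bd[OF that] True by linarith
    have 1: "slice p l T = (\<lambda>m. p / (real p - 1) * collapse p (low p l) T m
        + (- 1 / (real p - 1)) * collapse p (high p l) T m)"
      by (rule slice_combination) (use low_high_slice(1)[OF p2 v] in simp)
    have 2: "slice p n T = (\<lambda>m. p / (real p - 1) * collapse p (high p l) T m
        + (- 1 / (real p - 1)) * collapse p (low p l) T m)"
      by (rule slice_combination) (use low_high_slice(2)[OF p2 v] True in simp)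
    let ?x = "\<bar>p / (real p - 1)\<bar> * s (low p l) + \<bar>- 1 / (real p - 1)\<bar> * s (high p l)"
    let ?y = "\<bar>p / (real p - 1)\<bar> * s (high p l) + \<bar>- 1 / (real p - 1)\<bar> * s (low p l)"
    show ?thesis
    proof (rule that[of ?x ?y])
      show "holo_diff Q (slice p l T) ?x" unfolding 1 by (intro holo_diff_comb sl kl)
      show "holo_diff Q (slice p n T) ?y" unfolding 2 by (intro holo_diff_comb sl kl)
      have "(real p - 1) * (?x + ?y) = (real p + 1) * (s (low p l) + s (high p l))"
        using p1 by (simp add: divide_simps) (simp add: algebra_simps)
      also have "\<dots> \<le> (real p + 1) * r" using lh[of l] by (intro mult_left_mono) auto
      finally show "(real p - 1) * (?x + ?y) \<le> (real p + 1) * r" .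
    qed (use True in auto)
  next
    case False
    then obtain m where m: "n = Suc m" "Suc l \<le> m" using ln by (metis Suc_leI Suc_lessE less_Suc_eq_le less_antisym)
    let ?a = "p / (real p - 1)" and ?b = "p / (real p ^ 2 - 1)"
    have 1: "slice p l T = (\<lambda>i. ?a * collapse p (low p l) T i + (- ?b) * collapse p (decay p (Suc l)) T i)"
      by (rule slice_combination) (use low_decay_slice[OF p2] bd in auto)
    have 2: "slice p n T = (\<lambda>i. ?a * collapse p (high p m) T i + (- ?b) * collapse p (decay p m) T i)"
      by (rule slice_combination) (use high_decay_slice[OF p2] bd m in auto)
    let ?x = "\<bar>?a\<bar> * s (low p l) + \<bar>- ?b\<bar> * s (decay p (Suc l))"
    let ?y = "\<bar>?a\<bar> * s (high p m) + \<bar>- ?b\<bar> * s (decay p m)"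
    have b0: "?b \<ge> 0" using p1 by (simp add: c)  (use c in simp)
    show ?thesis
    proof (rule that[of ?x ?y])
      show "holo_diff Q (slice p l T) ?x" unfolding 1 by (intro holo_diff_comb sl kl)
      show "holo_diff Q (slice p n T) ?y" unfolding 2 by (intro holo_diff_comb sl kl)
      assume far: "l + 3 \<le> n \<or> (l + 2 \<le> n \<and> p \<ge> 3)"
      define L M M' H where "L = s (low p l)" and "M = c * s (decay p (Suc l))"
        and "M' = c * s (decay p m)" and "H = s (high p m)"
      have nn': "L \<ge> 0" "M \<ge> 0" "M' \<ge> 0" "H \<ge> 0" using nn kl c by (auto simp: L_def M_def M'_def H_def)
      have e: "(real p - 1) * ?x = p * L + p / (real p - 1) * M" "(real p - 1) * ?y = p * H + p / (real p - 1) * M'"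
      proof -
        have ab: "\<bar>?a\<bar> = ?a" "\<bar>- ?b\<bar> = p / (real p - 1)^2 * c" using p1 b0 c by auto
        have "q * (P / q * U + P / q^2 * c * V) = P * U + P / q * (c * V)" if "q \<noteq> 0" for q P U V :: real
          using that by (simp add: field_simps power2_eq_square)
        from this[of "real p - 1"] p1 show "(real p - 1) * ?x = p * L + p / (real p - 1) * M"
            "(real p - 1) * ?y = p * H + p / (real p - 1) * M'"
          unfolding ab L_def M_def M'_def H_def by simp_all
      qed
      define q where "q = p / (real p - 1)"
      have sum: "(real p - 1) * (?x + ?y) = (p * L + q * M) + (p * H + q * M')"
        by (subst distrib_left) (simp only: e q_def)
      show "(real p - 1) * (?x + ?y) \<le> real p * r"
      proof (cases "m = Suc l")
        case True
        have "p \<ge> 3" using far True m by auto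
        then have "q * 2 \<le> p" by (simp add: q_def divide_simps)
        from mult_right_mono[OF this nn'(2)] have "q * M + q * M \<le> p * M" by (simp add: algebra_simps)
        moreover have "M' = M" using True by (simp add: M_def M'_def)
        ultimately have "(real p - 1) * (?x + ?y) \<le> p * (L + M + H)" unfolding sum by (simp add: distrib_left)
        moreover have "L + M + H \<le> r" using lh[of m] lS[of l] True by (simp add: L_def M_def H_def)
        ultimately show ?thesis using mult_left_mono[of "L + M + H" r p] by linarith
      next
        case False
        then obtain k where k: "m = Suc k" "Suc l \<le> k" using m by (metis Suc_leD Suc_le_D le_antisym not_less_eq_eq)
        have "q \<le> p" using p1 by (simp add: q_def divide_simps)
        then have "q * M \<le> p * M" "q * M' \<le> p * M'" using nn' by (auto intro: mult_right_mono)
        then have "(real p - 1) * (?x + ?y) \<le> p * (L + M + H + M')" unfolding sum by (simp add: distrib_left)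
        moreover have "L + M + H + M' \<le> r"
          using lh[of m] lS[of l] lS[of k] inc[OF k(2)] by (simp add: L_def M_def M'_def H_def k(1))
        ultimately show ?thesis using mult_left_mono[of "L + M + H + M'" r p] by linarith
      qed
    qed (use False in auto)
  qed
qed

lemma fin_on_smooth_zero: "fin_on (smooth Q) T \<Longrightarrow> T 0 = 0"
  by (auto simp: fin_on_def smooth_def)

lemma slice_nonzero:
  assumes "prime p" "fin_on (smooth Q) T" "T d \<noteq> 0"
  shows "slice p (multiplicity p d) T (cofactor p d) = T d"
proof -
  have "d > 0" using fin_on_smooth_zero[OF assms(2)] assms(3) by (cases d) auto
  moreover have "finite {d. T d \<noteq> 0}" using assms(2) by (simp add: fin_on_def)
  ultimately show ?thesis
    using slice_apply[of p T, OF assms(1) fin_on_smooth_zero[OF assms(2)]] not_dvd_cofactor[OF assms(1)]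
      cofactor_decomp[of d p] by simp
qed

lemma slice_int:
  assumes "\<And>d. T d \<in> \<int>" shows "slice p j T m \<in> \<int>"
  unfolding slice_def collapse_def by (intro Ints_sum) (use assms in auto)

lemma slice_range:
  assumes "prime p" "fin_on (smooth Q) T" "T d \<noteq> 0"
  obtains l n m m' where "l \<le> n" "\<And>d. T d \<noteq> 0 \<Longrightarrow> l \<le> multiplicity p d \<and> multiplicity p d \<le> n"
    "slice p l T m \<noteq> 0" "slice p n T m' \<noteq> 0"
proof -
  let ?M = "multiplicity p ` {d. T d \<noteq> 0}"
  have M: "finite ?M" "?M \<noteq> {}" using assms by (auto simp: fin_on_def)
  obtain a where a: "T a \<noteq> 0" "multiplicity p a = Min ?M" using Min_in[OF M] by auto
  obtain b where b: "T b \<noteq> 0" "multiplicity p b = Max ?M" using Max_in[OF M] by auto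
  have "slice p (Min ?M) T (cofactor p a) \<noteq> 0" "slice p (Max ?M) T (cofactor p b) \<noteq> 0"
    using slice_nonzero[OF assms(1,2) a(1)] slice_nonzero[OF assms(1,2) b(1)] a b by auto
  moreover have "Min ?M \<le> multiplicity p d \<and> multiplicity p d \<le> Max ?M" if "T d \<noteq> 0" for d
    using that M by auto
  moreover have "Min ?M \<le> Max ?M" using a M(1) by (metis (mono_tags, lifting) Max_ge image_eqI mem_Collect_eq)
  ultimately show ?thesis using that by blast
qed

text \<open>If there is only one row, it is the sum of the rows.\<close>

lemma single_slice:
  assumes p: "prime p" and Q: "finite Q" "\<forall>q\<in>Q. prime q" and T: "holo_diff (insert p Q) T r"
    and bd: "\<And>d. T d \<noteq> 0 \<Longrightarrow> multiplicity p d = l"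
  shows "holo_diff Q (slice p l T) r"
proof -
  obtain s where s: "\<And>u. preserves_holo p u \<Longrightarrow> holo_diff Q (collapse p u T) (s u)" "s (\<lambda>_. 1) \<le> r"
    using holo_diff_collapse[OF p Q T] by metis
  have "slice p l T = collapse p (\<lambda>_. 1) T"
    unfolding slice_def by (rule collapse_cong) (use bd in auto)
  then show ?thesis using s(1)[OF one_preserves_holo[OF p]] s(2) holo_diff_mono by metis
qed

section \<open>Integral families are not small\<close>

lemma int_abs_ge_1: "(x::real) \<in> \<int> \<Longrightarrow> x \<noteq> 0 \<Longrightarrow> 1 \<le> \<bar>x\<bar>"
  by (metis Ints_nonzero_abs_ge1)

text \<open>For \<open>p \<ge> 3\<close> the factors in \<open>outer_slices\<close> are at least \<open>1 / 2\<close> for each of the two outer rows, so the bound \<open>1\<close> is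
inherited from the rows.\<close>

lemma norm_ge_one_odd_primes:
  assumes "finite Q" "\<forall>q\<in>Q. prime q \<and> 3 \<le> q" "holo_diff Q T r" "\<And>d. T d \<in> \<int>" "T d\<^sub>0 \<noteq> 0"
  shows "1 \<le> r"
  using assms
proof (induction Q arbitrary: T r d\<^sub>0 rule: finite_induct)
  case empty
  have sub: "{d. T d \<noteq> 0} \<subseteq> {1}" using holo_diff_fin[OF empty(2)] by (simp add: fin_on_def smooth_empty)
  then have "d\<^sub>0 = 1" using empty by auto
  moreover have "weight T = T 1" using sub by (simp add: pairing_eq_sum[of "{1}"])
  ultimately show ?case using holo_diff_weight[OF _ _ empty(2)] int_abs_ge_1[OF empty(3) empty(4)] by simp
next
  case (insert p Q)
  have p: "prime p" "real p \<ge> 3" and Q: "finite Q" "\<forall>q\<in>Q. prime q" using insert by auto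
  have IH: "1 \<le> q" if "holo_diff Q (slice p j T) q" "slice p j T m \<noteq> 0" for q j m
    by (rule insert.IH[OF _ that(1) _ that(2)]) (use insert.prems slice_int[of T] in auto)
  obtain l n m m' where ln: "l \<le> n" "\<And>d. T d \<noteq> 0 \<Longrightarrow> l \<le> multiplicity p d \<and> multiplicity p d \<le> n"
    and m: "slice p l T m \<noteq> 0" "slice p n T m' \<noteq> 0"
    using slice_range[OF p(1) holo_diff_fin[OF insert.prems(2)] insert.prems(4)] by metis
  show ?case
  proof (cases "l = n")
    case True
    then show ?thesis using single_slice[OF p(1) Q insert.prems(2), of l] ln IH m by (metis le_antisym)
  next
    case False
    then have "l < n" using ln by simp
    then obtain x y where xy: "holo_diff Q (slice p l T) x" "holo_diff Q (slice p n T) y"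
      "n = Suc l \<Longrightarrow> (real p - 1) * (x + y) \<le> (real p + 1) * r"
      "l + 3 \<le> n \<or> (l + 2 \<le> n \<and> p \<ge> 3) \<Longrightarrow> (real p - 1) * (x + y) \<le> real p * r"
      using outer_slices[OF p(1) Q insert.prems(2) ln(2)] by (metis (no_types, lifting))
    have "x + y \<ge> 2" using IH[OF xy(1) m(1)] IH[OF xy(2) m(2)] by simp
    then have 1: "(real p - 1) * 2 \<le> (real p - 1) * (x + y)" using p by (intro mult_left_mono) auto
    have 2: "1 \<le> r" if "(real p - 1) * 2 \<le> k * r" "k \<le> (real p - 1) * 2" "k > 0" for k
    proof -
      have "k * 1 \<le> k * r" using that by linarith
      then show ?thesis using that(3) by (rule mult_left_le_imp_le)
    qed
    show ?thesis
    proof (cases "n = Suc l")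
      case True
      show ?thesis by (rule 2[of "real p + 1"]) (use xy(3)[OF True] 1 p in auto)
    next
      case False
      with \<open>l < n\<close> have "l + 3 \<le> n \<or> (l + 2 \<le> n \<and> p \<ge> 3)" using p by auto
      from xy(4)[OF this] show ?thesis by (intro 2[of "real p"]) (use 1 p in auto)
    qed
  qed
qed

lemma rows_collapse:
  assumes "\<And>d. T d \<noteq> 0 \<Longrightarrow> l \<le> multiplicity p d \<and> multiplicity p d \<le> l + 2"
  shows "collapse p u T = (\<lambda>m. u l * slice p l T m + (u (l + 1) * slice p (l + 1) T m + u (l + 2) * slice p (l + 2) T m))"
proof -
  let ?e = "\<lambda>j i. if i = j then 1 else (0::real)"
  have "collapse p u T = collapse p (\<lambda>i. u l * ?e l i + 1 * (u (l + 1) * ?e (l + 1) i + u (l + 2) * ?e (l + 2) i)) T"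
  proof (rule collapse_cong)
    fix d assume "T d \<noteq> 0"
    then have "multiplicity p d = l \<or> multiplicity p d = l + 1 \<or> multiplicity p d = l + 2"
      using assms[of d] by linarith
    then show "u (multiplicity p d) = u l * ?e l (multiplicity p d) + 1 * (u (l + 1) * ?e (l + 1) (multiplicity p d)
        + u (l + 2) * ?e (l + 2) (multiplicity p d))" by auto
  qed
  then show ?thesis unfolding slice_def
    by (intro ext) (simp only: collapse_comb, simp only: mult_1)
qed

text \<open>The case left out in \<open>outer_slices\<close>. For three consecutive rows at the prime \<open>2\<close> the functions \<open>low\<close>, \<open>decay\<close> and \<open>high\<close> are
proportional to \<open>(4, 2, 1)\<close>, \<open>(1, 2, 1)\<close> and \<open>(1, 2, 4)\<close>.\<close>

lemma three_slices:
  assumes Q: "finite Q" "\<forall>q\<in>Q. prime q" and T: "holo_diff (insert 2 Q) T r"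
    and bd: "\<And>d. T d \<noteq> 0 \<Longrightarrow> l \<le> multiplicity 2 d \<and> multiplicity 2 d \<le> l + 2"
  obtains x y z where
    "holo_diff Q (\<lambda>m. 4 * slice 2 l T m + 2 * slice 2 (l + 1) T m + slice 2 (l + 2) T m) x"
    "holo_diff Q (\<lambda>m. slice 2 l T m + 2 * slice 2 (l + 1) T m + slice 2 (l + 2) T m) y"
    "holo_diff Q (\<lambda>m. slice 2 l T m + 2 * slice 2 (l + 1) T m + 4 * slice 2 (l + 2) T m) z"
    "x + y + z \<le> 6 * r"
proof -
  have p: "prime (2::nat)" by simp
  obtain s where lin: "\<And>a u b v. s (\<lambda>j. a * u j + b * v j) = a * s u + b * s v"
    and nn: "\<And>u. preserves_holo 2 u \<Longrightarrow> 0 \<le> s u"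
    and sl: "\<And>u. preserves_holo 2 u \<Longrightarrow> holo_diff Q (collapse 2 u T) (s u)"
    and one: "s (\<lambda>_. 1) \<le> r"
    using holo_diff_collapse[OF p Q T] by blast
  have rows: "collapse 2 u T = (\<lambda>m. u l * slice 2 l T m + (u (l + 1) * slice 2 (l + 1) T m + u (l + 2) * slice 2 (l + 2) T m))"
    for u by (rule rows_collapse) (rule bd)
  have comb: "(\<lambda>m. a * slice 2 l T m + b * slice 2 (l + 1) T m + c * slice 2 (l + 2) T m)
      = (\<lambda>m. k * collapse 2 u T m)"
    if "a = k * u l" "b = k * u (l + 1)" "c = k * u (l + 2)" for a b c k u
    unfolding that rows by (simp add: algebra_simps)
  have "(\<lambda>_. 1) = (\<lambda>j. 1 * low 2 (Suc l) j + 1 * high 2 (Suc l) j)" by (auto simp: high_def)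
  then have s1: "s (low 2 (Suc l)) + s (high 2 (Suc l)) \<le> r"
    using lin[of 1 "low 2 (Suc l)" 1 "high 2 (Suc l)"] one by simp
  have "low 2 (Suc l) = (\<lambda>j. 1 * low 2 l j + 1 / 3 * decay 2 (Suc l) j)"
    using low_Suc[of 2 l] by auto
  then have s2: "s (low 2 (Suc l)) = s (low 2 l) + 1 / 3 * s (decay 2 (Suc l))"
    using lin[of 1 "low 2 l" "1/3" "decay 2 (Suc l)"] by simp
  have k: "preserves_holo 2 (low 2 l)" "preserves_holo 2 (decay 2 (Suc l))" "preserves_holo 2 (high 2 (Suc l))"
    by (simp_all add: low_preserves_holo high_preserves_holo decay_preserves_holo)
  have "(\<lambda>m. 4 * slice 2 l T m + 2 * slice 2 (l + 1) T m + 1 * slice 2 (l + 2) T m)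
      = (\<lambda>m. 6 * collapse 2 (low 2 l) T m)"
    by (rule comb) (simp_all add: low_def power2_eq_square)
  then have x: "holo_diff Q (\<lambda>m. 4 * slice 2 l T m + 2 * slice 2 (l + 1) T m + slice 2 (l + 2) T m) (6 * s (low 2 l))"
    using holo_diff_scale[OF sl[OF k(1)], of 6] by simp
  have "(\<lambda>m. 1 * slice 2 l T m + 2 * slice 2 (l + 1) T m + 1 * slice 2 (l + 2) T m)
      = (\<lambda>m. 2 * collapse 2 (decay 2 (Suc l)) T m)"
    by (rule comb) (simp_all add: decay_def)
  then have y: "holo_diff Q (\<lambda>m. slice 2 l T m + 2 * slice 2 (l + 1) T m + slice 2 (l + 2) T m) (2 * s (decay 2 (Suc l)))"
    using holo_diff_scale[OF sl[OF k(2)], of 2] by simp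
  have "(\<lambda>m. 1 * slice 2 l T m + 2 * slice 2 (l + 1) T m + 4 * slice 2 (l + 2) T m)
      = (\<lambda>m. 6 * collapse 2 (high 2 (Suc l)) T m)"
    by (rule comb) (simp_all add: low_def high_def power2_eq_square)
  then have z: "holo_diff Q (\<lambda>m. slice 2 l T m + 2 * slice 2 (l + 1) T m + 4 * slice 2 (l + 2) T m) (6 * s (high 2 (Suc l)))"
    using holo_diff_scale[OF sl[OF k(3)], of 6] by simp
  show ?thesis by (rule that[OF x y z]) (use s1 s2 in auto)
qed

text \<open>The prime \<open>2\<close> is separated last, over families for which the bound \<open>1\<close> is known. Two adjacent rows give \<open>2 / 3\<close>, as for
\<open>\<eta> / \<eta>\<^sub>2\<close>. For three rows \<open>T\<^sub>0, T\<^sub>1, T\<^sub>2\<close> the three combinations of \<open>three_slices\<close> are integral, and their differences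
are \<open>3 * T\<^sub>0\<close> and \<open>3 * T\<^sub>2\<close>; if the two outer combinations vanish, then the middle one is divisible by \<open>6\<close>.\<close>

lemma norm_ge_two_thirds:
  assumes "finite Q" "\<forall>q\<in>Q. prime q" "holo_diff Q T r" "\<And>d. T d \<in> \<int>" "T d\<^sub>0 \<noteq> 0"
  shows "2 / 3 \<le> r"
proof (cases "2 \<in> Q")
  case False
  then have "\<forall>q\<in>Q. prime q \<and> 3 \<le> q" using assms(2) prime_ge_2_nat by (metis le_neq_implies_less Suc_leI numeral_3_eq_3 numeral_2_eq_2)
  then show ?thesis using norm_ge_one_odd_primes[OF assms(1) _ assms(3-5)] by fastforce
next
  case True
  define R where "R = Q - {2}"
  have R: "finite R" "\<forall>q\<in>R. prime q" "\<forall>q\<in>R. prime q \<and> 3 \<le> q"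
    using assms(1,2) prime_ge_2_nat by (auto simp: R_def) (metis le_neq_implies_less Suc_leI numeral_3_eq_3 numeral_2_eq_2)
  have T: "holo_diff (insert 2 R) T r" using assms(3) True by (simp add: R_def insert_absorb)
  have p: "prime (2::nat)" by simp
  have IH: "1 \<le> q" if "holo_diff R V q" "\<And>m. V m \<in> \<int>" "V m \<noteq> 0" for q V m
    by (rule norm_ge_one_odd_primes[OF R(1,3) that])
  obtain l n m m' where ln: "l \<le> n" "\<And>d. T d \<noteq> 0 \<Longrightarrow> l \<le> multiplicity 2 d \<and> multiplicity 2 d \<le> n"
    and m: "slice 2 l T m \<noteq> 0" "slice 2 n T m' \<noteq> 0"
    using slice_range[OF p holo_diff_fin[OF T] assms(5)] by metis
  have int: "slice 2 j T k \<in> \<int>" for j k using slice_int assms(4) by blast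
  show ?thesis
  proof (cases "l = n")
    case True
    have "1 \<le> r" by (rule IH[OF single_slice[OF p R(1,2) T, of l] int m(1)]) (use ln True in force)
    then show ?thesis by simp
  next
    case False
    then have "l < n" using ln by simp
    then obtain x y where xy: "holo_diff R (slice 2 l T) x" "holo_diff R (slice 2 n T) y"
      "n = Suc l \<Longrightarrow> (real 2 - 1) * (x + y) \<le> (real 2 + 1) * r"
      "l + 3 \<le> n \<or> (l + 2 \<le> n \<and> (2::nat) \<ge> 3) \<Longrightarrow> (real 2 - 1) * (x + y) \<le> real 2 * r"
      using outer_slices[OF p R(1,2) T ln(2)] by (metis (no_types, lifting))
    have xy1: "x \<ge> 1" "y \<ge> 1" using IH[OF xy(1) int m(1)] IH[OF xy(2) int m(2)] by auto
    consider "n = Suc l" | "n = l + 2" | "l + 3 \<le> n" using \<open>l < n\<close> by linarith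
    then show ?thesis
    proof cases
      case 1 then show ?thesis using xy(3) xy1 by simp
    next
      case 3 then show ?thesis using xy(4) xy1 by simp
    next
      case 2
      let ?a = "slice 2 l T" and ?b = "slice 2 (l + 1) T" and ?c = "slice 2 (l + 2) T"
      have bd2: "l \<le> multiplicity 2 d \<and> multiplicity 2 d \<le> l + 2" if "T d \<noteq> 0" for d
        using ln(2)[OF that] 2 by simp
      obtain x y z where
        x: "holo_diff R (\<lambda>m. 4 * ?a m + 2 * ?b m + ?c m) x" and
        y: "holo_diff R (\<lambda>m. ?a m + 2 * ?b m + ?c m) y" and
        z: "holo_diff R (\<lambda>m. ?a m + 2 * ?b m + 4 * ?c m) z" and
        xyz: "x + y + z \<le> 6 * r"
        by (rule three_slices[OF R(1,2) T bd2])
      have "holo_diff R ?a (1 / 3 * x + 1 / 3 * y)"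
        using holo_diff_comb[OF x y, of "1/3" "-1/3"] by (simp add: algebra_simps)
      from IH[OF this int m(1)] have a: "x + y \<ge> 3" by simp
      have "holo_diff R ?c (1 / 3 * z + 1 / 3 * y)"
        using holo_diff_comb[OF z y, of "1/3" "-1/3"] by (simp add: algebra_simps)
      from IH[OF this int, of m'] m(2) 2 have c: "z + y \<ge> 3" by simp
      \<comment> \<open>A nonzero outer combination has norm at least 1, and the two others together bound 3 times a nonzero row.\<close>
      consider k where "4 * ?a k + 2 * ?b k + ?c k \<noteq> 0" | k where "?a k + 2 * ?b k + 4 * ?c k \<noteq> 0"
        | "\<And>k. 4 * ?a k + 2 * ?b k + ?c k = 0" "\<And>k. ?a k + 2 * ?b k + 4 * ?c k = 0" by blast
      then show ?thesis
      proof cases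
        case 1
        have "1 \<le> x" by (rule IH[OF x _ 1]) (intro Ints_add Ints_mult int; simp)
        then show ?thesis using c xyz by simp
      next
        case 2
        have "1 \<le> z" by (rule IH[OF z _ 2]) (intro Ints_add Ints_mult int; simp)
        then show ?thesis using a xyz by simp
      next
        case 3
        let ?v = "\<lambda>k. ?b k + 2 * ?a k"
        have *: "?c k = ?a k" "?a k = - 2 * ?v k" "?a k + 2 * ?b k + ?c k = 6 * ?v k" for k
          using 3[of k] by (auto simp: algebra_simps)
        have "holo_diff R ?v (1 / 6 * y)"
          using holo_diff_scale[OF y, of "1/6"] unfolding *(3) by (simp add: add_divide_distrib)
        moreover have "?v m \<noteq> 0" using *(2)[of m] m(1) by auto
        ultimately have "1 \<le> 1 / 6 * y" by (intro IH[of ?v]) (auto intro!: Ints_add Ints_mult int)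
        moreover have "x \<ge> 0" "z \<ge> 0"
          using holo_diff_weight[OF R(1,2) x] holo_diff_weight[OF R(1,2) z] by linarith+
        ultimately show ?thesis using xyz by simp
      qed
    qed
  qed
qed

section \<open>Primes at least five\<close>

lemma weight_slice:
  "finite {d. X d \<noteq> 0} \<Longrightarrow> weight (slice p j X) = pairing X (\<lambda>d. if multiplicity p d = j then 1 else 0)"
  unfolding slice_def by (subst pairing_collapse) simp_all

lemma pairing_int:
  assumes "\<And>d. X d \<in> \<int>" "\<And>d. f d \<in> \<int>" shows "pairing X f \<in> \<int>"
  unfolding pairing_def by (intro Ints_sum Ints_mult assms)

text \<open>Two outer rows of norm at least \<open>2 / 3\<close> need \<open>(p - 1) * (4 / 3) \<le> p\<close> if they are not adjacent. If they are adjacent, one of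
them has nonzero integral weight and hence norm at least \<open>1\<close>, and \<open>(p - 1) * (5 / 3) \<le> p + 1\<close> follows. Both fail for
\<open>p \<ge> 5\<close>.\<close>

lemma large_prime_single_slice:
  assumes p: "prime p" "p \<ge> 5" and Q: "finite Q" "\<forall>q\<in>Q. prime q"
    and X: "holo (insert p Q) X" "\<And>d. X d \<in> \<int>" "weight X = 1"
  obtains l where "\<And>d. X d \<noteq> 0 \<Longrightarrow> multiplicity p d = l"
proof -
  have p5: "real p \<ge> 5" using p by simp
  have fin: "finite {d. X d \<noteq> 0}" using X by (simp add: holo_def fin_on_def)
  have T: "holo_diff (insert p Q) X 1" using holo_diff_self[OF X(1)] X(3) by simp
  obtain d\<^sub>0 where "X d\<^sub>0 \<noteq> 0" using X(3) by (force simp: pairing_def)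
  then obtain l n m m' where ln: "l \<le> n" "\<And>d. X d \<noteq> 0 \<Longrightarrow> l \<le> multiplicity p d \<and> multiplicity p d \<le> n"
    and m: "slice p l X m \<noteq> 0" "slice p n X m' \<noteq> 0"
    using slice_range[OF p(1) holo_diff_fin[OF T]] by metis
  have int: "slice p j X k \<in> \<int>" for j k using slice_int X(2) by blast
  have "l = n"
  proof (rule ccontr)
    assume "l \<noteq> n"
    then have "l < n" using ln by simp
    then obtain x y where xy: "holo_diff Q (slice p l X) x" "holo_diff Q (slice p n X) y"
      "n = Suc l \<Longrightarrow> (real p - 1) * (x + y) \<le> (real p + 1) * 1"
      "l + 3 \<le> n \<or> (l + 2 \<le> n \<and> p \<ge> 3) \<Longrightarrow> (real p - 1) * (x + y) \<le> real p * 1"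
      using outer_slices[OF p(1) Q T ln(2)] by (metis (no_types, lifting))
    have b: "x \<ge> 2/3" "y \<ge> 2/3"
      using norm_ge_two_thirds[OF Q xy(1) int m(1)] norm_ge_two_thirds[OF Q xy(2) int m(2)] by auto
    show False
    proof (cases "n = Suc l")
      case True
      let ?i = "\<lambda>j d. if multiplicity p d = j then 1 else (0::real)"
      have "pairing X (\<lambda>d. 1 * ?i l d + 1 * ?i n d) = weight X"
      proof (rule pairing_cong)
        fix d assume "X d \<noteq> 0"
        from ln(2)[OF this] True have "multiplicity p d = l \<or> multiplicity p d = n" by linarith
        then show "1 * ?i l d + 1 * ?i n d = 1" using True by auto
      qed
      then have "weight (slice p l X) + weight (slice p n X) = 1"
        unfolding weight_slice[OF fin] using X(3) pairing_comb_right[of X 1 "?i l" 1 "?i n"] by simp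
      moreover have "weight (slice p l X) \<in> \<int>" "weight (slice p n X) \<in> \<int>"
        by (intro pairing_int int; simp)+
      ultimately have "1 \<le> \<bar>weight (slice p l X)\<bar> \<or> 1 \<le> \<bar>weight (slice p n X)\<bar>"
        using int_abs_ge_1 by (metis add_0 zero_neq_one)
      then have "x \<ge> 1 \<or> y \<ge> 1"
        using holo_diff_weight[OF Q xy(1)] holo_diff_weight[OF Q xy(2)] by linarith
      then have "x + y \<ge> 5 / 3" using b by linarith
      then have "(real p - 1) * (5 / 3) \<le> (real p - 1) * (x + y)" using p5 by (intro mult_left_mono) auto
      then show False using xy(3)[OF True] p5 by simp
    next
      case False
      then have f: "l + 3 \<le> n \<or> (l + 2 \<le> n \<and> p \<ge> 3)" using \<open>l < n\<close> p by auto
      have "(real p - 1) * (4 / 3) \<le> (real p - 1) * (x + y)" using p5 b by (intro mult_left_mono) auto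
      then show False using xy(4)[OF f] p5 by simp
    qed
  qed
  then show ?thesis using that ln(2) by (metis le_antisym)
qed

lemma single_slice_rescaling:
  assumes p: "prime p" and X: "holo (insert p Q) X" and l: "\<And>d. X d \<noteq> 0 \<Longrightarrow> multiplicity p d = l"
  shows "holo Q (\<lambda>m. X (p ^ l * m))" "weight (\<lambda>m. X (p ^ l * m)) = weight X"
    "X d \<noteq> 0 \<Longrightarrow> p ^ l dvd d"
proof -
  have fin: "finite {d. X d \<noteq> 0}" "X 0 = 0" using X fin_on_smooth_zero by (auto simp: holo_def fin_on_def)
  have "X (p ^ l * m) = 0" if "p dvd m" for m
  proof (rule ccontr)
    assume nz: "X (p ^ l * m) \<noteq> 0"
    from that have "p ^ Suc l dvd p ^ l * m" by (simp add: mult.commute)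
    moreover have "p ^ l * m \<noteq> 0" using nz fin by metis
    ultimately have "Suc l \<le> multiplicity p (p ^ l * m)"
      using p by (intro multiplicity_geI) (auto dest: not_prime_unit)
    then show False using l[OF nz] by simp
  qed
  then have "slice p l X = (\<lambda>m. X (p ^ l * m))"
    by (intro ext) (simp add: slice_apply[OF p fin(2,1)])
  moreover have "slice p l X = collapse p (\<lambda>_. 1) X"
    unfolding slice_def by (rule collapse_cong) (use l in auto)
  ultimately have *: "collapse p (\<lambda>_. 1) X = (\<lambda>m. X (p ^ l * m))" by simp
  show "holo Q (\<lambda>m. X (p ^ l * m))" unfolding *[symmetric] using one_preserves_holo[OF p] X by (auto simp: preserves_holo_def)
  show "weight (\<lambda>m. X (p ^ l * m)) = weight X"
    unfolding *[symmetric] using fin by (subst pairing_collapse) auto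
  show "p ^ l dvd d" if "X d \<noteq> 0" using l[OF that] multiplicity_dvd by metis
qed

lemma reduce_to_2_3:
  assumes "finite P" "\<forall>q\<in>P. prime q \<and> q \<ge> 5" "holo (P \<union> {2, 3}) X" "\<And>d. X d \<in> \<int>" "weight X = 1"
  shows "\<exists>c>0. (\<forall>d. X d \<noteq> 0 \<longrightarrow> c dvd d) \<and> holo {2, 3} (\<lambda>m. X (c * m)) \<and> weight (\<lambda>m. X (c * m)) = 1"
  using assms
proof (induction P arbitrary: X rule: finite_induct)
  case empty
  then show ?case by (intro exI[of _ 1]) simp
next
  case (insert p P)
  have p: "prime p" "p \<ge> 5" and Q: "finite (P \<union> {2, 3})" "\<forall>q\<in>P \<union> {2, 3}. prime q" using insert by auto
  have X: "holo (insert p (P \<union> {2, 3})) X" using insert.prems(2) by (simp only: Un_insert_left)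
  obtain l where l: "\<And>d. X d \<noteq> 0 \<Longrightarrow> multiplicity p d = l"
    using large_prime_single_slice[OF p Q X insert.prems(3,4)] by blast
  note r = single_slice_rescaling[OF p(1) X l]
  obtain c where c: "c > 0" "\<And>d. X (p ^ l * d) \<noteq> 0 \<Longrightarrow> c dvd d" "holo {2, 3} (\<lambda>m. X (p ^ l * (c * m)))"
    "weight (\<lambda>m. X (p ^ l * (c * m))) = 1"
    using insert.IH[OF _ r(1)] insert.prems r(2) by auto
  have "p ^ l * c dvd d" if nz: "X d \<noteq> 0" for d
  proof -
    obtain k where "d = p ^ l * k" using r(3)[OF _ nz] by (auto elim: dvdE)
    then show ?thesis using c(2)[of k] nz by simp
  qed
  then show ?case using c p(1) by (intro exI[of _ "p ^ l * c"]) (auto simp: mult.assoc prime_gt_0_nat)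
qed

section \<open>Powers of two\<close>

text \<open>A family on three consecutive powers of two. All families that survive the estimates at the prime \<open>2\<close> have this
form.\<close>

definition triple :: "nat \<Rightarrow> real \<Rightarrow> real \<Rightarrow> real \<Rightarrow> nat \<Rightarrow> real" where
  "triple r a b c = (\<lambda>d. if d = 2 ^ r then a else if d = 2 ^ (r + 1) then b else if d = 2 ^ (r + 2) then c else 0)"

lemma smooth_2_D:
  assumes "d \<in> smooth {2}" shows "d = 2 ^ multiplicity 2 d"
proof -
  have "d \<in> smooth (insert 2 {})" using assms by simp
  from cofactor_smooth[OF two_is_prime_nat this] have "cofactor 2 d = 1" by (simp add: smooth_empty)
  then show ?thesis using cofactor_decomp[of d 2] by simp
qed

lemma multiplicity_2_power: "multiplicity 2 (2 ^ k :: nat) = k"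
  using multiplicity_prime_power[of "2::nat" k] by simp

lemma triple_eqI:
  assumes "fin_on (smooth {2}) V" "\<And>d. V d \<noteq> 0 \<Longrightarrow> l \<le> multiplicity 2 d \<and> multiplicity 2 d \<le> l + 2"
  shows "V = triple l (V (2 ^ l)) (V (2 ^ (l + 1))) (V (2 ^ (l + 2)))"
proof
  fix d
  show "V d = triple l (V (2 ^ l)) (V (2 ^ (l + 1))) (V (2 ^ (l + 2))) d"
  proof (cases "V d = 0")
    case True
    then show ?thesis by (auto simp: triple_def)
  next
    case False
    then have "d = 2 ^ multiplicity 2 d" using assms(1) smooth_2_D by (auto simp: fin_on_def)
    moreover have "multiplicity 2 d = l \<or> multiplicity 2 d = l + 1 \<or> multiplicity 2 d = l + 2"
      using assms(2)[OF False] by linarith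
    ultimately have "d = 2 ^ l \<or> d = 2 ^ (l + 1) \<or> d = 2 ^ (l + 2)" by metis
    then show ?thesis by (auto simp: triple_def)
  qed
qed

lemma pairing_triple:
  "pairing (triple r a b c) f = a * f (2 ^ r) + b * f (2 ^ (r + 1)) + c * f (2 ^ (r + 2))"
proof -
  have "pairing (triple r a b c) f = (\<Sum>d\<in>{2 ^ r, 2 ^ (r + 1), 2 ^ (r + 2)}. triple r a b c d * f d)"
    by (rule pairing_eq_sum) (auto simp: triple_def)
  also have "\<dots> = a * f (2 ^ r) + b * f (2 ^ (r + 1)) + c * f (2 ^ (r + 2))"
    by (simp add: triple_def)
  finally show ?thesis .
qed

text \<open>For a family on the powers of two, the order at \<open>2 ^ i\<close> up to the factor \<open>2 ^ i\<close>.\<close>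

definition dyadic_order :: "nat \<Rightarrow> (nat \<Rightarrow> real) \<Rightarrow> real" where
  "dyadic_order i A = pairing A (\<lambda>d. decay 2 i (multiplicity 2 d))"

lemma dyadic_order_triple: "dyadic_order i (triple r a b c) = a * decay 2 i r + b * decay 2 i (r + 1) + c * decay 2 i (r + 2)"
  by (simp only: dyadic_order_def pairing_triple multiplicity_2_power)

lemma weight_triple: "weight (triple r a b c) = a + b + c"
  by (simp add: pairing_triple)

lemma preserves_holo_pairing_nonneg:
  assumes "prime p" "holo {p} A" "preserves_holo p u"
  shows "0 \<le> pairing A (\<lambda>d. u (multiplicity p d))"
proof -
  have "pairing A (\<lambda>d. u (multiplicity p d)) = weight (collapse p u A)"
    using assms(2) by (subst pairing_collapse) (auto simp: holo_def fin_on_def)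
  moreover have "holo {} (collapse p u A)" using assms by (auto simp: preserves_holo_def)
  ultimately show ?thesis using weight_nonneg[of "{}"] by simp
qed

lemma dyadic_order_nonneg: "holo {2} A \<Longrightarrow> 0 \<le> dyadic_order i A"
  unfolding dyadic_order_def by (rule preserves_holo_pairing_nonneg) (auto intro: decay_preserves_holo)

lemma pairing_slice_value:
  assumes "fin_on (smooth {2}) V"
    and "\<And>d. V d \<noteq> 0 \<Longrightarrow> f d = (if multiplicity 2 d = j then 1 else 0)"
  shows "pairing V f = V (2 ^ j)"
proof -
  have "pairing V f = pairing V (\<lambda>d. if d = 2 ^ j then 1 else 0)"
  proof (rule pairing_cong)
    fix d assume d: "V d \<noteq> 0"
    then have "d = 2 ^ multiplicity 2 d" using assms(1) smooth_2_D by (auto simp: fin_on_def)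
    then have "d = 2 ^ j \<longleftrightarrow> multiplicity 2 d = j" by (metis multiplicity_2_power)
    then show "f d = (if d = 2 ^ j then 1 else 0)" using assms(2)[OF d] by simp
  qed
  also have "\<dots> = (\<Sum>d\<in>insert (2 ^ j) {d. V d \<noteq> 0}. V d * (if d = 2 ^ j then 1 else 0))"
    by (rule pairing_eq_sum) (use assms in \<open>auto simp: fin_on_def\<close>)
  also have "\<dots> = V (2 ^ j)" using assms(1) by (subst sum.cong[OF refl, of _ _ "\<lambda>d. if d = 2 ^ j then V d else 0"])
      (auto simp: fin_on_def)
  finally show ?thesis .
qed

lemma decay_slice_dyadic:
  assumes "l \<le> j"
  shows "5 / 3 * decay 2 (Suc l) j - 2 / 3 * decay 2 l j - 2 / 3 * decay 2 (Suc (Suc l)) j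
    = (if j = Suc l then 1 else 0)"
proof -
  consider "j = l" | "j = Suc l" | k where "j = Suc (Suc l) + k" using assms le_Suc_ex
    by (metis Suc_leI le_neq_implies_less)
  then show ?thesis
  proof cases
    case 3
    then have "decay 2 (Suc l) j = 1/2 * (1/2)^k" "decay 2 l j = 1/4 * (1/2)^k" "decay 2 (Suc (Suc l)) j = (1/2)^k"
      by (simp_all add: decay_def Suc_diff_le)
    then show ?thesis using 3 by simp
  qed (simp_all add: decay_def Suc_diff_le)
qed

text \<open>The exponents at \<open>2 ^ r\<close>, \<open>2 ^ (r + 1)\<close> and \<open>2 ^ (r + 2)\<close> of the integral holomorphic families of weight \<open>1\<close> on
powers of two.\<close>

definition unit_triples :: "(real \<times> real \<times> real) set" where
  "unit_triples = {(1, 0, 0), (2, -1, 0), (-1, 2, 0), (-1, 3, -1), (-2, 5, -2), (1, -1, 1)}"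

text \<open>The nonzero integral families of weight \<open>0\<close> and norm at most \<open>3 / 4\<close> on powers of two, again up to the position \<open>r\<close>.\<close>

definition null_triples :: "(real \<times> real \<times> real) set" where
  "null_triples = {(1, -1, 0), (-1, 1, 0), (1, -2, 1), (-1, 2, -1)}"

lemma slice_2_apply:
  assumes "fin_on (smooth {2}) V" shows "slice 2 j V m = (if odd m then V (2 ^ j * m) else 0)"
  using slice_apply[of 2 V j m] assms fin_on_smooth_zero[OF assms] by (auto simp: fin_on_def)

lemma dyadic_range:
  assumes V: "fin_on (smooth {2}) V" and nz: "V d \<noteq> 0"
  obtains l n where "l \<le> n" "\<And>d. V d \<noteq> 0 \<Longrightarrow> l \<le> multiplicity 2 d \<and> multiplicity 2 d \<le> n"
    "V (2 ^ l) \<noteq> 0" "V (2 ^ n) \<noteq> 0"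
proof -
  obtain l n m m' where 1: "l \<le> n" "\<And>d. V d \<noteq> 0 \<Longrightarrow> l \<le> multiplicity 2 d \<and> multiplicity 2 d \<le> n"
    "slice 2 l V m \<noteq> 0" "slice 2 n V m' \<noteq> 0"
    using slice_range[OF two_is_prime_nat V nz] by metis
  have "V (2 ^ j) \<noteq> 0" if "slice 2 j V m \<noteq> 0" for j m
  proof -
    have m: "odd m" "V (2 ^ j * m) \<noteq> 0" using that slice_2_apply[OF V] by (auto split: if_splits)
    then have "2 ^ j * m = 2 ^ multiplicity 2 (2 ^ j * m)" using V smooth_2_D by (auto simp: fin_on_def)
    also have "multiplicity 2 (2 ^ j * m) = j" using cofactor_power_mult(2)[of 2 m j] m by simp
    finally show ?thesis using m by simp
  qed
  then show ?thesis using that[OF 1(1,2)] 1(3,4) by blast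
qed

lemma real_int_cases:
  assumes "(x::real) \<in> \<int>" obtains i :: int where "x = real_of_int i"
  using assms by (auto elim: Ints_cases)

text \<open>If the support has length at most three, three orders and the weight leave finitely many cases. For a longer support the total weight \<open>1\<close>
is used up exactly by the two outer entries, so all orders near the lower end are known, and the second entry
would be half an odd integer.\<close>

lemma unit_dyadic:
  assumes S: "holo {2} S" "\<And>d. S d \<in> \<int>" "weight S = 1"
  obtains r a b c where "S = triple r a b c" "(a, b, c) \<in> unit_triples"
proof -
  have V: "fin_on (smooth {2}) S" using S by (simp add: holo_def)
  obtain d\<^sub>0 where "S d\<^sub>0 \<noteq> 0" using S(3) by (force simp: pairing_def)
  then obtain l n where ln: "l \<le> n" "\<And>d. S d \<noteq> 0 \<Longrightarrow> l \<le> multiplicity 2 d \<and> multiplicity 2 d \<le> n"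
    and nz: "S (2 ^ l) \<noteq> 0" "S (2 ^ n) \<noteq> 0"
    using dyadic_range[OF V] by metis
  show ?thesis
  proof (cases "n \<le> l + 2")
    case True
    let ?a = "S (2 ^ l)" and ?b = "S (2 ^ (l + 1))" and ?c = "S (2 ^ (l + 2))"
    have t: "S = triple l ?a ?b ?c" by (rule triple_eqI[OF V]) (use ln(2) True in fastforce)
    obtain a b c :: int where abc: "?a = a" "?b = b" "?c = c" using S(2) real_int_cases by metis
    have "0 \<le> dyadic_order l (triple l a b c)" "0 \<le> dyadic_order (l + 1) (triple l a b c)" "0 \<le> dyadic_order (l + 2) (triple l a b c)"
      using dyadic_order_nonneg[OF S(1)] t unfolding abc by metis+
    then have "0 \<le> 4 * real_of_int a + 2 * b + c" "0 \<le> real_of_int a + 2 * b + c" "0 \<le> real_of_int a + 2 * b + 4 * c"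
      by (simp_all add: dyadic_order_triple decay_def power2_eq_square)
    then have ineq: "0 \<le> 4 * a + 2 * b + c" "0 \<le> a + 2 * b + c" "0 \<le> a + 2 * b + 4 * c" by linarith+
    have "real_of_int a + b + c = 1" using S(3) weight_triple[of l a b c] t unfolding abc by metis
    then have sum: "a + b + c = 1" by linarith
    have a0: "a \<noteq> 0" using nz(1) abc by simp
    have "b = 0 \<and> c = 0 \<or> b \<noteq> 0 \<and> c = 0 \<or> c \<noteq> 0" by blast
    then have "(a, b, c) \<in> {(1, 0, 0), (2, -1, 0), (-1, 2, 0), (-1, 3, -1), (-2, 5, -2), (1, -1, 1)}"
    proof (elim disjE conjE)
      assume "b = 0" "c = 0" then show ?thesis using sum by simp
    next
      assume "b \<noteq> 0" "c = 0"
      moreover from this have "a = -1 \<or> a = 0 \<or> a = 1 \<or> a = 2" using ineq sum by presburger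
      ultimately show ?thesis using sum a0 by auto
    next
      assume "c \<noteq> 0"
      have "-2 \<le> a" "a \<le> 2" "-2 \<le> c" "c \<le> 2" using ineq sum by presburger+
      then have "a \<in> {-2, -1, 1, 2}" "c \<in> {-2, -1, 1, 2}" using a0 \<open>c \<noteq> 0\<close> by auto
      moreover have "0 \<le> 2 + 2 * a - c" "0 \<le> 2 - a - c" "0 \<le> 2 + 2 * c - a" using ineq sum by linarith+
      ultimately have "a = 1 \<and> c = 1 \<or> a = -1 \<and> c = -1 \<or> a = -2 \<and> c = -2"
        by (elim insertE emptyE; simp)
      moreover have "b = 1 - a - c" using sum by simp
      ultimately show ?thesis by (elim disjE conjE) (simp_all only: insert_iff, simp_all)
    qed
    then have "(real_of_int a, real_of_int b, real_of_int c) \<in> unit_triples"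
      by (elim insertE emptyE Pair_inject; simp add: unit_triples_def)
    then show ?thesis by (rule that[OF t[unfolded abc]])
  next
    case False
    then obtain m where m: "n = Suc m" "l + 2 \<le> m" by (metis Suc_le_D add_Suc_right not_less_eq_eq one_add_one plus_1_eq_Suc)
    define s where "s u = pairing S (\<lambda>d. u (multiplicity 2 d))" for u
    have lin: "s (\<lambda>j. a * u j + b * v j) = a * s u + b * s v" for a u b v
      unfolding s_def by (rule pairing_comb_right)
    have nn: "0 \<le> s u" if "preserves_holo 2 u" for u
      unfolding s_def by (rule preserves_holo_pairing_nonneg) (use S that in auto)
    have k: "preserves_holo 2 (low 2 i)" "preserves_holo 2 (high 2 i)" "preserves_holo 2 (decay 2 i)" for i
      by (auto intro: low_preserves_holo high_preserves_holo decay_preserves_holo)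
    have lS: "s (low 2 (Suc i)) = s (low 2 i) + 1 / 3 * s (decay 2 (Suc i))" for i
    proof -
      have "low 2 (Suc i) = (\<lambda>j. 1 * low 2 i j + 1 / 3 * decay 2 (Suc i) j)"
        using low_Suc[of 2 i] by auto
      then show ?thesis using lin[of 1 "low 2 i" "1/3" "decay 2 (Suc i)"] by simp
    qed
    have inc: "s (low 2 i) \<le> s (low 2 j)" if "i \<le> j" for i j
      by (rule lift_Suc_mono_le[of "\<lambda>i. s (low 2 i)", OF _ that]) (use lS nn k in simp)
    have lh: "s (low 2 i) + s (high 2 i) = 1" for i
    proof -
      have "(\<lambda>_. 1) = (\<lambda>j. 1 * low 2 i j + 1 * high 2 i j)" by (auto simp: high_def)
      moreover have "s (\<lambda>_. 1) = 1" using S(3) by (simp add: s_def)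
      ultimately show ?thesis using lin[of 1 "low 2 i" 1 "high 2 i"] by simp
    qed
    have va: "S (2 ^ l) = 2 * s (low 2 l) - 2 / 3 * s (decay 2 (Suc l))"
    proof -
      have "S (2 ^ l) = s (\<lambda>j. 2 * low 2 l j + (- 2 / 3) * decay 2 (Suc l) j)"
        unfolding s_def by (rule pairing_slice_value[OF V, symmetric])
          (use low_decay_slice[of 2 l] ln(2) in \<open>auto simp: algebra_simps\<close>)
      then show ?thesis unfolding lin by simp
    qed
    have vb: "S (2 ^ n) = 2 * s (high 2 m) - 2 / 3 * s (decay 2 m)"
    proof -
      have "S (2 ^ n) = s (\<lambda>j. 2 * high 2 m j + (- 2 / 3) * decay 2 m j)"
        unfolding s_def by (rule pairing_slice_value[OF V, symmetric])
          (use high_decay_slice[of 2 _ m] ln(2) m in \<open>auto simp: algebra_simps\<close>)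
      then show ?thesis unfolding lin by simp
    qed
    have vc: "S (2 ^ Suc l) = 5 / 3 * s (decay 2 (Suc l)) - 2 / 3 * s (decay 2 l) - 2 / 3 * s (decay 2 (Suc (Suc l)))"
    proof -
      have "S (2 ^ Suc l) = s (\<lambda>j. 1 * (5 / 3 * decay 2 (Suc l) j + (- 2 / 3) * decay 2 l j)
          + (- 2 / 3) * decay 2 (Suc (Suc l)) j)"
        unfolding s_def by (rule pairing_slice_value[OF V, symmetric])
          (use decay_slice_dyadic[of l] ln(2) in \<open>auto simp: algebra_simps\<close>)
      then show ?thesis unfolding lin by simp
    qed
    have yl: "s (low 2 l) = 2 / 3 * s (decay 2 l)"
    proof -
      have "s (low 2 l) = s (\<lambda>j. 2 / 3 * decay 2 l j + 0 * decay 2 l j)"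
        unfolding s_def by (rule pairing_cong) (use ln(2) in \<open>auto simp: low_def decay_def\<close>)
      then show ?thesis unfolding lin by simp
    qed
    define x y y' z where "x = s (low 2 l)" and "y = 1 / 3 * s (decay 2 (Suc l))"
      and "y' = 1 / 3 * s (decay 2 m)" and "z = s (high 2 m)"
    have pos: "x \<ge> 0" "y \<ge> 0" "y' \<ge> 0" "z \<ge> 0" using nn k by (auto simp: x_def y_def y'_def z_def)
    have ab: "S (2 ^ l) = 2 * x - 2 * y" "S (2 ^ n) = 2 * z - 2 * y'"
      using va vb by (auto simp: x_def y_def y'_def z_def)
    then have big: "1 \<le> \<bar>2 * x - 2 * y\<bar>" "1 \<le> \<bar>2 * z - 2 * y'\<bar>"
      using int_abs_ge_1[OF S(2) nz(1)] int_abs_ge_1[OF S(2) nz(2)] by auto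
    obtain i where i: "m = Suc i" "Suc l \<le> i" using m(2) by (metis Suc_le_D Suc_le_mono add_2_eq_Suc')
    have small: "x + y + y' + z \<le> 1"
      using lh[of m] lS[of l] lS[of i] inc[OF i(2)] by (simp add: x_def y_def y'_def z_def i(1))
    have xy: "x = 1/2 \<and> y = 0 \<or> x = 0 \<and> y = 1/2" "z = 1/2 \<and> y' = 0 \<or> z = 0 \<and> y' = 1/2"
    proof -
      have *: "u = 1/2 \<and> v = 0 \<or> u = 0 \<and> v = 1/2"
        if "1 \<le> \<bar>2 * u - 2 * v\<bar>" "u + v \<le> 1/2" "0 \<le> u" "0 \<le> v" for u v :: real
      proof (cases "v \<le> u")
        case True
        then have "u = 1/2" "v = 0" using that by linarith+
        then show ?thesis by simp
      next
        case False
        then have "u = 0" "v = 1/2" using that by linarith+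
        then show ?thesis by simp
      qed
      have "1/2 \<le> x + y" "1/2 \<le> y' + z"
        using pos big by linarith+
      with small have "x + y \<le> 1/2" "z + y' \<le> 1/2" by linarith+
      then show "x = 1/2 \<and> y = 0 \<or> x = 0 \<and> y = 1/2" "z = 1/2 \<and> y' = 0 \<or> z = 0 \<and> y' = 1/2"
        using * pos big by blast+
    qed
    \<comment> \<open>The next order is either the one at the upper end, or it belongs to the part without weight.\<close>
    have "s (decay 2 (Suc (Suc l))) \<in> {0, 3/2}"
    proof (cases "i = Suc l")
      case True
      then show ?thesis using xy(2) i by (auto simp: y'_def)
    next
      case False
      then have "Suc (Suc l) \<le> i" using i by simp
      then have "x + y + 1/3 * s (decay 2 (Suc (Suc l))) + y' + z \<le> 1"
        using lh[of m] lS[of l] lS[of "Suc l"] lS[of i] inc[of "Suc (Suc l)" i]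
        by (simp add: x_def y_def y'_def z_def i(1))
      then have "s (decay 2 (Suc (Suc l))) \<le> 0" using xy by auto
      then show ?thesis using nn[OF k(3)[of "Suc (Suc l)"]] by simp
    qed
    then have "2 * S (2 ^ Suc l) \<in> {-1, -3, 5, 3}"
      using xy(1) vc yl by (auto simp: x_def y_def)
    moreover obtain q :: int where "S (2 ^ Suc l) = q" using S(2) real_int_cases by metis
    ultimately have "2 * real_of_int q \<in> {-1, -3, 5, 3}" by simp
    then have "2 * q = -1 \<or> 2 * q = -3 \<or> 2 * q = 5 \<or> 2 * q = 3" by auto
    then have False by presburger
    then show ?thesis ..
  qed
qed

lemma holo_diff_empty: "holo_diff {} V q \<Longrightarrow> \<bar>V 1\<bar> \<le> q"
  using holo_diff_weight[of "{}" V q] holo_diff_fin[of "{}" V q]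
  by (simp add: fin_on_def smooth_empty pairing_eq_sum[of "{1}"])

text \<open>The outer entries are at least \<open>1\<close> in absolute value, which by \<open>outer_slices\<close> excludes a support of length greater than three;
\<open>three_slices\<close> settles length three.\<close>

lemma null_dyadic:
  assumes D: "holo_diff {2} D (3 / 4)" "\<And>d. D d \<in> \<int>" "weight D = 0" "D d\<^sub>0 \<noteq> 0"
  obtains r a b c where "D = triple r a b c" "(a, b, c) \<in> null_triples"
proof -
  have V: "fin_on (smooth {2}) D" using holo_diff_fin[OF D(1)] .
  have D1: "holo_diff (insert 2 {}) D (3 / 4)" using D by simp
  obtain l n where ln: "l \<le> n" "\<And>d. D d \<noteq> 0 \<Longrightarrow> l \<le> multiplicity 2 d \<and> multiplicity 2 d \<le> n"
    and nz: "D (2 ^ l) \<noteq> 0" "D (2 ^ n) \<noteq> 0"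
    using dyadic_range[OF V D(4)] by metis
  have sl: "slice 2 j D 1 = D (2 ^ j)" for j using slice_2_apply[OF V] by simp
  have val0: "D (2 ^ j) = 0" if "j > n" for j
    using ln(2)[of "2 ^ j"] that multiplicity_2_power[of j] by fastforce
  let ?a = "D (2 ^ l)" and ?b = "D (2 ^ (l + 1))" and ?c = "D (2 ^ (l + 2))"
  obtain a b c :: int where abc: "?a = a" "?b = b" "?c = c" using D(2) real_int_cases by metis
  have out: "2 * (\<bar>?a\<bar> + \<bar>D (2 ^ n)\<bar>) \<le> (if n = Suc l then 9 / 2 else 3)"
    if lt: "l < n" "n \<noteq> l + 2"
  proof -
    obtain x y where xy: "holo_diff {} (slice 2 l D) x" "holo_diff {} (slice 2 n D) y"
      "n = Suc l \<Longrightarrow> (real 2 - 1) * (x + y) \<le> (real 2 + 1) * (3 / 4)"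
      "l + 3 \<le> n \<or> (l + 2 \<le> n \<and> (2::nat) \<ge> 3) \<Longrightarrow> (real 2 - 1) * (x + y) \<le> real 2 * (3 / 4)"
      by (rule outer_slices[OF two_is_prime_nat _ _ D1 ln(2) lt(1)]) auto
    have "\<bar>?a\<bar> \<le> x" "\<bar>D (2 ^ n)\<bar> \<le> y" using holo_diff_empty[OF xy(1)] holo_diff_empty[OF xy(2)] sl by auto
    then show ?thesis using xy(3,4) lt by (cases "n = Suc l") auto
  qed
  have ge1: "1 \<le> \<bar>?a\<bar>" "1 \<le> \<bar>D (2 ^ n)\<bar>" using int_abs_ge_1 D(2) nz by auto
  have le2: "n \<le> l + 2"
  proof (rule ccontr)
    assume "\<not> n \<le> l + 2" then show False using out ge1 by simp
  qed
  have t: "D = triple l ?a ?b ?c" by (rule triple_eqI[OF V]) (use ln(2) le2 in fastforce)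
  have "real_of_int a + b + c = 0" using D(3) weight_triple[of l a b c] t unfolding abc by metis
  then have sum: "a + b + c = 0" by linarith
  have a0: "a \<noteq> 0" using nz(1) abc by simp
  consider "n = l" | "n = Suc l" | "n = l + 2" using ln(1) le2 by linarith
  then have "(a, b, c) \<in> {(1, -1, 0), (-1, 1, 0), (1, -2, 1), (-1, 2, -1)}"
  proof cases
    case 1
    then have "b = 0" "c = 0" using val0[of "l + 1"] val0[of "l + 2"] abc by auto
    then show ?thesis using sum a0 by simp
  next
    case 2
    then have "c = 0" using val0[of "l + 2"] abc by auto
    then have "b = - a" using sum by simp
    moreover have "2 * (\<bar>real_of_int a\<bar> + \<bar>real_of_int b\<bar>) \<le> 9 / 2"
      using out 2 abc by simp
    ultimately have "real_of_int \<bar>a\<bar> < 2" by simp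
    then have "\<bar>a\<bar> < 2" by linarith
    then have "a = 1 \<or> a = -1" using a0 by linarith
    then show ?thesis using \<open>c = 0\<close> \<open>b = - a\<close> by auto
  next
    case 3
    then have c0: "c \<noteq> 0" using nz(2) abc by simp
    have bd2: "l \<le> multiplicity 2 d \<and> multiplicity 2 d \<le> l + 2" if "D d \<noteq> 0" for d
      using ln(2)[OF that] 3 by simp
    obtain x y z where xyz:
      "holo_diff {} (\<lambda>m. 4 * slice 2 l D m + 2 * slice 2 (l + 1) D m + slice 2 (l + 2) D m) x"
      "holo_diff {} (\<lambda>m. slice 2 l D m + 2 * slice 2 (l + 1) D m + slice 2 (l + 2) D m) y"
      "holo_diff {} (\<lambda>m. slice 2 l D m + 2 * slice 2 (l + 1) D m + 4 * slice 2 (l + 2) D m) z"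
      "x + y + z \<le> 6 * (3 / 4)"
      by (rule three_slices[OF _ _ D1 bd2]) auto
    have "\<bar>4 * real_of_int a + 2 * b + c\<bar> + \<bar>real_of_int a + 2 * b + c\<bar> + \<bar>real_of_int a + 2 * b + 4 * c\<bar> \<le> 9 / 2"
      using holo_diff_empty[OF xyz(1)] holo_diff_empty[OF xyz(2)] holo_diff_empty[OF xyz(3)] xyz(4)
      unfolding sl abc by linarith
    then have "\<bar>4 * a + 2 * b + c\<bar> + \<bar>a + 2 * b + c\<bar> + \<bar>a + 2 * b + 4 * c\<bar> \<le> 4" by linarith
    moreover have b: "b = - a - c" using sum by simp
    ultimately have "\<bar>2 * a - c\<bar> + \<bar>a + c\<bar> + \<bar>2 * c - a\<bar> \<le> 4" by simp
    then have "a = 1 \<and> c = 1 \<or> a = -1 \<and> c = -1" using a0 c0 by linarith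
    then show ?thesis using b by auto
  qed
  then have "(real_of_int a, real_of_int b, real_of_int c) \<in> null_triples"
      by (elim insertE emptyE Pair_inject; simp add: null_triples_def)
  then show ?thesis by (rule that[OF t[unfolded abc]])
qed

section \<open>Gluing rows at the prime three\<close>

text \<open>A unit family from which \<open>5 / 3\<close> of a null family can be subtracted without losing holomorphy. Where the null family has positive
orders, the unit family must have large ones, and it has large orders only next to its own support. Therefore a few
orders fix the relative position; at distance three or more they only change by the
factor \<open>(1 / 2) ^ k\<close>.\<close>

lemma unit_null_pairs:
  assumes S: "(a, b, c) \<in> unit_triples" and D: "(x, y, z) \<in> null_triples"
    and le: "\<And>i. 5 / 3 * dyadic_order i (triple r x y z) \<le> dyadic_order i (triple q a b c)"
  shows "(x, y, z) = (1, -1, 0) \<and> q = r \<and> (a, b, c) \<in> {(1, 0, 0), (2, -1, 0)} \<or>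
    (x, y, z) = (-1, 1, 0) \<and> (q = r + 1 \<and> (a, b, c) = (1, 0, 0) \<or> q = r \<and> (a, b, c) = (-1, 2, 0)) \<or>
    (x, y, z) = (1, -2, 1) \<and> (q = r + 1 \<and> (a, b, c) = (1, 0, 0) \<or> q = r \<and> (a, b, c) = (1, -1, 1)) \<or>
    (x, y, z) = (-1, 2, -1) \<and> q = r \<and> (a, b, c) \<in> {(-1, 3, -1), (-2, 5, -2)}"
proof -
  \<comment> \<open>The places inside the support of the null family; the place below it is needed only if the unit family starts lower.\<close>
  note le' = le[of r] le[of "r + 1"] le[of "r + 2"]
  consider "q = r" | "q = r + 1" | "q = r + 2" | k where "q = r + 3 + k" | "r = q + 1" | "r = q + 2"
    | k where "r = q + 3 + k"
  proof -
    have "q = r \<or> q = r + 1 \<or> q = r + 2 \<or> r + 3 \<le> q \<or> r = q + 1 \<or> r = q + 2 \<or> q + 3 \<le> r" by linarith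
    then show ?thesis using that le_Suc_ex by metis
  qed
  then show ?thesis
  proof cases
    case 1
    show ?thesis using S D le' unfolding 1 unit_triples_def null_triples_def dyadic_order_triple
      by (elim insertE emptyE; simp add: decay_def power_divide)
  next
    case 2
    show ?thesis using S D le' unfolding 2 unit_triples_def null_triples_def dyadic_order_triple
      by (elim insertE emptyE; simp add: decay_def power_divide)
  next
    case 3
    show ?thesis using S D le' unfolding 3 unit_triples_def null_triples_def dyadic_order_triple
      by (elim insertE emptyE; simp add: decay_def power_divide)
  next
    case (4 k)
    define K :: real where "K = (1/2) ^ k"
    have h: "0 < K" "K \<le> 1" by (auto simp: K_def power_le_one)
    have g: "decay 2 (r + i) (q + j) = (1/2) ^ (3 - i + j) * K" if "i \<le> 3" for i j
      using that unfolding decay_def 4 K_def power_add[symmetric]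
      by (intro arg_cong2[of _ _ _ _ power]) auto
    have dv: "decay 2 r q = K / 8" "decay 2 r (q + 1) = K / 16" "decay 2 r (q + 2) = K / 32"
      "decay 2 (r + 1) q = K / 4" "decay 2 (r + 1) (q + 1) = K / 8" "decay 2 (r + 1) (q + 2) = K / 16"
      "decay 2 (r + 2) q = K / 2" "decay 2 (r + 2) (q + 1) = K / 4" "decay 2 (r + 2) (q + 2) = K / 8"
      using g[of 0 0] g[of 0 1] g[of 0 2] g[of 1 0] g[of 1 1] g[of 1 2] g[of 2 0] g[of 2 1] g[of 2 2]
      by (simp_all add: power_divide)
    have f: "5 / 3 * (x / 1 + y / 2 + z / 4) \<le> (a / 8 + b / 16 + c / 32) * K"
      "5 / 3 * (x / 2 + y / 1 + z / 2) \<le> (a / 4 + b / 8 + c / 16) * K"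
      "5 / 3 * (x / 4 + y / 2 + z / 1) \<le> (a / 2 + b / 4 + c / 8) * K"
      using le'[unfolded dyadic_order_triple dv] by (simp_all add: decay_def power_divide algebra_simps)
    show ?thesis using S D f h unfolding unit_triples_def null_triples_def
      by (elim insertE emptyE; simp)
  next
    case 5
    show ?thesis using S D le' le[of "r - 1"] unfolding 5 unit_triples_def null_triples_def dyadic_order_triple
      by (elim insertE emptyE; simp add: decay_def power_divide)
  next
    case 6
    show ?thesis using S D le' le[of "r - 1"] unfolding 6 unit_triples_def null_triples_def dyadic_order_triple
      by (elim insertE emptyE; simp add: decay_def power_divide)
  next
    case (7 k)
    define K :: real where "K = (1/2) ^ k"
    have h: "0 < K" "K \<le> 1" by (auto simp: K_def power_le_one)
    have g: "decay 2 (r + i) (q + j) = (1/2) ^ (3 + i - j) * K" if "j \<le> 3" for i j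
      using that unfolding decay_def 7 K_def power_add[symmetric]
      by (intro arg_cong2[of _ _ _ _ power]) auto
    have dv: "decay 2 r q = K / 8" "decay 2 r (q + 1) = K / 4" "decay 2 r (q + 2) = K / 2"
      "decay 2 (r + 1) q = K / 16" "decay 2 (r + 1) (q + 1) = K / 8" "decay 2 (r + 1) (q + 2) = K / 4"
      "decay 2 (r + 2) q = K / 32" "decay 2 (r + 2) (q + 1) = K / 16" "decay 2 (r + 2) (q + 2) = K / 8"
      using g[of 0 0] g[of 0 1] g[of 0 2] g[of 1 0] g[of 1 1] g[of 1 2] g[of 2 0] g[of 2 1] g[of 2 2]
      by (simp_all add: power_divide)
    have f: "5 / 3 * (x / 1 + y / 2 + z / 4) \<le> (a / 8 + b / 4 + c / 2) * K"
      "5 / 3 * (x / 2 + y / 1 + z / 2) \<le> (a / 16 + b / 8 + c / 4) * K"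
      "5 / 3 * (x / 4 + y / 2 + z / 1) \<le> (a / 32 + b / 16 + c / 8) * K"
      using le'[unfolded dyadic_order_triple dv] by (simp_all add: decay_def power_divide algebra_simps)
    show ?thesis using S D f h unfolding unit_triples_def null_triples_def
      by (elim insertE emptyE; simp)
  qed
qed

lemma fin_on_triple: "fin_on (smooth {2}) (triple r a b c)"
proof -
  have "q = 2" if "q \<in> prime_factors (2 ^ k)" for q k :: nat
    using that prime_dvd_power[of q 2 k] primes_dvd_imp_eq[of q 2] by auto
  then have "2 ^ k \<in> smooth {2}" for k by (fastforce simp: smooth_def)
  then have sub: "{2 ^ r, 2 ^ (r + 1), 2 ^ (r + 2)} \<subseteq> smooth {2}" by blast
  have triple: "{d. triple r a b c d \<noteq> 0} \<subseteq> {2 ^ r, 2 ^ (r + 1), 2 ^ (r + 2)}" by (auto simp: triple_def)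
  show ?thesis unfolding fin_on_def
    using finite_subset[OF triple] subset_trans[OF triple sub] by simp
qed

lemma triple_shift: "triple (r + 1) 1 0 0 = triple r 0 1 0"
  by (auto simp: triple_def)

lemma dyadic_order_comb:
  assumes "fin_on (smooth {2}) A" "fin_on (smooth {2}) B"
  shows "dyadic_order i (\<lambda>d. a * A d + b * B d) = a * dyadic_order i A + b * dyadic_order i B"
  unfolding dyadic_order_def by (rule pairing_comb[OF assms])

text \<open>Here \<open>T\<close> is the row of weight \<open>1\<close> and the null row is its only neighbour; the hypotheses are the two kernels of the
prime \<open>3\<close>. Then \<open>T + 3 * D\<close> is an integral holomorphic family of weight \<open>1\<close>, and even \<open>T + 3 * D - (8 / 3) * D\<close> is
holomorphic. So \<open>T + 3 * D\<close> is found by \<open>unit_null_pairs\<close>, and the options that fail for \<open>8 / 3\<close> are discarded.\<close>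

lemma unit_row_with_null_row:
  assumes T: "fin_on (smooth {2}) T" "\<And>d. T d \<in> \<int>" "weight T = 1"
    and D: "(x, y, z) \<in> null_triples"
    and h: "holo {2} (\<lambda>m. 1 * T m + 1 / 3 * triple r x y z m)" "holo {2} (\<lambda>m. 1 / 3 * T m + 1 * triple r x y z m)"
  shows "\<exists>a b c. T = triple r a b c \<and> ((x, y, z), (a, b, c)) \<in>
    {((1, -1, 0), (-1, 2, 0)), ((-1, 1, 0), (2, -1, 0)), ((1, -2, 1), (-2, 5, -2)), ((-1, 2, -1), (1, -1, 1))}"
proof -
  let ?D = "triple r x y z"
  define S where "S = (\<lambda>m. 1 * T m + 3 * ?D m)"
  have "holo {2} S"
    using holo_comb[OF h(2) h(2), of 3 0] unfolding S_def by (simp add: algebra_simps)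
  moreover have "S d \<in> \<int>" for d unfolding S_def using D T(2)
    by (intro Ints_add Ints_mult) (auto simp: triple_def null_triples_def)
  moreover have "weight S = 1"
    unfolding S_def pairing_comb[OF T(1) fin_on_triple] weight_triple using T(3) D by (auto simp: null_triples_def)
  ultimately obtain q a b c where S: "S = triple q a b c" "(a, b, c) \<in> unit_triples"
    using unit_dyadic by metis
  have tS: "dyadic_order i (triple q a b c) = dyadic_order i T + 3 * dyadic_order i ?D" for i
    unfolding S(1)[symmetric] S_def by (subst dyadic_order_comb[OF T(1) fin_on_triple]) simp
  have t1: "0 \<le> dyadic_order i T + 1 / 3 * dyadic_order i ?D" for i
    using dyadic_order_nonneg[OF h(1), of i] by (subst (asm) dyadic_order_comb[OF T(1) fin_on_triple]) simp
  have t2: "0 \<le> 1 / 3 * dyadic_order i T + dyadic_order i ?D" for i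
    using dyadic_order_nonneg[OF h(2), of i] by (subst (asm) dyadic_order_comb[OF T(1) fin_on_triple]) simp
  have big: "8 / 3 * dyadic_order i ?D \<le> dyadic_order i (triple q a b c)" for i using t1[of i] tS[of i] by simp
  have "5 / 3 * dyadic_order i ?D \<le> dyadic_order i (triple q a b c)" for i using big[of i] t2[of i] tS[of i] by linarith
  from unit_null_pairs[OF S(2) D this]
  have "q = r \<and> ((x, y, z), (a, b, c)) \<in>
    {((1, -1, 0), (2, -1, 0)), ((-1, 1, 0), (-1, 2, 0)), ((1, -2, 1), (1, -1, 1)), ((-1, 2, -1), (-2, 5, -2))}"
    using big[of r] big[of "r + 1"]
    by (elim disjE conjE insertE emptyE Pair_inject; simp add: dyadic_order_triple decay_def power_divide)
  moreover have "T m = triple r (a - 3 * x) (b - 3 * y) (c - 3 * z) m" if "q = r" for m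
    using fun_cong[OF S(1), of m] that by (auto simp: S_def triple_def)
  ultimately have "T = triple r (a - 3 * x) (b - 3 * y) (c - 3 * z)" and mem: "((x, y, z), (a, b, c)) \<in>
    {((1, -1, 0), (2, -1, 0)), ((-1, 1, 0), (-1, 2, 0)), ((1, -2, 1), (1, -1, 1)), ((-1, 2, -1), (-2, 5, -2))}"
    by blast+
  moreover from mem have "((x, y, z), (a - 3 * x, b - 3 * y, c - 3 * z)) \<in>
    {((1, -1, 0), (-1, 2, 0)), ((-1, 1, 0), (2, -1, 0)), ((1, -2, 1), (-2, 5, -2)), ((-1, 2, -1), (1, -1, 1))}"
    by (elim insertE emptyE Pair_inject; simp)
  ultimately show ?thesis by blast
qed

text \<open>With null rows \<open>D\<close> and \<open>U\<close> on both sides of \<open>T\<close>, the family \<open>T + 2 * D + U\<close> is still holomorphic, and it stays so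
after subtracting \<open>(5 / 3) * D\<close> or adding \<open>(1 / 3) * D\<close>. This determines it from \<open>D\<close>, and with it the sum of the rows.\<close>

lemma unit_row_beside_null_row:
  assumes T: "fin_on (smooth {2}) T" "\<And>d. T d \<in> \<int>" "weight T = 1"
    and D: "(x, y, z) \<in> null_triples"
    and U: "fin_on (smooth {2}) U" "\<And>d. U d \<in> \<int>" "weight U = 0"
    and D0: "D = triple r x y z"
    and S2: "holo {2} (\<lambda>m. 1 * T m + 1 * (2 * D m + 1 * U m))"
    and E: "\<And>i. 0 \<le> dyadic_order i T + dyadic_order i D / 3 + dyadic_order i U / 3"
    and F: "\<And>i. 0 \<le> dyadic_order i T + 3 * dyadic_order i D + dyadic_order i U / 3"
    and G: "\<And>i. 0 \<le> dyadic_order i T + dyadic_order i D / 3 + 3 * dyadic_order i U"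
  shows "\<exists>a b c. (\<lambda>m. T m + D m + U m) = triple r a b c \<and> ((x, y, z), (a, b, c)) \<in>
    {((1, -1, 0), (0, 1, 0)), ((-1, 1, 0), (1, 0, 0)), ((1, -2, 1), (-1, 3, -1)), ((-1, 2, -1), (0, 1, 0))}"
proof -
  define S where "S = (\<lambda>m. 1 * T m + 1 * (2 * D m + 1 * U m))"
  have Df: "fin_on (smooth {2}) D" using D0 fin_on_triple by simp
  note DU = fin_on_comb[OF Df U(1)]
  have "S d \<in> \<int>" for d unfolding S_def using D T(2) U(2)
    by (intro Ints_add Ints_mult) (auto simp: D0 triple_def null_triples_def)
  moreover have "weight S = 1"
    unfolding S_def pairing_comb[OF T(1) DU] pairing_comb[OF Df U(1)] using T(3) D U(3)
    by (auto simp: D0 weight_triple null_triples_def)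
  ultimately obtain q a b c where S: "S = triple q a b c" "(a, b, c) \<in> unit_triples"
    using unit_dyadic[of S] S2 unfolding S_def by metis
  have tS: "dyadic_order i (triple q a b c) = dyadic_order i T + 2 * dyadic_order i (triple r x y z) + dyadic_order i U" for i
  proof -
    have "dyadic_order i S = dyadic_order i T + 2 * dyadic_order i D + dyadic_order i U"
      unfolding S_def by (subst dyadic_order_comb[OF T(1) DU], subst dyadic_order_comb[OF Df U(1)]) simp
    then show ?thesis unfolding S(1) D0 .
  qed
  have "5 / 3 * dyadic_order i (triple r x y z) \<le> dyadic_order i (triple q a b c)" for i
    using E[of i] G[of i] tS[of i] unfolding D0 by linarith
  note tab = unit_null_pairs[OF S(2) D this]
  have up: "0 \<le> dyadic_order i (triple q a b c) + 1 / 3 * dyadic_order i (triple r x y z)" for i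
    using F[of i] G[of i] tS[of i] unfolding D0 by linarith
  have S': "T m + D m + U m = triple q a b c m - triple r x y z m" for m
    using fun_cong[OF S(1), of m] by (simp add: S_def D0)
  have "q = r \<and> ((x, y, z), (a, b, c)) \<in> {((1, -1, 0), (1, 0, 0)), ((-1, 2, -1), (-1, 3, -1))} \<or>
     q = r + 1 \<and> (a, b, c) = (1, 0, 0) \<and> (x, y, z) \<in> {(-1, 1, 0), (1, -2, 1)}"
    using tab up[of r] up[of "r + 1"]
    by (elim disjE conjE insertE emptyE Pair_inject; simp add: dyadic_order_triple decay_def power_divide)
  then have "\<exists>a' b' c'. triple q a b c = triple r a' b' c' \<and> ((x, y, z), (a', b', c')) \<in> {((1, -1, 0), (1, 0, 0)),
      ((-1, 1, 0), (0, 1, 0)), ((1, -2, 1), (0, 1, 0)), ((-1, 2, -1), (-1, 3, -1))}"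
  proof (elim disjE conjE)
    assume q: "q = r" and mem: "((x, y, z), (a, b, c)) \<in> {((1, -1, 0), (1, 0, 0)), ((-1, 2, -1), (-1, 3, -1))}"
    then show ?thesis by blast
  next
    assume q: "q = r + 1" "(a, b, c) = (1, 0, 0)" and mem: "(x, y, z) \<in> {(-1, 1, 0), (1, -2, 1)}"
    then have "triple q a b c = triple r 0 1 0" using triple_shift[of r] by simp
    moreover have "((x, y, z), (0, 1, 0)) \<in> {((1, -1, 0), (1, 0, 0)),
      ((-1, 1, 0), (0, 1, 0)), ((1, -2, 1), (0, 1, 0)), ((-1, 2, -1), (-1, 3, -1))}"
      using mem by (elim insertE emptyE Pair_inject; simp)
    ultimately show ?thesis by blast
  qed
  then obtain a' b' c' where q: "triple q a b c = triple r a' b' c'" and mem: "((x, y, z), (a', b', c')) \<in>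
      {((1, -1, 0), (1, 0, 0)), ((-1, 1, 0), (0, 1, 0)), ((1, -2, 1), (0, 1, 0)), ((-1, 2, -1), (-1, 3, -1))}"
    by blast
  have "(\<lambda>m. T m + D m + U m) = triple r (a' - x) (b' - y) (c' - z)"
    unfolding S' q by (rule ext) (simp add: triple_def)
  moreover have "((x, y, z), (a' - x, b' - y, c' - z)) \<in>
      {((1, -1, 0), (0, 1, 0)), ((-1, 1, 0), (1, 0, 0)), ((1, -2, 1), (-1, 3, -1)), ((-1, 2, -1), (0, 1, 0))}"
    using mem by (elim insertE emptyE Pair_inject; simp)
  ultimately show ?thesis by blast
qed

lemma triple_at: "triple r a b c (2 ^ k) = (if k = r then a else if k = r + 1 then b else if k = r + 2 then c else 0)"
proof -
  have "(2::nat) ^ k = 2 ^ m \<longleftrightarrow> k = m" for m by (rule power_inject_exp) simp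
  then show ?thesis unfolding triple_def by (simp only:)
qed

text \<open>The sum of the three rows is determined by either null row, so their relative position is known, and each of
the remaining configurations has a negative order in one of the three kernels.\<close>

lemma no_two_null_rows:
  assumes D: "(x, y, z) \<in> null_triples" and U: "(x', y', z') \<in> null_triples"
    and S: "(\<lambda>m. T m + triple r x y z m + triple q x' y' z' m) = triple r a b c"
       "(\<lambda>m. T m + triple q x' y' z' m + triple r x y z m) = triple q a' b' c'"
    and fin: "fin_on (smooth {2}) T"
    and mem: "((x, y, z), (a, b, c)) \<in>
    {((1, -1, 0), (0, 1, 0)), ((-1, 1, 0), (1, 0, 0)), ((1, -2, 1), (-1, 3, -1)), ((-1, 2, -1), (0, 1, 0))}"
      "((x', y', z'), (a', b', c')) \<in>
    {((1, -1, 0), (0, 1, 0)), ((-1, 1, 0), (1, 0, 0)), ((1, -2, 1), (-1, 3, -1)), ((-1, 2, -1), (0, 1, 0))}"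
    and E: "\<And>i. 0 \<le> dyadic_order i T + dyadic_order i (triple r x y z) / 3 + dyadic_order i (triple q x' y' z') / 3"
    and F: "\<And>i. 0 \<le> dyadic_order i T + 3 * dyadic_order i (triple r x y z) + dyadic_order i (triple q x' y' z') / 3"
    and G: "\<And>i. 0 \<le> dyadic_order i T + dyadic_order i (triple r x y z) / 3 + 3 * dyadic_order i (triple q x' y' z')"
  shows False
proof -
  let ?D = "triple r x y z" and ?U = "triple q x' y' z'"
  have eq: "triple r a b c = triple q a' b' c'"
    using S by (simp add: add.commute add.left_commute)
  have tS: "dyadic_order i T + dyadic_order i ?D + dyadic_order i ?U = dyadic_order i (triple r a b c)" for i
  proof -
    have "triple r a b c = (\<lambda>m. 1 * T m + 1 * (1 * ?D m + 1 * ?U m))"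
      unfolding S(1)[symmetric] by (simp add: add.assoc)
    then show ?thesis
      by (simp only:) (subst dyadic_order_comb[OF fin fin_on_comb[OF fin_on_triple fin_on_triple]],
        subst dyadic_order_comb[OF fin_on_triple fin_on_triple], simp)
  qed
  have E': "0 \<le> dyadic_order i (triple r a b c) - 2 / 3 * dyadic_order i ?D - 2 / 3 * dyadic_order i ?U" for i
    using E[of i] tS[of i] by linarith
  have F': "0 \<le> dyadic_order i (triple r a b c) + 2 * dyadic_order i ?D - 2 / 3 * dyadic_order i ?U" for i
    using F[of i] tS[of i] by linarith
  have G': "0 \<le> dyadic_order i (triple r a b c) - 2 / 3 * dyadic_order i ?D + 2 * dyadic_order i ?U" for i
    using G[of i] tS[of i] by linarith
  have val: "triple r a b c (2 ^ k) = triple q a' b' c' (2 ^ k)" for k by (simp add: eq)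
  have qr: "q = r \<or> q = r + 1 \<or> r = q + 1"
  proof -
    \<comment> \<open>The sum of the rows has exactly one positive entry, which locates both null rows.\<close>
    have peak: "0 < triple s e f g (2 ^ i) \<longleftrightarrow> i = (if e = 1 then s else s + 1)"
      if "(e, f, g) \<in> {(0, 1, 0), (1, 0, 0), (-1, 3, -1)}" for s i e f g
      using that unfolding triple_at by (elim insertE emptyE Pair_inject) simp_all
    have "(a, b, c) \<in> {(0, 1, 0), (1, 0, 0), (-1, 3, -1)}" "(a', b', c') \<in> {(0, 1, 0), (1, 0, 0), (-1, 3, -1)}"
      using mem by (elim insertE emptyE Pair_inject; simp)+
    from peak[OF this(1), of r] peak[OF this(2), of q] have "(if a = 1 then r else r + 1) = (if a' = 1 then q else q + 1)"
      unfolding val by simp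
    then show ?thesis by (auto split: if_splits)
  qed
  note ineqs = E'[of r] E'[of "r + 1"] E'[of "r + 2"] F'[of r] F'[of "r + 1"] F'[of "r + 2"]
    G'[of r] G'[of "r + 1"] G'[of "r + 2"]
  note ineqs' = E'[of q] E'[of "q + 1"] E'[of "q + 2"] F'[of q] F'[of "q + 1"] F'[of "q + 2"]
    G'[of q] G'[of "q + 1"] G'[of "q + 2"]
  from qr show False
  proof (elim disjE)
    assume q: "q = r"
    have "a = a'" "b = b'" "c = c'" using val[of r] val[of "r + 1"] val[of "r + 2"] unfolding q triple_at by simp_all
    with mem have cases: "((x, y, z), (x', y', z'), (a, b, c)) \<in>
      {((1, -1, 0), (1, -1, 0), (0, 1, 0)), ((1, -1, 0), (-1, 2, -1), (0, 1, 0)),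
       ((-1, 2, -1), (1, -1, 0), (0, 1, 0)), ((-1, 2, -1), (-1, 2, -1), (0, 1, 0)),
       ((-1, 1, 0), (-1, 1, 0), (1, 0, 0)), ((1, -2, 1), (1, -2, 1), (-1, 3, -1))}"
      by (elim insertE emptyE Pair_inject; simp)
    show False using cases ineqs[unfolded q dyadic_order_triple]
      by (elim insertE emptyE Pair_inject; simp add: decay_def power_divide)
  next
    assume q: "q = r + 1"
    have "a = 0" "b = a'" "c = b'" "c' = 0"
      using val[of r] val[of "r + 1"] val[of "r + 2"] val[of "r + 3"] unfolding q triple_at by simp_all
    with mem have cases: "((x, y, z), (x', y', z'), (a, b, c)) \<in>
      {((1, -1, 0), (-1, 1, 0), (0, 1, 0)), ((-1, 2, -1), (-1, 1, 0), (0, 1, 0))}"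
      by (elim insertE emptyE Pair_inject; simp)
    show False using cases ineqs[unfolded q dyadic_order_triple]
      by (elim insertE emptyE Pair_inject; simp add: decay_def power_divide)
  next
    assume q: "r = q + 1"
    have "a' = 0" "b' = a" "c' = b" "c = 0"
      using val[of q] val[of "q + 1"] val[of "q + 2"] val[of "q + 3"] unfolding q triple_at by simp_all
    with mem have cases: "((x, y, z), (x', y', z'), (a, b, c)) \<in>
      {((-1, 1, 0), (1, -1, 0), (1, 0, 0)), ((-1, 1, 0), (-1, 2, -1), (1, 0, 0))}"
      by (elim insertE emptyE Pair_inject; simp)
    show False using cases ineqs'[unfolded q dyadic_order_triple]
      by (elim insertE emptyE Pair_inject; simp add: decay_def power_divide)
  qed
qed

lemma multiplicity_3_cofactor_2:
  assumes "d > 0" shows "multiplicity 3 (cofactor 2 d) = multiplicity 3 d"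
proof -
  have "\<not> 3 dvd (2::nat) ^ k" for k using prime_dvd_power[of 3 "2::nat" k] by auto
  then have "multiplicity 3 (2 ^ multiplicity 2 d * cofactor 2 d) = multiplicity 3 (cofactor 2 d)"
    by (intro multiplicity_prime_elem_times_other) auto
  then show ?thesis using cofactor_decomp[of d 2] by simp
qed

text \<open>Two outer rows of norm at least \<open>1\<close> are not excluded by the norm alone when they are adjacent; then the two kernels
\<open>(3, 1)\<close> and \<open>(1, 3)\<close> are tested directly.\<close>

lemma unit_triadic:
  assumes V: "holo {3} V" "\<And>d. V d \<in> \<int>" "weight V = 1"
  obtains l where "\<And>d. V d \<noteq> 0 \<Longrightarrow> multiplicity 3 d = l"
proof -
  have p: "prime (3::nat)" by simp
  have fin: "finite {d. V d \<noteq> 0}" using V by (simp add: holo_def fin_on_def)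
  have T: "holo_diff (insert 3 {}) V 1" using holo_diff_self[OF V(1)] V(3) by simp
  obtain d\<^sub>0 where "V d\<^sub>0 \<noteq> 0" using V(3) by (force simp: pairing_def)
  then obtain l n m m' where ln: "l \<le> n" "\<And>d. V d \<noteq> 0 \<Longrightarrow> l \<le> multiplicity 3 d \<and> multiplicity 3 d \<le> n"
    and m: "slice 3 l V m \<noteq> 0" "slice 3 n V m' \<noteq> 0"
    using slice_range[OF p holo_diff_fin[OF T]] by metis
  have int: "slice 3 j V k \<in> \<int>" for j k using slice_int V(2) by blast
  have "l = n"
  proof (rule ccontr)
    assume "l \<noteq> n"
    then have lt: "l < n" using ln by simp
    obtain x y where xy: "holo_diff {} (slice 3 l V) x" "holo_diff {} (slice 3 n V) y"
      "l + 3 \<le> n \<or> (l + 2 \<le> n \<and> (3::nat) \<ge> 3) \<Longrightarrow> (real 3 - 1) * (x + y) \<le> real 3 * 1"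
      by (rule outer_slices[OF p _ _ T ln(2) lt]) auto
    have "1 \<le> x" "1 \<le> y"
      using norm_ge_one_odd_primes[OF _ _ xy(1) int m(1)] norm_ge_one_odd_primes[OF _ _ xy(2) int m(2)] by auto
    then have n: "n = Suc l" using xy(3) lt by (cases "l + 2 \<le> n") auto
    let ?i = "\<lambda>j d. if multiplicity 3 d = j then 1 else (0::real)"
    have w: "weight (slice 3 j V) \<in> \<int>" for j by (intro pairing_int int; simp)
    have sub: "slice 3 j V d = 0" if "d \<noteq> 1" for j d
      using collapse_fin_on[OF p, of "{}" V] V(1) that unfolding slice_def by (auto simp: holo_def fin_on_def smooth_empty)
    have wv: "weight (slice 3 j V) = slice 3 j V 1" for j
      using sub by (subst pairing_eq_sum[of "{1}"]) auto
    obtain a b :: int where ab: "weight (slice 3 l V) = a" "weight (slice 3 n V) = b"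
      using w real_int_cases by metis
    have nz: "a \<noteq> 0" "b \<noteq> 0" using m sub[of m l] sub[of m' n] ab wv[of l] wv[of n] by force+
    have comb: "u l * a + u n * b = pairing V (\<lambda>d. u (multiplicity 3 d))" for u :: "nat \<Rightarrow> real"
    proof -
      have "pairing V (\<lambda>d. u (multiplicity 3 d)) = pairing V (\<lambda>d. u l * ?i l d + u n * ?i n d)"
      proof (rule pairing_cong)
        fix d assume "V d \<noteq> 0"
        from ln(2)[OF this] n have "multiplicity 3 d = l \<or> multiplicity 3 d = n" by linarith
        then show "u (multiplicity 3 d) = u l * ?i l d + u n * ?i n d" using lt by auto
      qed
      then show ?thesis unfolding pairing_comb_right ab[symmetric] weight_slice[OF fin] by simp
    qed
    have "real_of_int a + b = 1" using comb[of "\<lambda>_. 1"] V(3) by simp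
    moreover have "0 \<le> decay 3 l l * a + decay 3 l n * b" "0 \<le> decay 3 n l * a + decay 3 n n * b"
      unfolding comb by (rule preserves_holo_pairing_nonneg; simp add: V decay_preserves_holo)+
    then have "0 \<le> 3 * real_of_int a + b" "0 \<le> real_of_int a + 3 * b" by (simp_all add: decay_def n)
    ultimately have "a + b = 1" "0 \<le> 3 * a + b" "0 \<le> a + 3 * b" by linarith+
    then show False using nz by presburger
  qed
  then show ?thesis using that ln(2) by (metis le_antisym)
qed

text \<open>Summing over the powers of two leaves an integral holomorphic family of weight \<open>1\<close> on powers of three, which
sits at one point. Hence the row \<open>j\<close> has weight \<open>1\<close> and all other rows have weight \<open>0\<close>.\<close>

lemma row_profile:
  assumes Z: "holo {2, 3} Z" "\<And>d. Z d \<in> \<int>" "weight Z = 1"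
  obtains j where "\<And>u. pairing Z (\<lambda>d. u (multiplicity 3 d)) = u j"
proof -
  let ?V = "collapse 2 (\<lambda>_. 1) Z"
  have fin: "finite {d. Z d \<noteq> 0}" "\<And>d. Z d \<noteq> 0 \<Longrightarrow> d > 0" using Z by (auto simp: holo_def fin_on_def smooth_def)
  have V: "holo {3} ?V" using one_preserves_holo[of 2] Z(1) by (auto simp: preserves_holo_def)
  have "?V d \<in> \<int>" for d unfolding collapse_def by (intro Ints_sum Ints_mult Z) simp
  moreover have pair: "pairing ?V (\<lambda>d. u (multiplicity 3 d)) = pairing Z (\<lambda>d. u (multiplicity 3 d))" for u
    unfolding pairing_collapse[OF fin(1)] by (rule pairing_cong) (simp add: multiplicity_3_cofactor_2 fin(2))
  ultimately obtain l where l: "\<And>d. ?V d \<noteq> 0 \<Longrightarrow> multiplicity 3 d = l"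
    using unit_triadic[OF V] pair[of "\<lambda>_. 1"] Z(3) by metis
  have "pairing Z (\<lambda>d. u (multiplicity 3 d)) = u l" for u
  proof -
    have "pairing ?V (\<lambda>d. u (multiplicity 3 d)) = pairing ?V (\<lambda>d. u l * 1)"
      by (rule pairing_cong) (use l in simp)
    also have "\<dots> = u l" unfolding pairing_scale_right using pair[of "\<lambda>_. 1"] Z(3) by simp
    finally show ?thesis using pair by simp
  qed
  then show ?thesis using that by blast
qed

text \<open>The first six entries are the unit families on powers of two. In the other eight, one row is a unit family and the
other a null family.\<close>

definition zagier_exponents :: "((real \<times> real \<times> real) \<times> (real \<times> real \<times> real)) set" where
  "zagier_exponents =
    {((1, 0, 0), (0, 0, 0)), ((2, -1, 0), (0, 0, 0)), ((-1, 2, 0), (0, 0, 0)),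
     ((-1, 3, -1), (0, 0, 0)), ((-2, 5, -2), (0, 0, 0)), ((1, -1, 1), (0, 0, 0)),
     ((1, -1, 0), (-1, 2, 0)), ((2, -1, 0), (-1, 1, 0)), ((-1, 2, 0), (1, -1, 0)),
     ((-1, 1, 0), (2, -1, 0)), ((-1, 2, -1), (1, -1, 1)), ((-2, 5, -2), (1, -2, 1)),
     ((1, -1, 1), (-1, 2, -1)), ((1, -2, 1), (-2, 5, -2))}"

text \<open>Two adjacent rows at the prime \<open>3\<close>, each a triple that starts at the same power of two.\<close>

definition has_shape :: "(nat \<Rightarrow> real) \<Rightarrow> nat \<Rightarrow> (real \<times> real \<times> real) \<times> (real \<times> real \<times> real) \<Rightarrow> bool" where
  "has_shape X \<nu> t \<longleftrightarrow> (\<forall>d. X d \<noteq> 0 \<longrightarrow> (\<exists>k\<in>{1, 2, 3, 4, 6, 12}. d = \<nu> * k)) \<and>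
     ((X \<nu>, X (\<nu> * 2), X (\<nu> * 4)), (X (\<nu> * 3), X (\<nu> * 6), X (\<nu> * 12))) = t"

lemma slice_beyond:
  assumes "\<And>d. T d \<noteq> 0 \<Longrightarrow> multiplicity p d \<noteq> j"
  shows "slice p j T = (\<lambda>_. 0)"
  unfolding slice_def collapse_def by (rule ext, rule sum.neutral) (use assms in auto)

lemma shape_of_rows:
  assumes fin: "fin_on (smooth {2, 3}) Z"
    and bd: "\<And>d. Z d \<noteq> 0 \<Longrightarrow> multiplicity 3 d = l \<or> multiplicity 3 d = l + 1"
    and r: "slice 3 l Z = triple r a b c" "slice 3 (l + 1) Z = triple r a' b' c'"
  shows "has_shape Z (2 ^ r * 3 ^ l) ((a, b, c), (a', b', c'))"
proof -
  have f: "finite {d. Z d \<noteq> 0}" and Z0: "Z 0 = 0" using fin fin_on_smooth_zero by (auto simp: fin_on_def)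
  have nd: "\<not> 3 dvd (2::nat) ^ k" for k using prime_dvd_power[of 3 "2::nat" k] by auto
  have v: "Z (3 ^ j * 2 ^ k) = slice 3 j Z (2 ^ k)" for j k
    using slice_apply[of 3 Z, OF _ Z0 f] nd by simp
  let ?n = "2 ^ r * 3 ^ l :: nat"
  have e: "?n = 3 ^ l * 2 ^ r" "?n * 2 = 3 ^ l * 2 ^ (r + 1)" "?n * 4 = 3 ^ l * 2 ^ (r + 2)"
    "?n * 3 = 3 ^ (l + 1) * 2 ^ r" "?n * 6 = 3 ^ (l + 1) * 2 ^ (r + 1)" "?n * 12 = 3 ^ (l + 1) * 2 ^ (r + 2)"
    by simp_all
  have "Z ?n = a" "Z (?n * 2) = b" "Z (?n * 4) = c" "Z (?n * 3) = a'" "Z (?n * 6) = b'" "Z (?n * 12) = c'"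
    unfolding e(2-6) unfolding e(1) v r by (simp_all add: triple_def)
  moreover have "\<exists>k\<in>{1, 2, 3, 4, 6, 12}. d = ?n * k" if nz: "Z d \<noteq> 0" for d
  proof -
    let ?j = "multiplicity 3 d" and ?m = "cofactor 3 d"
    have d: "d = 3 ^ ?j * ?m" by (rule cofactor_decomp)
    have "slice 3 ?j Z ?m \<noteq> 0" using slice_nonzero[of 3 _ Z, OF _ fin nz] nz by simp
    then have j: "?j = l \<or> ?j = l + 1" and "triple r a b c ?m \<noteq> 0 \<or> triple r a' b' c' ?m \<noteq> 0"
      using bd[OF nz] r by auto
    then have "?m = 2 ^ r \<or> ?m = 2 ^ (r + 1) \<or> ?m = 2 ^ (r + 2)" by (auto simp: triple_def split: if_splits)
    with j d have "d = ?n \<or> d = ?n * 2 \<or> d = ?n * 4 \<or> d = ?n * 3 \<or> d = ?n * 6 \<or> d = ?n * 12"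
      unfolding e(2-6) unfolding e(1) by metis
    then show ?thesis by auto
  qed
  ultimately show ?thesis unfolding has_shape_def by simp
qed

text \<open>The rows are taken at the prime \<open>3\<close>, and \<open>j\<close> is the row of weight \<open>1\<close>. By \<open>row_profile\<close> a collapse with \<open>u\<close> has weight \<open>u j\<close>, so
an outer row at distance \<open>k + 1\<close> from \<open>j\<close> has norm at most \<open>(3 / 4) * (1 / 3) ^ k\<close>, which is compatible with
\<open>norm_ge_two_thirds\<close> only for \<open>k = 0\<close>.\<close>

lemma classification_2_3:
  assumes Z: "holo {2, 3} Z" "\<And>d. Z d \<in> \<int>" "weight Z = 1"
  shows "\<exists>\<nu>>0. \<exists>t\<in>zagier_exponents. has_shape Z \<nu> t"
proof -
  have p: "prime (3::nat)" by simp
  have Q: "finite {2::nat}" "\<forall>q\<in>{2::nat}. prime q" by auto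
  have Z32: "holo (insert 3 {2}) Z" using Z(1) by (simp add: insert_commute)
  have fin: "fin_on (smooth {2, 3}) Z" "finite {d. Z d \<noteq> 0}" using Z by (auto simp: holo_def fin_on_def)
  have fin32: "fin_on (smooth (insert 3 {2})) Z" using Z32 by (simp add: holo_def)
  obtain j where j: "\<And>u. pairing Z (\<lambda>d. u (multiplicity 3 d)) = u j" using row_profile[OF Z] by metis
  have hc: "holo {2} (collapse 3 u Z)" if "preserves_holo 3 u" for u using that Z32 by (auto simp: preserves_holo_def)
  have wc: "weight (collapse 3 u Z) = u j" for u using j[of u] by (simp add: pairing_collapse[OF fin(2)])
  have hd: "holo_diff {2} (collapse 3 u Z) (u j)" if "preserves_holo 3 u" for u
    using holo_diff_self[OF hc[OF that]] wc by simp
  obtain d\<^sub>0 where "Z d\<^sub>0 \<noteq> 0" using Z(3) by (force simp: pairing_def)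
  then obtain l n m m' where ln: "l \<le> n" "\<And>d. Z d \<noteq> 0 \<Longrightarrow> l \<le> multiplicity 3 d \<and> multiplicity 3 d \<le> n"
    and m: "slice 3 l Z m \<noteq> 0" "slice 3 n Z m' \<noteq> 0"
    using slice_range[OF p fin32] by metis
  have int: "slice 3 i Z k \<in> \<int>" for i k using slice_int Z(2) by blast
  have fs: "fin_on (smooth {2}) (slice 3 i Z)" for i
    unfolding slice_def by (rule collapse_fin_on[OF p fin32])
  have ws: "weight (slice 3 i Z) = (if i = j then 1 else 0)" for i unfolding slice_def wc by simp
  have keep: "preserves_holo 3 (low 3 i)" "preserves_holo 3 (high 3 i)" "preserves_holo 3 (decay 3 i)" for i
    by (auto intro: low_preserves_holo high_preserves_holo decay_preserves_holo)
  have "l \<le> j \<and> j \<le> n"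
  proof (rule ccontr)
    assume "\<not> (l \<le> j \<and> j \<le> n)"
    then have "slice 3 j Z = (\<lambda>_. 0)" by (intro slice_beyond) (use ln(2) in fastforce)
    then show False using ws[of j] by (simp add: pairing_def)
  qed
  then have lj: "l \<le> j" and jn: "j \<le> n" by auto
  \<comment> \<open>One step further away the bound drops to 1/4.\<close>
  have small: "k = 0" if "2 / 3 \<le> 3 / 4 * (1 / 3 :: real) ^ k" for k
  proof (cases k)
    case (Suc i)
    have "(1/3::real) ^ i \<le> 1" by (simp add: power_le_one)
    then show ?thesis using that Suc by simp
  qed simp
  have lower: "j = l + 1 \<and> holo_diff {2} (slice 3 l Z) (3 / 4)" if lt: "l < j"
  proof -
    obtain k where k: "j = Suc l + k" using lt by (metis Suc_leI le_Suc_ex)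
    have "slice 3 l Z = (\<lambda>m. 3 / 2 * collapse 3 (low 3 l) Z m + (- 3 / 8) * collapse 3 (decay 3 (Suc l)) Z m)"
      by (rule slice_combination) (use low_decay_slice[of 3 l] ln(2) in simp)
    then have "holo_diff {2} (slice 3 l Z) (\<bar>3 / 2\<bar> * low 3 l j + \<bar>- 3 / 8\<bar> * decay 3 (Suc l) j)"
      using holo_diff_comb[OF hd[OF keep(1)[of l]] hd[OF keep(3)[of "Suc l"]], of "3/2" "-3/8"] by simp
    moreover have "low 3 l j = 1 / 4 * (1 / 3) ^ k" "decay 3 (Suc l) j = (1 / 3) ^ k"
      by (simp_all add: k low_def decay_def Suc_diff_le)
    ultimately have h: "holo_diff {2} (slice 3 l Z) (3 / 4 * (1 / 3) ^ k)" by simp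
    from small[OF norm_ge_two_thirds[OF Q h int m(1)]] h k show ?thesis by simp
  qed
  have upper: "n = j + 1 \<and> holo_diff {2} (slice 3 n Z) (3 / 4)" if lt: "j < n"
  proof -
    obtain k where k: "n = Suc (j + k)" using lt by (metis less_iff_Suc_add)
    have "slice 3 n Z = (\<lambda>m. 3 / 2 * collapse 3 (high 3 (j + k)) Z m + (- 3 / 8) * collapse 3 (decay 3 (j + k)) Z m)"
      by (rule slice_combination) (use high_decay_slice[of 3 _ "j + k"] ln(2) k in simp)
    then have "holo_diff {2} (slice 3 n Z) (\<bar>3 / 2\<bar> * high 3 (j + k) j + \<bar>- 3 / 8\<bar> * decay 3 (j + k) j)"
      using holo_diff_comb[OF hd[OF keep(2)[of "j + k"]] hd[OF keep(3)[of "j + k"]], of "3/2" "-3/8"] by simp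
    moreover have "high 3 (j + k) j = 1 / 4 * (1 / 3) ^ k" "decay 3 (j + k) j = (1 / 3) ^ k"
      by (simp_all add: high_beyond decay_def)
    ultimately have h: "holo_diff {2} (slice 3 n Z) (3 / 4 * (1 / 3) ^ k)" by simp
    from small[OF norm_ge_two_thirds[OF Q h int m(2)]] h k show ?thesis by simp
  qed
  have null: "\<exists>r x y z. slice 3 i Z = triple r x y z \<and> (x, y, z) \<in> null_triples"
    if "holo_diff {2} (slice 3 i Z) (3 / 4)" "i \<noteq> j" "slice 3 i Z k \<noteq> 0" for i k
  proof -
    have "weight (slice 3 i Z) = 0" using ws that(2) by simp
    from null_dyadic[OF that(1) int this that(3)] show ?thesis by metis
  qed
  have pos: "(2::nat) ^ r * 3 ^ l > 0" for r by simp
  let ?T = "slice 3 j Z"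
  have T: "fin_on (smooth {2}) ?T" "\<And>d. ?T d \<in> \<int>" "weight ?T = 1" using fs int ws by auto
  have bd: "l \<le> multiplicity 3 d \<and> multiplicity 3 d \<le> l + 2" if "Z d \<noteq> 0" for d
  proof -
    have "n \<le> l + 2" using lower upper lj jn by fastforce
    then show ?thesis using ln(2)[OF that] by simp
  qed
  have rc: "collapse 3 u Z = (\<lambda>m. u l * slice 3 l Z m + (u (l + 1) * slice 3 (l + 1) Z m + u (l + 2) * slice 3 (l + 2) Z m))"
    for u by (rule rows_collapse) (rule bd)
  consider "l = j" "n = j" | "l = j" "n = j + 1" | "j = l + 1" "n = j" | "j = l + 1" "n = j + 1"
  proof -
    have "l = j \<or> j = l + 1" "n = j \<or> n = j + 1" using lower upper lj jn by fastforce+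
    then show ?thesis using that by blast
  qed
  then show ?thesis
  proof cases
    case 1
    have v: "multiplicity 3 d = l" if "Z d \<noteq> 0" for d using ln(2)[OF that] 1 by simp
    have s: "slice 3 l Z = collapse 3 (\<lambda>_. 1) Z" unfolding slice_def by (rule collapse_cong) (use v in auto)
    then have "holo {2} ?T" using hc[OF one_preserves_holo[OF p]] 1 by simp
    then obtain r a b c where r: "?T = triple r a b c" "(a, b, c) \<in> unit_triples" using unit_dyadic T by metis
    have "slice 3 (l + 1) Z = triple r 0 0 0" using slice_beyond[of Z 3 "l + 1"] v by (auto simp: triple_def)
    then have "has_shape Z (2 ^ r * 3 ^ l) ((a, b, c), (0, 0, 0))"
      using v 1 r by (intro shape_of_rows fin) auto
    moreover have "((a, b, c), (0, 0, 0)) \<in> zagier_exponents"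
      using r(2) unfolding unit_triples_def zagier_exponents_def by (elim insertE emptyE Pair_inject; simp)
    ultimately show ?thesis using pos by blast
  next
    case 2
    have v: "multiplicity 3 d = l \<or> multiplicity 3 d = l + 1" if "Z d \<noteq> 0" for d using ln(2)[OF that] 2 by auto
    have z: "slice 3 (l + 2) Z = (\<lambda>_. 0)" by (rule slice_beyond) (use v in fastforce)
    obtain r x y z' where D: "slice 3 (l + 1) Z = triple r x y z'" "(x, y, z') \<in> null_triples"
      using null[of n m'] upper m(2) 2 by auto
    have h: "holo {2} (\<lambda>m. 1 * ?T m + 1 / 3 * triple r x y z' m)" "holo {2} (\<lambda>m. 1 / 3 * ?T m + 1 * triple r x y z' m)"
      using hc[OF keep(3)[of l]] hc[OF keep(3)[of "l + 1"]] unfolding rc z D(1) by (simp_all add: decay_def 2)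
    obtain a b c where "?T = triple r a b c" and mem: "((x, y, z'), (a, b, c)) \<in>
      {((1, -1, 0), (-1, 2, 0)), ((-1, 1, 0), (2, -1, 0)), ((1, -2, 1), (-2, 5, -2)), ((-1, 2, -1), (1, -1, 1))}"
      using unit_row_with_null_row[OF T D(2) h] by blast
    then have "has_shape Z (2 ^ r * 3 ^ l) ((a, b, c), (x, y, z'))"
      using v 2 D by (intro shape_of_rows fin) auto
    moreover have "((a, b, c), (x, y, z')) \<in> zagier_exponents"
      using mem unfolding zagier_exponents_def by (elim insertE emptyE Pair_inject; simp)
    ultimately show ?thesis using pos by blast
  next
    case 3
    have v: "multiplicity 3 d = l \<or> multiplicity 3 d = l + 1" if "Z d \<noteq> 0" for d using ln(2)[OF that] 3 by auto
    have z: "slice 3 (l + 2) Z = (\<lambda>_. 0)" by (rule slice_beyond) (use v in fastforce)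
    obtain r x y z' where D: "slice 3 l Z = triple r x y z'" "(x, y, z') \<in> null_triples"
      using null[of l m] lower m(1) 3 by auto
    have h: "holo {2} (\<lambda>m. 1 * ?T m + 1 / 3 * triple r x y z' m)" "holo {2} (\<lambda>m. 1 / 3 * ?T m + 1 * triple r x y z' m)"
      using hc[OF keep(3)[of l]] hc[OF keep(3)[of "l + 1"]] unfolding rc z D(1) 3 by (simp_all add: decay_def add.commute)
    obtain a b c where "?T = triple r a b c" and mem: "((x, y, z'), (a, b, c)) \<in>
      {((1, -1, 0), (-1, 2, 0)), ((-1, 1, 0), (2, -1, 0)), ((1, -2, 1), (-2, 5, -2)), ((-1, 2, -1), (1, -1, 1))}"
      using unit_row_with_null_row[OF T D(2) h] by blast
    then have "has_shape Z (2 ^ r * 3 ^ l) ((x, y, z'), (a, b, c))"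
      using v 3 D by (intro shape_of_rows fin) auto
    moreover have "((x, y, z'), (a, b, c)) \<in> zagier_exponents"
      using mem unfolding zagier_exponents_def by (elim insertE emptyE Pair_inject; simp)
    ultimately show ?thesis using pos by blast
  next
    case 4
    obtain r x y z where D: "slice 3 l Z = triple r x y z" "(x, y, z) \<in> null_triples"
      using null[of l m] lower m(1) 4 by auto
    obtain q x' y' z' where U: "slice 3 (l + 2) Z = triple q x' y' z'" "(x', y', z') \<in> null_triples"
      using null[of n m'] upper m(2) 4 by auto
    let ?D = "triple r x y z" and ?U = "triple q x' y' z'"
    have rc': "collapse 3 u Z = (\<lambda>m. u l * ?D m + (u (l + 1) * ?T m + u (l + 2) * ?U m))" for u
      using rc[of u] unfolding D(1) U(1) 4 by simp
    have tc: "dyadic_order i (\<lambda>m. a * ?D m + (b * ?T m + c * ?U m)) = a * dyadic_order i ?D + (b * dyadic_order i ?T + c * dyadic_order i ?U)"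
      for i a b c
      using dyadic_order_comb[OF fin_on_triple fin_on_comb[OF T(1) fin_on_triple], of i a r x y z 1 b c q x' y' z']
        dyadic_order_comb[OF T(1) fin_on_triple, of i b c q x' y' z'] by simp
    have nn: "0 \<le> u l * dyadic_order i ?D + (u (l + 1) * dyadic_order i ?T + u (l + 2) * dyadic_order i ?U)" if "preserves_holo 3 u" for u i
      using dyadic_order_nonneg[OF hc[OF that], of i] unfolding rc' tc .
    have E: "0 \<le> dyadic_order i ?T + dyadic_order i ?D / 3 + dyadic_order i ?U / 3" for i
      using nn[OF keep(3)[of "l + 1"], of i] by (simp add: decay_def)
    have F: "0 \<le> dyadic_order i ?T + 3 * dyadic_order i ?D + dyadic_order i ?U / 3" for i
      using nn[OF keep(3)[of l], of i] by (simp add: decay_def power_divide)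
    have G: "0 \<le> dyadic_order i ?T + dyadic_order i ?D / 3 + 3 * dyadic_order i ?U" for i
      using nn[OF keep(3)[of "l + 2"], of i] by (simp add: decay_def power_divide)
    define hE hF hG where "hE = collapse 3 (decay 3 (l + 1)) Z" and "hF = collapse 3 (decay 3 l) Z"
      and "hG = collapse 3 (decay 3 (l + 2)) Z"
    have H: "holo {2} hE" "holo {2} hF" "holo {2} hG" unfolding hE_def hF_def hG_def by (intro hc keep)+
    have val: "hE = (\<lambda>m. 1 / 3 * ?D m + (1 * ?T m + 1 / 3 * ?U m))" "hF = (\<lambda>m. 1 * ?D m + (1 / 3 * ?T m + 1 / 9 * ?U m))"
      "hG = (\<lambda>m. 1 / 9 * ?D m + (1 / 3 * ?T m + 1 * ?U m))"
      unfolding hE_def hF_def hG_def rc' by (simp_all add: decay_def power_divide)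
    \<comment> \<open>The kernels at the lower and upper row enter multiplied by 3, so these are the convex combinations with weights 1/8, 5/8 and 1/4.\<close>
    have "holo {2} (\<lambda>m. 1 * (1 / 8 * hE m + 15 / 8 * hF m) + 3 / 4 * hG m)"
      "holo {2} (\<lambda>m. 1 * (1 / 8 * hE m + 15 / 8 * hG m) + 3 / 4 * hF m)"
      by (intro holo_comb H; simp)+
    then have S: "holo {2} (\<lambda>m. 1 * ?T m + 1 * (2 * ?D m + 1 * ?U m))" "holo {2} (\<lambda>m. 1 * ?T m + 1 * (2 * ?U m + 1 * ?D m))"
      unfolding val by (simp_all add: algebra_simps)
    have Df: "fin_on (smooth {2}) ?D" "\<And>d. ?D d \<in> \<int>" "weight ?D = 0"
      and Uf: "fin_on (smooth {2}) ?U" "\<And>d. ?U d \<in> \<int>" "weight ?U = 0"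
      using fs[of l] int[of l] ws[of l] fs[of "l + 2"] int[of "l + 2"] ws[of "l + 2"] 4 unfolding D(1) U(1) by auto
    obtain a b c where 1: "(\<lambda>m. ?T m + ?D m + ?U m) = triple r a b c" "((x, y, z), (a, b, c)) \<in>
      {((1, -1, 0), (0, 1, 0)), ((-1, 1, 0), (1, 0, 0)), ((1, -2, 1), (-1, 3, -1)), ((-1, 2, -1), (0, 1, 0))}"
      using unit_row_beside_null_row[OF T D(2) Uf refl S(1) E F G] by blast
    obtain a' b' c' where 2: "(\<lambda>m. ?T m + ?U m + ?D m) = triple q a' b' c'" "((x', y', z'), (a', b', c')) \<in>
      {((1, -1, 0), (0, 1, 0)), ((-1, 1, 0), (1, 0, 0)), ((1, -2, 1), (-1, 3, -1)), ((-1, 2, -1), (0, 1, 0))}"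
      using unit_row_beside_null_row[OF T U(2) Df refl S(2)] E F G by (smt (verit) add.commute add.left_commute)
    show ?thesis using no_two_null_rows[OF D(2) U(2) 1(1) 2(1) T(1) 1(2) 2(2) E F G] ..
  qed
qed

lemma weight_half_exponents:
  assumes X: "holo Q X" "\<And>d. X d \<in> \<int>" "weight X = 1" and Q: "finite Q" "\<forall>q\<in>Q. prime q" "{2, 3} \<subseteq> Q"
  shows "\<exists>\<nu>>0. \<exists>t\<in>zagier_exponents. has_shape X \<nu> t"
proof -
  define P where "P = Q - {2, 3}"
  have "q \<ge> 5" if "prime q" "q \<noteq> 2" "q \<noteq> 3" for q :: nat
  proof -
    have "q \<ge> 2" "q \<noteq> 4" using that prime_ge_2_nat primes_dvd_imp_eq[of 2 q] by auto
    then show ?thesis using that by simp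
  qed
  then have P: "finite P" "\<forall>q\<in>P. prime q \<and> q \<ge> 5" "P \<union> {2, 3} = Q" using Q by (auto simp: P_def)
  obtain c where c: "c > 0" "\<And>d. X d \<noteq> 0 \<Longrightarrow> c dvd d" "holo {2, 3} (\<lambda>m. X (c * m))" "weight (\<lambda>m. X (c * m)) = 1"
    using reduce_to_2_3[OF P(1,2), of X] X P(3) by auto
  obtain \<nu> t where t: "\<nu> > 0" "t \<in> zagier_exponents" "has_shape (\<lambda>m. X (c * m)) \<nu> t"
    using classification_2_3[OF c(3) X(2) c(4)] by blast
  have "has_shape X (c * \<nu>) t"
    unfolding has_shape_def
  proof (intro conjI allI impI)
    fix d assume nz: "X d \<noteq> 0"
    then obtain k where k: "d = c * k" using c(2) by (auto elim: dvdE)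
    then have "\<exists>i\<in>{1, 2, 3, 4, 6, 12}. k = \<nu> * i" using t(3) nz unfolding has_shape_def by blast
    then show "\<exists>i\<in>{1, 2, 3, 4, 6, 12}. d = c * \<nu> * i" unfolding k by auto
  next
    show "((X (c * \<nu>), X (c * \<nu> * 2), X (c * \<nu> * 4)), X (c * \<nu> * 3), X (c * \<nu> * 6), X (c * \<nu> * 12)) = t"
      using t(3) unfolding has_shape_def mult.assoc by blast
  qed
  then show ?thesis using t c by (intro exI[of _ "c * \<nu>"]) auto
qed

section \<open>The classification\<close>

text \<open>Exponents are grouped by rows at the prime \<open>3\<close>, as in \<open>has_shape\<close>.\<close>

definition eta_product :: "(int \<times> int \<times> int) \<times> (int \<times> int \<times> int) \<Rightarrow> complex \<Rightarrow> complex" where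
  "eta_product = (\<lambda>((x1, x2, x4), (x3, x6, x12)) w.
     eta_resc 1 w powi x1 * eta_resc 2 w powi x2 * eta_resc 4 w powi x4 *
     (eta_resc 3 w powi x3 * eta_resc 6 w powi x6 * eta_resc 12 w powi x12))"

text \<open>The members of \<open>zagier_exponents\<close> as integers, in the order of \<open>zagier_list\<close>.\<close>

definition zagier_table :: "((int \<times> int \<times> int) \<times> (int \<times> int \<times> int)) list" where
  "zagier_table =
    [((1, 0, 0), (0, 0, 0)), ((2, -1, 0), (0, 0, 0)), ((-1, 2, 0), (0, 0, 0)),
     ((-1, 3, -1), (0, 0, 0)), ((-2, 5, -2), (0, 0, 0)), ((1, -1, 1), (0, 0, 0)),
     ((1, -1, 0), (-1, 2, 0)), ((2, -1, 0), (-1, 1, 0)), ((-1, 2, 0), (1, -1, 0)),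
     ((-1, 1, 0), (2, -1, 0)), ((-1, 2, -1), (1, -1, 1)), ((-2, 5, -2), (1, -2, 1)),
     ((1, -1, 1), (-1, 2, -1)), ((1, -2, 1), (-2, 5, -2))]"

lemma zagier_table_list: "list_all2 (\<lambda>t g. \<forall>w. eta_product t w = g w) zagier_table zagier_list"
  unfolding zagier_table_def zagier_list_def
  by (simp add: eta_product_def power_int_minus divide_inverse mult_ac)

lemma eta_quotient_of_shape:
  assumes X: "eta_exponents X" and s: "has_shape (\<lambda>d. real_of_int (X d)) \<nu> t" and nu: "\<nu> > 0"
  shows "eta_quotient X z = eta_product ((X \<nu>, X (\<nu> * 2), X (\<nu> * 4)), (X (\<nu> * 3), X (\<nu> * 6), X (\<nu> * 12))) (of_nat \<nu> * z)"
proof -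
  let ?K = "{1, 2, 3, 4, 6, 12::nat}"
  have sub: "{d. X d \<noteq> 0} \<subseteq> (\<lambda>k. \<nu> * k) ` ?K" using s unfolding has_shape_def by auto
  have "eta_quotient X z = (\<Prod>d\<in>(\<lambda>k. \<nu> * k) ` ?K. eta_resc d z powi X d)"
    unfolding eta_quotient_def by (rule prod.mono_neutral_left) (use sub in auto)
  also have "\<dots> = (\<Prod>k\<in>?K. eta_resc (\<nu> * k) z powi X (\<nu> * k))"
    by (subst prod.reindex) (use nu in \<open>auto simp: inj_on_def\<close>)
  also have "\<dots> = (\<Prod>k\<in>?K. eta_resc k (of_nat \<nu> * z) powi X (\<nu> * k))"
    by (intro prod.cong refl) (simp add: eta_resc_def mult_ac)
  finally show ?thesis by (simp add: eta_product_def mult_ac)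
qed

theorem theorem1:
  fixes X :: "nat \<Rightarrow> int"
  assumes "eta_exponents X"
    and "holomorphic_eta_quotient X"
    and "eta_weight X = 1 / 2"
  shows "\<exists>\<nu>::nat. \<nu> > 0 \<and>
           (\<exists>g \<in> set zagier_list. \<forall>z. Im z > 0 \<longrightarrow> eta_quotient X z = g (of_nat \<nu> * z))"
proof -
  define Q where "Q = {2, 3} \<union> (\<Union>d\<in>{d. X d \<noteq> 0}. prime_factors d)"
  define A where "A d = real_of_int (X d)" for d
  have supp: "{d. A d \<noteq> 0} = {d. X d \<noteq> 0}" by (simp add: A_def)
  have fin: "finite {d. X d \<noteq> 0}" and pos: "\<And>d. X d \<noteq> 0 \<Longrightarrow> d > 0"
    using assms(1) by (auto simp: eta_exponents_def intro: gr0I)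
  have Q: "finite Q" "\<forall>q\<in>Q. prime q" "{2, 3} \<subseteq> Q" using fin by (auto simp: Q_def)
  have "cusp_order A t = (\<Sum>d | X d \<noteq> 0. of_int (X d) * (real (gcd d t) ^ 2 / d))" for t
    unfolding cusp_order_def pairing_def supp by (simp add: A_def)
  moreover have "fin_on (smooth Q) A"
    unfolding fin_on_def supp using fin pos by (auto simp: smooth_def Q_def)
  ultimately have "holo Q A"
    using holomorphic_cusp_order_nonneg[OF assms(1,2)] by (simp add: holo_def)
  moreover have "A d \<in> \<int>" for d by (simp add: A_def)
  moreover have "weight A = 1"
    using assms(3) unfolding pairing_def supp eta_weight_def by (simp add: A_def)
  ultimately obtain \<nu> t where nu: "\<nu> > 0" "t \<in> zagier_exponents" "has_shape A \<nu> t"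
    using weight_half_exponents[OF _ _ _ Q] by blast
  let ?u = "((X \<nu>, X (\<nu> * 2), X (\<nu> * 4)), (X (\<nu> * 3), X (\<nu> * 6), X (\<nu> * 12)))"
  have "((A \<nu>, A (\<nu> * 2), A (\<nu> * 4)), (A (\<nu> * 3), A (\<nu> * 6), A (\<nu> * 12))) \<in> zagier_exponents"
    using nu(2,3) unfolding has_shape_def by blast
  then have "?u \<in> set zagier_table"
    unfolding zagier_exponents_def zagier_table_def A_def
    by (elim insertE emptyE Pair_inject; simp)
  then obtain i where i: "i < length zagier_table" "zagier_table ! i = ?u"
    by (auto simp: in_set_conv_nth simp del: prod.inject)
  have "zagier_list ! i \<in> set zagier_list"
    using i(1) list_all2_lengthD[OF zagier_table_list] by simp
  moreover have "eta_product ?u w = (zagier_list ! i) w" for w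
    using list_all2_nthD[OF zagier_table_list i(1)] unfolding i(2) by blast
  moreover have "eta_quotient X z = eta_product ?u (of_nat \<nu> * z)" for z
    using eta_quotient_of_shape[OF assms(1) _ nu(1)] nu(3) unfolding A_def[abs_def] by blast
  ultimately have "\<exists>g\<in>set zagier_list. \<forall>z. Im z > 0 \<longrightarrow> eta_quotient X z = g (of_nat \<nu> * z)"
    by (intro bexI[of _ "zagier_list ! i"]) (simp_all only: simp_thms)
  then show ?thesis using nu(1) by blast
qed

end
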